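(* Let $H$ be a Hopf algebra over a field $\Bbbk$ with bijective antipode, let $n$ be a positive integer, $\mathbb{I}_n=\{1,\ldots,n\}$, and let $R=({}_iM_j)_{i,j\in\mathbb{I}_n}$ be a generalized matrix algebra over $\Bbbk$ with diagonal algebras $R_i={}_iM_i$, whose unit elements are denoted $1_i$. The following assertions are equivalent: (i) there exists a left partial action $\rhd: H\otimes R\to R$ of $H$ on $R$ such that ${}_i\tilde M_j$ is $H$-invariant for all $i,j\in\mathbb{I}_n$; (ii) the following conditions hold: (a) for each $i\in\mathbb{I}_n$, there is a left partial action $\rightharpoonup_i: H\otimes R_i\to R_i$ of $H$ on $R_i$; (b) for all $i,j\in\mathbb{I}_n$, ${}_iM_j$ is a left $\underline{R_i\# H}$-module and a right $\underline{H^{\mathrm{op}}\# R_j}$-module (the partial smash products being formed with respect to the partial actions in (a)) such that $$(1_i\#h)\cdot m=m\cdot (h\#1_j),\qquad (1_i\#h)\cdot r=h\rightharpoonup_i r,$$ $$(r_i\#1_H)\cdot m=r_i\cdot m,\qquad m\cdot(1_H\# r_j)=m\cdot r_j,$$ for all $h\in H$, $m\in {}_iM_j$, $r,r_i\in R_i$, $r_j\in R_j$ and $i,j\in\mathbb{I}_n$ (in the second identity $r$ is regarded as an element of the left $\underline{R_i\# H}$-module ${}_iM_i=R_i$); (c) $(1_i\#h)\cdot mn=\big((1_i\#h_{(1)})\cdot m\big)\big((1_j\#h_{(2)})\cdot n\big)$ for all $h\in H$, $m\in{}_iM_j$, $n\in{}_jM_k$ and $i,j,k\in\mathbb{I}_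n$.
   Context: Conventions: $\Bbbk$ is a field; algebras are associative unital $\Bbbk$-algebras; vector spaces and tensor products are over $\Bbbk$; $\Delta(h)=h_{(1)}\otimes h_{(2)}$ is Sweedler notation. $H^{\mathrm{op}}$ is $H$ with the opposite multiplication $h\cdot_{\mathrm{op}}k=kh$ and the same comultiplication. Generalized matrix algebra: one is given vector spaces ${}_iM_j$ ($i,j\in\mathbb{I}_n$), linear maps $\theta_{ijk}:{}_iM_j\otimes{}_jM_k\to{}_iM_k$ and $\eta_i:\Bbbk\to{}_iM_i$ with $\theta_{ikl}\circ(\theta_{ijk}\otimes\mathrm{id})=\theta_{ijl}\circ(\mathrm{id}\otimes\theta_{jkl})$ and $\theta_{iij}\circ(\eta_i\otimes\mathrm{id})=\mathrm{id}=\theta_{ijj}\circ(\mathrm{id}\otimes\eta_j)$ on ${}_iM_j$. Then $R_i={}_iM_i$ is a unital algebra with unit $1_i=\eta_i(1)$, ${}_iM_j$ is an $(R_i,R_j)$-bimodule via $\theta_{iij},\theta_{ijj}$, and $R=\bigoplus_{i,j}{}_iM_j$ is a unital algebra of matrices $(x_{ij})$, $x_{ij}\in{}_iM_j$, with row-column multiplication using the products $mn:=\theta_{ijk}(m\otimes n)$; its unit is $\operatorname{diag}(1_1,\dots,1_n)$. Let $\iota_{ij}:{}_iM_j\to R$ be the natural inclusion (placing $m$ at entry $(i,j)$, zero elsewhere) and ${}_i\tilde M_j=\iota_{ij}({}_iM_j)$. Given a left partial action $\rhd$ of $H$ on $R$, ${}_i\tilde M_j$ is $H$-invariant if $h\rhd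 m\in{}_i\tilde M_j$ for all $h\in H$, $m\in{}_i\tilde M_j$. A left partial action (always meant symmetric) of $H$ on an algebra $A$ is a linear map $H\otimes A\to A$, $h\otimes a\mapsto h\cdot a$, such that for all $h,k\in H$, $a,b\in A$: $1_H\cdot a=a$; $h\cdot(ab)=(h_{(1)}\cdot a)(h_{(2)}\cdot b)$; $h\cdot(k\cdot a)=(h_{(1)}\cdot 1_A)(h_{(2)}k\cdot a)=(h_{(1)}k\cdot a)(h_{(2)}\cdot 1_A)$. A right partial action (symmetric) of a Hopf algebra $L$ on $A$ is a linear map $A\otimes L\to A$, $a\otimes h\mapsto a\cdot h$, with $a\cdot 1_L=a$; $(ab)\cdot h=(a\cdot h_{(1)})(b\cdot h_{(2)})$; $(a\cdot k)\cdot h=(a\cdot kh_{(1)})(1_A\cdot h_{(2)})=(1_A\cdot h_{(1)})(a\cdot kh_{(2)})$. A left partial action of $H$ on $A$ gives a right partial action of $H^{\mathrm{op}}$ on $A$ by $a\triangleleft h=h\cdot a$. Left partial smash product: $A\otimes H$ has the associative product $(a\otimes h)(b\otimes k)=a(h_{(1)}\cdot b)\otimes h_{(2)}k$; $\underline{A\#H}=(A\otimes H)(1_A\otimes 1_H)$ is the unital algebra spanned by $a\#h=a(h_{(1)}\cdot 1_A)\otimes h_{(2)}$, with unit $1_A\#1_H$. Right partial smash product, for a right partial action of $L$ on $A$: $L\otimes A$ has the associative product $(k\otimes b)(h\otimes a)=kh_{(1)}\otimes(b\cdot h_{(2)})a$; $\underline{L\#A}=(1_L\otimes 1_A)(L\otimes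 A)$ is the unital algebra spanned by $h\#a=h_{(1)}\otimes(1_A\cdot h_{(2)})a$, with unit $1_L\#1_A$. In the claim, $\underline{R_i\#H}$ is formed with $\rightharpoonup_i$, and $\underline{H^{\mathrm{op}}\#R_j}$ with $L=H^{\mathrm{op}}$ and the right partial action $r\triangleleft h=h\rightharpoonup_j r$. *)

theory Defs
  imports "HOL-Algebra.Module" "HOL-Algebra.AbelCoset"
begin

text \<open>
  Vector spaces over a field \<open>K\<close> are \<open>module K V\<close>; for these the \<open>mult\<close> and \<open>one\<close> fields of the
  record \<open>V\<close> are irrelevant. Algebras use all fields. A linear map out of a tensor
  product \<open>U \<otimes> V\<close> is given, via the universal property, by the corresponding curried bilinear
  map on \<open>U \<times> V\<close>. The values of linear and bilinear maps outside the carriers are irrelevant.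
\<close>

section \<open>Linear algebra\<close>

definition linear_map ::
  "('k, 'r) ring_scheme \<Rightarrow> ('k, 'u, 'x) module_scheme \<Rightarrow> ('k, 'v, 'y) module_scheme \<Rightarrow> ('u \<Rightarrow> 'v) \<Rightarrow> bool"
  where "linear_map K U V f \<longleftrightarrow>
    f \<in> carrier U \<rightarrow> carrier V \<and>
    (\<forall>x\<in>carrier U. \<forall>y\<in>carrier U. f (x \<oplus>\<^bsub>U\<^esub> y) = f x \<oplus>\<^bsub>V\<^esub> f y) \<and>
    (\<forall>c\<in>carrier K. \<forall>x\<in>carrier U. f (c \<odot>\<^bsub>U\<^esub> x) = c \<odot>\<^bsub>V\<^esub> f x)"

definition bilinear_map ::
  "('k, 'r) ring_scheme \<Rightarrow> ('k, 'u, 'x) module_scheme \<Rightarrow> ('k, 'v, 'y) module_scheme \<Rightarrow>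
    ('k, 'w, 'z) module_scheme \<Rightarrow> ('u \<Rightarrow> 'v \<Rightarrow> 'w) \<Rightarrow> bool"
  where "bilinear_map K U V W f \<longleftrightarrow>
    (\<forall>u\<in>carrier U. linear_map K V W (f u)) \<and>
    (\<forall>v\<in>carrier V. linear_map K U W (\<lambda>u. f u v))"

definition base_algebra :: "('k, 'r) ring_scheme \<Rightarrow> ('k, 'k) module"
  where "base_algebra K =
    \<lparr>carrier = carrier K, mult = mult K, one = \<one>\<^bsub>K\<^esub>, zero = \<zero>\<^bsub>K\<^esub>, add = add K, smult = mult K\<rparr>"

definition free_module :: "('k, 'r) ring_scheme \<Rightarrow> 'a set \<Rightarrow> ('k, 'a \<Rightarrow> 'k) module"
  where "free_module K X =
    \<lparr>carrier = {x. x \<in> UNIV \<rightarrow> carrier K \<and> finite {p. x p \<noteq> \<zero>\<^bsub>K\<^esub>} \<and> {p. x p \<noteq> \<zero>\<^bsub>K\<^esub>} \<subseteq> X},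
     mult = undefined, one = undefined,
     zero = (\<lambda>p. \<zero>\<^bsub>K\<^esub>),
     add = (\<lambda>x y p. x p \<oplus>\<^bsub>K\<^esub> y p),
     smult = (\<lambda>c x p. c \<otimes>\<^bsub>K\<^esub> x p)\<rparr>"

definition free_gen :: "('k, 'r) ring_scheme \<Rightarrow> 'a \<Rightarrow> 'a \<Rightarrow> 'k"
  where "free_gen K p = (\<lambda>q. if q = p then \<one>\<^bsub>K\<^esub> else \<zero>\<^bsub>K\<^esub>)"


section \<open>Tensor products\<close>

abbreviation (input) free_on_pairs ::
  "('k, 'r) ring_scheme \<Rightarrow> ('k, 'u, 'x) module_scheme \<Rightarrow> ('k, 'v, 'y) module_scheme \<Rightarrow> ('k, 'u \<times> 'v \<Rightarrow> 'k) module"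
  where "free_on_pairs K U V \<equiv> free_module K (carrier U \<times> carrier V)"

definition tensor_relators ::
  "('k, 'r) ring_scheme \<Rightarrow> ('k, 'u, 'x) module_scheme \<Rightarrow> ('k, 'v, 'y) module_scheme \<Rightarrow> ('u \<times> 'v \<Rightarrow> 'k) set"
  where "tensor_relators K U V = (let F = free_on_pairs K U V; \<delta> = free_gen K in
      {\<delta> (u \<oplus>\<^bsub>U\<^esub> u', v) \<ominus>\<^bsub>F\<^esub> (\<delta> (u, v) \<oplus>\<^bsub>F\<^esub> \<delta> (u', v)) | u u' v.
         u \<in> carrier U \<and> u' \<in> carrier U \<and> v \<in> carrier V}
    \<union> {\<delta> (u, v \<oplus>\<^bsub>V\<^esub> v') \<ominus>\<^bsub>F\<^esub> (\<delta> (u, v) \<oplus>\<^bsub>F\<^esub> \<delta> (u, v')) | u v v'.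
         u \<in> carrier U \<and> v \<in> carrier V \<and> v' \<in> carrier V}
    \<union> {\<delta> (c \<odot>\<^bsub>U\<^esub> u, v) \<ominus>\<^bsub>F\<^esub> c \<odot>\<^bsub>F\<^esub> \<delta> (u, v) | c u v.
         c \<in> carrier K \<and> u \<in> carrier U \<and> v \<in> carrier V}
    \<union> {\<delta> (u, c \<odot>\<^bsub>V\<^esub> v) \<ominus>\<^bsub>F\<^esub> c \<odot>\<^bsub>F\<^esub> \<delta> (u, v) | c u v.
         c \<in> carrier K \<and> u \<in> carrier U \<and> v \<in> carrier V})"

definition tensor_kernel ::
  "('k, 'r) ring_scheme \<Rightarrow> ('k, 'u, 'x) module_scheme \<Rightarrow> ('k, 'v, 'y) module_scheme \<Rightarrow> ('u \<times> 'v \<Rightarrow> 'k) set"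
  where "tensor_kernel K U V =
    \<Inter> {N. submodule N K (free_on_pairs K U V) \<and> tensor_relators K U V \<subseteq> N}"

definition tensor_product ::
  "('k, 'r) ring_scheme \<Rightarrow> ('k, 'u, 'x) module_scheme \<Rightarrow> ('k, 'v, 'y) module_scheme \<Rightarrow>
    ('k, ('u \<times> 'v \<Rightarrow> 'k) set) module"
  where "tensor_product K U V = (let F = free_on_pairs K U V; N = tensor_kernel K U V in
    \<lparr>carrier = a_rcosets\<^bsub>F\<^esub> N,
     mult = undefined, one = undefined,
     zero = N,
     add = set_add F,
     smult = (\<lambda>c A. \<Union>x\<in>A. N +>\<^bsub>F\<^esub> (c \<odot>\<^bsub>F\<^esub> x))\<rparr>)"

definition pure_tensor ::
  "('k, 'r) ring_scheme \<Rightarrow> ('k, 'u, 'x) module_scheme \<Rightarrow> ('k, 'v, 'y) module_scheme \<Rightarrow>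
    'u \<Rightarrow> 'v \<Rightarrow> ('u \<times> 'v \<Rightarrow> 'k) set"
  where "pure_tensor K U V u v = tensor_kernel K U V +>\<^bsub>free_on_pairs K U V\<^esub> free_gen K (u, v)"

text \<open>
  For bilinear \<open>f : U \<times> V \<rightarrow> W\<close>, the linear map \<open>U \<otimes> V \<rightarrow> W\<close> with \<open>u \<otimes> v \<mapsto> f u v\<close>; bilinearity of \<open>f\<close>
  makes the value independent of the chosen representative.
\<close>

definition tensor_lift ::
  "('k, 'r) ring_scheme \<Rightarrow> ('k, 'u, 'x) module_scheme \<Rightarrow> ('k, 'v, 'y) module_scheme \<Rightarrow>
    ('k, 'w, 'z) module_scheme \<Rightarrow> ('u \<Rightarrow> 'v \<Rightarrow> 'w) \<Rightarrow> ('u \<times> 'v \<Rightarrow> 'k) set \<Rightarrow> 'w"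
  where "tensor_lift K U V W f t = (let x = (SOME x. x \<in> t) in
    (\<Oplus>\<^bsub>W\<^esub>p\<in>{p. x p \<noteq> \<zero>\<^bsub>K\<^esub>}. x p \<odot>\<^bsub>W\<^esub> f (fst p) (snd p)))"


section \<open>Algebras and Hopf algebras\<close>

text \<open>Unlike \<open>algebra\<close> from the library, multiplication need not be commutative.\<close>

locale assoc_algebra = field K + module K A + ring A for K (structure) and A (structure) +
  assumes smult_mult_left:
      "\<lbrakk>c \<in> carrier K; x \<in> carrier A; y \<in> carrier A\<rbrakk> \<Longrightarrow> (c \<odot>\<^bsub>A\<^esub> x) \<otimes>\<^bsub>A\<^esub> y = c \<odot>\<^bsub>A\<^esub> (x \<otimes>\<^bsub>A\<^esub> y)"
    and smult_mult_right:
      "\<lbrakk>c \<in> carrier K; x \<in> carrier A; y \<in> carrier A\<rbrakk> \<Longrightarrow> x \<otimes>\<^bsub>A\<^esub> (c \<odot>\<^bsub>A\<^esub> y) = c \<odot>\<^bsub>A\<^esub> (x \<otimes>\<^bsub>A\<^esub> y)"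

definition algebra_hom ::
  "('k, 'r) ring_scheme \<Rightarrow> ('k, 'a, 'x) module_scheme \<Rightarrow> ('k, 'b, 'y) module_scheme \<Rightarrow> ('a \<Rightarrow> 'b) \<Rightarrow> bool"
  where "algebra_hom K A B f \<longleftrightarrow>
    linear_map K A B f \<and>
    (\<forall>x\<in>carrier A. \<forall>y\<in>carrier A. f (x \<otimes>\<^bsub>A\<^esub> y) = f x \<otimes>\<^bsub>B\<^esub> f y) \<and>
    f \<one>\<^bsub>A\<^esub> = \<one>\<^bsub>B\<^esub>"

definition op_algebra :: "('k, 'a) module \<Rightarrow> ('k, 'a) module"
  where "op_algebra A = A\<lparr>mult := (\<lambda>x y. y \<otimes>\<^bsub>A\<^esub> x)\<rparr>"

definition tensor_algebra ::
  "('k, 'r) ring_scheme \<Rightarrow> ('k, 'a, 'x) module_scheme \<Rightarrow> ('k, 'b, 'y) module_scheme \<Rightarrow>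
    ('k, ('a \<times> 'b \<Rightarrow> 'k) set) module"
  where "tensor_algebra K A B = (let T = tensor_product K A B; tens = pure_tensor K A B in
    T\<lparr>mult := (\<lambda>x y. tensor_lift K A B T (\<lambda>a b.
                 tensor_lift K A B T (\<lambda>a' b'. tens (a \<otimes>\<^bsub>A\<^esub> a') (b \<otimes>\<^bsub>B\<^esub> b')) y) x),
      one := tens \<one>\<^bsub>A\<^esub> \<one>\<^bsub>B\<^esub>\<rparr>)"

text \<open>
  \<open>sweedler K H \<Delta> W f h\<close> is the element of \<open>W\<close> that Sweedler notation writes as
  \<open>f(h\<^sub>(\<^sub>1\<^sub>), h\<^sub>(\<^sub>2\<^sub>))\<close>, for bilinear \<open>f : H \<times> H \<rightarrow> W\<close>.
\<close>

definition sweedler ::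
  "('k, 'r) ring_scheme \<Rightarrow> ('k, 'h, 'x) module_scheme \<Rightarrow> ('h \<Rightarrow> ('h \<times> 'h \<Rightarrow> 'k) set) \<Rightarrow>
    ('k, 'w, 'z) module_scheme \<Rightarrow> ('h \<Rightarrow> 'h \<Rightarrow> 'w) \<Rightarrow> 'h \<Rightarrow> 'w"
  where "sweedler K H \<Delta> W f h = tensor_lift K H H W f (\<Delta> h)"

text \<open>
  In \<open>coassociative\<close> both sides live in \<open>(H \<otimes> H) \<otimes> H\<close>; the right-hand side is
  \<open>(id \<otimes> \<Delta>) (\<Delta> h)\<close> transported along \<open>a \<otimes> (b \<otimes> c) \<mapsto> (a \<otimes> b) \<otimes> c\<close>.
\<close>

locale hopf_algebra = assoc_algebra K H for K :: "'k ring" and H :: "('k, 'h) module" +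
  fixes \<Delta> :: "'h \<Rightarrow> ('h \<times> 'h \<Rightarrow> 'k) set" and \<epsilon> :: "'h \<Rightarrow> 'k" and S :: "'h \<Rightarrow> 'h"
  assumes comult_hom: "algebra_hom K H (tensor_algebra K H H) \<Delta>"
    and counit_hom: "algebra_hom K H (base_algebra K) \<epsilon>"
    and antipode_linear: "linear_map K H H S"
    and coassociative: "h \<in> carrier H \<Longrightarrow>
      (let HH = tensor_product K H H; HHH = tensor_product K HH H in
        sweedler K H \<Delta> HHH (\<lambda>a b. pure_tensor K HH H (\<Delta> a) b) h =
        sweedler K H \<Delta> HHH (\<lambda>a b.
          sweedler K H \<Delta> HHH (\<lambda>b\<^sub>1 b\<^sub>2. pure_tensor K HH H (pure_tensor K H H a b\<^sub>1) b\<^sub>2) b) h)"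
    and counit_left: "h \<in> carrier H \<Longrightarrow> sweedler K H \<Delta> H (\<lambda>a b. \<epsilon> a \<odot>\<^bsub>H\<^esub> b) h = h"
    and counit_right: "h \<in> carrier H \<Longrightarrow> sweedler K H \<Delta> H (\<lambda>a b. \<epsilon> b \<odot>\<^bsub>H\<^esub> a) h = h"
    and antipode_left: "h \<in> carrier H \<Longrightarrow> sweedler K H \<Delta> H (\<lambda>a b. S a \<otimes>\<^bsub>H\<^esub> b) h = \<epsilon> h \<odot>\<^bsub>H\<^esub> \<one>\<^bsub>H\<^esub>"
    and antipode_right: "h \<in> carrier H \<Longrightarrow> sweedler K H \<Delta> H (\<lambda>a b. a \<otimes>\<^bsub>H\<^esub> S b) h = \<epsilon> h \<odot>\<^bsub>H\<^esub> \<one>\<^bsub>H\<^esub>"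


section \<open>Modules over algebras\<close>

definition left_module_over ::
  "('k, 'r) ring_scheme \<Rightarrow> ('k, 'b, 'x) module_scheme \<Rightarrow> ('k, 'v, 'y) module_scheme \<Rightarrow> ('b \<Rightarrow> 'v \<Rightarrow> 'v) \<Rightarrow> bool"
  where "left_module_over K B V act \<longleftrightarrow>
    bilinear_map K B V V act \<and>
    (\<forall>x\<in>carrier B. \<forall>y\<in>carrier B. \<forall>m\<in>carrier V. act (x \<otimes>\<^bsub>B\<^esub> y) m = act x (act y m)) \<and>
    (\<forall>m\<in>carrier V. act \<one>\<^bsub>B\<^esub> m = m)"

definition right_module_over ::
  "('k, 'r) ring_scheme \<Rightarrow> ('k, 'b, 'x) module_scheme \<Rightarrow> ('k, 'v, 'y) module_scheme \<Rightarrow> ('v \<Rightarrow> 'b \<Rightarrow> 'v) \<Rightarrow> bool"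
  where "right_module_over K B V act \<longleftrightarrow>
    bilinear_map K V B V act \<and>
    (\<forall>x\<in>carrier B. \<forall>y\<in>carrier B. \<forall>m\<in>carrier V. act m (x \<otimes>\<^bsub>B\<^esub> y) = act (act m x) y) \<and>
    (\<forall>m\<in>carrier V. act m \<one>\<^bsub>B\<^esub> = m)"


section \<open>Partial actions and partial smash products\<close>

text \<open>Partial actions are always symmetric; \<open>act h a\<close> is \<open>h \<cdot> a\<close>.\<close>

definition left_partial_action ::
  "('k, 'r) ring_scheme \<Rightarrow> ('k, 'h) module \<Rightarrow> ('h \<Rightarrow> ('h \<times> 'h \<Rightarrow> 'k) set) \<Rightarrow> ('k, 'a) module \<Rightarrow>
    ('h \<Rightarrow> 'a \<Rightarrow> 'a) \<Rightarrow> bool"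
  where "left_partial_action K H \<Delta> A act \<longleftrightarrow>
    bilinear_map K H A A act \<and>
    (\<forall>a\<in>carrier A. act \<one>\<^bsub>H\<^esub> a = a) \<and>
    (\<forall>h\<in>carrier H. \<forall>a\<in>carrier A. \<forall>b\<in>carrier A.
      act h (a \<otimes>\<^bsub>A\<^esub> b) = sweedler K H \<Delta> A (\<lambda>h\<^sub>1 h\<^sub>2. act h\<^sub>1 a \<otimes>\<^bsub>A\<^esub> act h\<^sub>2 b) h) \<and>
    (\<forall>h\<in>carrier H. \<forall>k\<in>carrier H. \<forall>a\<in>carrier A.
      act h (act k a) = sweedler K H \<Delta> A (\<lambda>h\<^sub>1 h\<^sub>2. act h\<^sub>1 \<one>\<^bsub>A\<^esub> \<otimes>\<^bsub>A\<^esub> act (h\<^sub>2 \<otimes>\<^bsub>H\<^esub> k) a) h \<and>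
      act h (act k a) = sweedler K H \<Delta> A (\<lambda>h\<^sub>1 h\<^sub>2. act (h\<^sub>1 \<otimes>\<^bsub>H\<^esub> k) a \<otimes>\<^bsub>A\<^esub> act h\<^sub>2 \<one>\<^bsub>A\<^esub>) h)"

text \<open>
  The algebra \<open>A \<otimes> H\<close> with \<open>(a \<otimes> h)(b \<otimes> k) = a(h\<^sub>(\<^sub>1\<^sub>) \<cdot> b) \<otimes> h\<^sub>(\<^sub>2\<^sub>)k\<close> is not unital in
  general; its \<open>one\<close> field is left unspecified. The element \<open>a # h\<close> is \<open>left_hash \<dots> a h\<close>.
\<close>

definition left_smash_ambient ::
  "('k, 'r) ring_scheme \<Rightarrow> ('k, 'h) module \<Rightarrow> ('h \<Rightarrow> ('h \<times> 'h \<Rightarrow> 'k) set) \<Rightarrow> ('k, 'a) module \<Rightarrow>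
    ('h \<Rightarrow> 'a \<Rightarrow> 'a) \<Rightarrow> ('k, ('a \<times> 'h \<Rightarrow> 'k) set) module"
  where "left_smash_ambient K H \<Delta> A act =
    (let T = tensor_product K A H; tens = pure_tensor K A H in
    T\<lparr>mult := (\<lambda>x y. tensor_lift K A H T (\<lambda>a h. tensor_lift K A H T (\<lambda>b k.
        sweedler K H \<Delta> T (\<lambda>h\<^sub>1 h\<^sub>2. tens (a \<otimes>\<^bsub>A\<^esub> act h\<^sub>1 b) (h\<^sub>2 \<otimes>\<^bsub>H\<^esub> k)) h) y) x)\<rparr>)"

definition left_hash ::
  "('k, 'r) ring_scheme \<Rightarrow> ('k, 'h) module \<Rightarrow> ('h \<Rightarrow> ('h \<times> 'h \<Rightarrow> 'k) set) \<Rightarrow> ('k, 'a) module \<Rightarrow>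
    ('h \<Rightarrow> 'a \<Rightarrow> 'a) \<Rightarrow> 'a \<Rightarrow> 'h \<Rightarrow> ('a \<times> 'h \<Rightarrow> 'k) set"
  where "left_hash K H \<Delta> A act a h = sweedler K H \<Delta> (tensor_product K A H)
    (\<lambda>h\<^sub>1 h\<^sub>2. pure_tensor K A H (a \<otimes>\<^bsub>A\<^esub> act h\<^sub>1 \<one>\<^bsub>A\<^esub>) h\<^sub>2) h"

definition left_smash ::
  "('k, 'r) ring_scheme \<Rightarrow> ('k, 'h) module \<Rightarrow> ('h \<Rightarrow> ('h \<times> 'h \<Rightarrow> 'k) set) \<Rightarrow> ('k, 'a) module \<Rightarrow>
    ('h \<Rightarrow> 'a \<Rightarrow> 'a) \<Rightarrow> ('k, ('a \<times> 'h \<Rightarrow> 'k) set) module"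
  where "left_smash K H \<Delta> A act = (let P = left_smash_ambient K H \<Delta> A act in
    P\<lparr>carrier := (\<lambda>x. x \<otimes>\<^bsub>P\<^esub> pure_tensor K A H \<one>\<^bsub>A\<^esub> \<one>\<^bsub>H\<^esub>) ` carrier P,
      one := left_hash K H \<Delta> A act \<one>\<^bsub>A\<^esub> \<one>\<^bsub>H\<^esub>\<rparr>)"

text \<open>
  The right-handed versions take a right partial action of \<open>L\<close> on \<open>A\<close>, with \<open>act a h\<close> for \<open>a \<cdot> h\<close>;
  the product on \<open>L \<otimes> A\<close> is \<open>(k \<otimes> b)(h \<otimes> a) = kh\<^sub>(\<^sub>1\<^sub>) \<otimes> (b \<cdot> h\<^sub>(\<^sub>2\<^sub>))a\<close>. If \<open>H\<close> acts partially on \<open>A\<close> from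
  the left by \<open>act\<close>, then \<open>\<lambda>a h. act h a\<close> is a right partial action of \<open>op_algebra H\<close> on \<open>A\<close>.
\<close>

definition right_partial_action ::
  "('k, 'r) ring_scheme \<Rightarrow> ('k, 'h) module \<Rightarrow> ('h \<Rightarrow> ('h \<times> 'h \<Rightarrow> 'k) set) \<Rightarrow> ('k, 'a) module \<Rightarrow>
    ('a \<Rightarrow> 'h \<Rightarrow> 'a) \<Rightarrow> bool"
  where "right_partial_action K L \<Delta> A act \<longleftrightarrow>
    bilinear_map K A L A act \<and>
    (\<forall>a\<in>carrier A. act a \<one>\<^bsub>L\<^esub> = a) \<and>
    (\<forall>h\<in>carrier L. \<forall>a\<in>carrier A. \<forall>b\<in>carrier A.
      act (a \<otimes>\<^bsub>A\<^esub> b) h = sweedler K L \<Delta> A (\<lambda>h\<^sub>1 h\<^sub>2. act a h\<^sub>1 \<otimes>\<^bsub>A\<^esub> act b h\<^sub>2) h) \<and>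
    (\<forall>h\<in>carrier L. \<forall>k\<in>carrier L. \<forall>a\<in>carrier A.
      act (act a k) h = sweedler K L \<Delta> A (\<lambda>h\<^sub>1 h\<^sub>2. act a (k \<otimes>\<^bsub>L\<^esub> h\<^sub>1) \<otimes>\<^bsub>A\<^esub> act \<one>\<^bsub>A\<^esub> h\<^sub>2) h \<and>
      act (act a k) h = sweedler K L \<Delta> A (\<lambda>h\<^sub>1 h\<^sub>2. act \<one>\<^bsub>A\<^esub> h\<^sub>1 \<otimes>\<^bsub>A\<^esub> act a (k \<otimes>\<^bsub>L\<^esub> h\<^sub>2)) h)"

definition right_smash_ambient ::
  "('k, 'r) ring_scheme \<Rightarrow> ('k, 'h) module \<Rightarrow> ('h \<Rightarrow> ('h \<times> 'h \<Rightarrow> 'k) set) \<Rightarrow> ('k, 'a) module \<Rightarrow>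
    ('a \<Rightarrow> 'h \<Rightarrow> 'a) \<Rightarrow> ('k, ('h \<times> 'a \<Rightarrow> 'k) set) module"
  where "right_smash_ambient K L \<Delta> A act =
    (let T = tensor_product K L A; tens = pure_tensor K L A in
    T\<lparr>mult := (\<lambda>x y. tensor_lift K L A T (\<lambda>k b. tensor_lift K L A T (\<lambda>h a.
        sweedler K L \<Delta> T (\<lambda>h\<^sub>1 h\<^sub>2. tens (k \<otimes>\<^bsub>L\<^esub> h\<^sub>1) (act b h\<^sub>2 \<otimes>\<^bsub>A\<^esub> a)) h) y) x)\<rparr>)"

definition right_hash ::
  "('k, 'r) ring_scheme \<Rightarrow> ('k, 'h) module \<Rightarrow> ('h \<Rightarrow> ('h \<times> 'h \<Rightarrow> 'k) set) \<Rightarrow> ('k, 'a) module \<Rightarrow>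
    ('a \<Rightarrow> 'h \<Rightarrow> 'a) \<Rightarrow> 'h \<Rightarrow> 'a \<Rightarrow> ('h \<times> 'a \<Rightarrow> 'k) set"
  where "right_hash K L \<Delta> A act h a = sweedler K L \<Delta> (tensor_product K L A)
    (\<lambda>h\<^sub>1 h\<^sub>2. pure_tensor K L A h\<^sub>1 (act \<one>\<^bsub>A\<^esub> h\<^sub>2 \<otimes>\<^bsub>A\<^esub> a)) h"

definition right_smash ::
  "('k, 'r) ring_scheme \<Rightarrow> ('k, 'h) module \<Rightarrow> ('h \<Rightarrow> ('h \<times> 'h \<Rightarrow> 'k) set) \<Rightarrow> ('k, 'a) module \<Rightarrow>
    ('a \<Rightarrow> 'h \<Rightarrow> 'a) \<Rightarrow> ('k, ('h \<times> 'a \<Rightarrow> 'k) set) module"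
  where "right_smash K L \<Delta> A act = (let P = right_smash_ambient K L \<Delta> A act in
    P\<lparr>carrier := (\<lambda>x. pure_tensor K L A \<one>\<^bsub>L\<^esub> \<one>\<^bsub>A\<^esub> \<otimes>\<^bsub>P\<^esub> x) ` carrier P,
      one := right_hash K L \<Delta> A act \<one>\<^bsub>L\<^esub> \<one>\<^bsub>A\<^esub>\<rparr>)"


section \<open>Generalized matrix algebras\<close>

locale generalized_matrix_algebra = field K for K :: "'k ring" (structure) +
  fixes n :: nat
    and M :: "nat \<Rightarrow> nat \<Rightarrow> ('k, 'm) module"
    and \<theta> :: "nat \<Rightarrow> nat \<Rightarrow> nat \<Rightarrow> 'm \<Rightarrow> 'm \<Rightarrow> 'm"
    and \<eta> :: "nat \<Rightarrow> 'k \<Rightarrow> 'm"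
  assumes vector_space: "\<lbrakk>i \<in> {1..n}; j \<in> {1..n}\<rbrakk> \<Longrightarrow> module K (M i j)"
    and theta_bilinear: "\<lbrakk>i \<in> {1..n}; j \<in> {1..n}; k \<in> {1..n}\<rbrakk> \<Longrightarrow>
      bilinear_map K (M i j) (M j k) (M i k) (\<theta> i j k)"
    and eta_linear: "i \<in> {1..n} \<Longrightarrow> linear_map K (base_algebra K) (M i i) (\<eta> i)"
    and theta_assoc: "\<lbrakk>i \<in> {1..n}; j \<in> {1..n}; k \<in> {1..n}; l \<in> {1..n};
      x \<in> carrier (M i j); y \<in> carrier (M j k); z \<in> carrier (M k l)\<rbrakk> \<Longrightarrow>
      \<theta> i k l (\<theta> i j k x y) z = \<theta> i j l x (\<theta> j k l y z)"
    and eta_left: "\<lbrakk>i \<in> {1..n}; j \<in> {1..n}; c \<in> carrier K; m \<in> carrier (M i j)\<rbrakk> \<Longrightarrow>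
      \<theta> i i j (\<eta> i c) m = c \<odot>\<^bsub>M i j\<^esub> m"
    and eta_right: "\<lbrakk>i \<in> {1..n}; j \<in> {1..n}; c \<in> carrier K; m \<in> carrier (M i j)\<rbrakk> \<Longrightarrow>
      \<theta> i j j m (\<eta> j c) = c \<odot>\<^bsub>M i j\<^esub> m"

definition diag_algebra ::
  "'k ring \<Rightarrow> (nat \<Rightarrow> nat \<Rightarrow> ('k, 'm) module) \<Rightarrow> (nat \<Rightarrow> nat \<Rightarrow> nat \<Rightarrow> 'm \<Rightarrow> 'm \<Rightarrow> 'm) \<Rightarrow>
    (nat \<Rightarrow> 'k \<Rightarrow> 'm) \<Rightarrow> nat \<Rightarrow> ('k, 'm) module"
  where "diag_algebra K M \<theta> \<eta> i = (M i i)\<lparr>mult := \<theta> i i i, one := \<eta> i \<one>\<^bsub>K\<^esub>\<rparr>"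

text \<open>Matrices are extensional functions on \<open>{1..n} \<times> {1..n}\<close>.\<close>

definition matrix_algebra ::
  "'k ring \<Rightarrow> nat \<Rightarrow> (nat \<Rightarrow> nat \<Rightarrow> ('k, 'm) module) \<Rightarrow> (nat \<Rightarrow> nat \<Rightarrow> nat \<Rightarrow> 'm \<Rightarrow> 'm \<Rightarrow> 'm) \<Rightarrow>
    (nat \<Rightarrow> 'k \<Rightarrow> 'm) \<Rightarrow> ('k, nat \<times> nat \<Rightarrow> 'm) module"
  where "matrix_algebra K n M \<theta> \<eta> = (let I = {1..n} in
    \<lparr>carrier = (\<Pi>\<^sub>E (i, j)\<in>I \<times> I. carrier (M i j)),
     mult = (\<lambda>x y. \<lambda>(i, j)\<in>I \<times> I. \<Oplus>\<^bsub>M i j\<^esub>k\<in>I. \<theta> i k j (x (i, k)) (y (k, j))),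
     one = (\<lambda>(i, j)\<in>I \<times> I. if i = j then \<eta> i \<one>\<^bsub>K\<^esub> else \<zero>\<^bsub>M i j\<^esub>),
     zero = (\<lambda>(i, j)\<in>I \<times> I. \<zero>\<^bsub>M i j\<^esub>),
     add = (\<lambda>x y. \<lambda>(i, j)\<in>I \<times> I. x (i, j) \<oplus>\<^bsub>M i j\<^esub> y (i, j)),
     smult = (\<lambda>c x. \<lambda>(i, j)\<in>I \<times> I. c \<odot>\<^bsub>M i j\<^esub> x (i, j))\<rparr>)"

definition matrix_incl ::
  "nat \<Rightarrow> (nat \<Rightarrow> nat \<Rightarrow> ('k, 'm) module) \<Rightarrow> nat \<Rightarrow> nat \<Rightarrow> 'm \<Rightarrow> (nat \<times> nat \<Rightarrow> 'm)"
  where "matrix_incl n M i j m =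
    (\<lambda>(p, q)\<in>{1..n} \<times> {1..n}. if (p, q) = (i, j) then m else \<zero>\<^bsub>M p q\<^esub>)"

definition block :: "nat \<Rightarrow> (nat \<Rightarrow> nat \<Rightarrow> ('k, 'm) module) \<Rightarrow> nat \<Rightarrow> nat \<Rightarrow> (nat \<times> nat \<Rightarrow> 'm) set"
  where "block n M i j = matrix_incl n M i j ` carrier (M i j)"

definition invariant_under ::
  "('k, 'h, 'x) module_scheme \<Rightarrow> ('h \<Rightarrow> 'a \<Rightarrow> 'a) \<Rightarrow> 'a set \<Rightarrow> bool"
  where "invariant_under H act X \<longleftrightarrow> (\<forall>h\<in>carrier H. \<forall>x\<in>X. act h x \<in> X)"

end

theory Submission
  imports Defs
begin

text \<open>
  The blocks \<open>\<^sub>iM\<^sub>j\<close> of the matrix algebra carry all the information on both sides of the equivalence. The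
  proof compares each side with a third notion, \<open>blockwise_partial_action\<close>: a family of bilinear maps
  \<open>(h, m) \<mapsto> h \<cdot> m\<close> on the single blocks with \<open>1 \<cdot> m = m\<close>, \<open>h \<cdot> (m x) = (h\<^sub>1 \<cdot> m)(h\<^sub>2 \<cdot> x)\<close> and
  \<open>h \<cdot> (k \<cdot> m) = (h\<^sub>1 \<cdot> 1\<^sub>i)(h\<^sub>2 k \<cdot> m) = (h\<^sub>1 k \<cdot> m)(h\<^sub>2 \<cdot> 1\<^sub>j)\<close> for \<open>m\<close> in \<open>\<^sub>iM\<^sub>j\<close>.

  A partial action on the matrix algebra that preserves the blocks acts entry by entry. It sends the unit,
  the sum of the diagonal units, to the diagonal matrix of the \<open>h \<cdot> 1\<^sub>i\<close>. From the left, this matrix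
  multiplies row \<open>i\<close> by \<open>h \<cdot> 1\<^sub>i\<close>, and from the right it multiplies column \<open>j\<close> by \<open>h \<cdot> 1\<^sub>j\<close>. So the axioms for matrices are the axioms for blocks,
  read entrywise (\<open>matrix_action_partial_action\<close>, \<open>invariant_action_blockwise\<close>).

  Given maps on the blocks, \<open>(r \<otimes> h) m = r (h \<cdot> m)\<close> and \<open>m (h \<otimes> r) = (h \<cdot> m) r\<close> define the modules
  over the smash products. They respect products because of \<open>h \<cdot> (b (k \<cdot> m)) = (h\<^sub>1 \<cdot> b)(h\<^sub>2 k \<cdot> m)\<close>
  and its mirror image (\<open>left_partial_module.D_mult_D\<close>, \<open>right_partial_module.D_D_mult\<close>): in the composition
  law the factor \<open>h\<^sub>2 \<cdot> 1\<close> is absorbed by \<open>h\<^sub>1 \<cdot> b\<close>.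

  Conversely, given the modules, put \<open>h \<cdot> m = (1 # h) m = m (h # 1)\<close>. In the smash products
  \<open>(1 # h)(1 # k) = ((h\<^sub>1 \<cdot> 1) # 1)(1 # h\<^sub>2 k)\<close>, and on the right, where the multiplication of \<open>H\<close> is
  reversed, \<open>(k # 1)(h # 1) = (h\<^sub>1 k # 1)(1 # (h\<^sub>2 \<cdot> 1))\<close>. Letting these act on \<open>m\<close> gives the two forms of the
  composition law (\<open>left_smash_module_partial\<close>, \<open>right_smash_module_partial\<close>).

  The calculations in Sweedler notation rest on the universal property of the tensor product. It turns
  coassociativity and the multiplicativity of \<open>\<Delta>\<close> into rules for iterated sums
  (\<open>sweedler_coassoc\<close>, \<open>sweedler_mult\<close>) that apply to every multilinear expression.
\<close>

section \<open>Linear maps\<close>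

lemma linear_mapI:
  assumes "\<And>x. x \<in> carrier U \<Longrightarrow> f x \<in> carrier V"
    and "\<And>x y. \<lbrakk>x \<in> carrier U; y \<in> carrier U\<rbrakk> \<Longrightarrow> f (x \<oplus>\<^bsub>U\<^esub> y) = f x \<oplus>\<^bsub>V\<^esub> f y"
    and "\<And>c x. \<lbrakk>c \<in> carrier K; x \<in> carrier U\<rbrakk> \<Longrightarrow> f (c \<odot>\<^bsub>U\<^esub> x) = c \<odot>\<^bsub>V\<^esub> f x"
  shows "linear_map K U V f"
  using assms by (auto simp: linear_map_def)

lemma linear_map_closed: "\<lbrakk>linear_map K U V f; x \<in> carrier U\<rbrakk> \<Longrightarrow> f x \<in> carrier V"
  by (auto simp: linear_map_def)

lemma linear_map_add:
  "\<lbrakk>linear_map K U V f; x \<in> carrier U; y \<in> carrier U\<rbrakk> \<Longrightarrow> f (x \<oplus>\<^bsub>U\<^esub> y) = f x \<oplus>\<^bsub>V\<^esub> f y"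
  by (auto simp: linear_map_def)

lemma linear_map_smult:
  "\<lbrakk>linear_map K U V f; c \<in> carrier K; x \<in> carrier U\<rbrakk> \<Longrightarrow> f (c \<odot>\<^bsub>U\<^esub> x) = c \<odot>\<^bsub>V\<^esub> f x"
  by (auto simp: linear_map_def)

lemma linear_map_id: "linear_map K U U (\<lambda>x. x)"
  by (auto simp: linear_map_def)

lemma linear_map_compose:
  "\<lbrakk>linear_map K V W g; linear_map K U V f\<rbrakk> \<Longrightarrow> linear_map K U W (\<lambda>x. g (f x))"
  by (auto simp: linear_map_def Pi_def)

lemma linear_map_cong:
  assumes "module K U" "linear_map K U V f" "\<And>x. x \<in> carrier U \<Longrightarrow> g x = f x"
  shows "linear_map K U V g"
proof -
  interpret U: module K U by fact
  show ?thesis using assms(2,3) by (auto simp: linear_map_def)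
qed

lemma linear_map_zero:
  assumes "module K U" "module K V" "linear_map K U V f"
  shows "f \<zero>\<^bsub>U\<^esub> = \<zero>\<^bsub>V\<^esub>"
proof -
  interpret U: module K U by fact
  interpret V: module K V by fact
  have "f \<zero>\<^bsub>U\<^esub> = f (\<zero>\<^bsub>K\<^esub> \<odot>\<^bsub>U\<^esub> \<zero>\<^bsub>U\<^esub>)" by simp
  also have "\<dots> = \<zero>\<^bsub>V\<^esub>"
    by (subst linear_map_smult[OF assms(3)]) (auto simp: linear_map_closed[OF assms(3)])
  finally show ?thesis .
qed

lemma linear_map_minus:
  assumes "module K U" "module K V" "linear_map K U V f" "x \<in> carrier U" "y \<in> carrier U"
  shows "f (x \<ominus>\<^bsub>U\<^esub> y) = f x \<ominus>\<^bsub>V\<^esub> f y"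
proof -
  interpret U: module K U by fact
  interpret V: module K V by fact
  note cl = linear_map_closed[OF assms(3)]
  have "f (x \<ominus>\<^bsub>U\<^esub> y) \<oplus>\<^bsub>V\<^esub> f y = f (x \<ominus>\<^bsub>U\<^esub> y \<oplus>\<^bsub>U\<^esub> y)"
    using linear_map_add[OF assms(3)] assms by simp
  also have "x \<ominus>\<^bsub>U\<^esub> y \<oplus>\<^bsub>U\<^esub> y = x" using assms by (simp add: U.minus_eq U.a_assoc U.l_neg)
  finally show ?thesis
    using assms cl by (metis U.minus_closed V.add.inv_solve_right V.minus_eq)
qed

lemma linear_map_finsum:
  assumes "module K U" "module K V" "linear_map K U V f" "finite A" "g \<in> A \<rightarrow> carrier U"
  shows "f (\<Oplus>\<^bsub>U\<^esub>i\<in>A. g i) = (\<Oplus>\<^bsub>V\<^esub>i\<in>A. f (g i))"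
proof -
  interpret U: module K U by fact
  interpret V: module K V by fact
  note cl = linear_map_closed[OF assms(3)]
  show ?thesis using assms(4,5)
  proof (induction A rule: finite_induct)
    case empty
    then show ?case by (simp add: linear_map_zero[OF assms(1-3)])
  next
    case (insert x F)
    then have "(\<lambda>i. f (g i)) \<in> F \<rightarrow> carrier V" "f (g x) \<in> carrier V" using cl by auto
    with insert show ?case by (simp add: linear_map_add[OF assms(3)] Pi_def)
  qed
qed

text \<open>
  A linear combination with fixed coefficients is linear in any parameter in which all its terms
  are linear. Sweedler sums are of this kind when the element that is split stays fixed.
\<close>

lemma linear_map_finsum_param:
  assumes "module K W" "finite A"
    and "\<And>i. i \<in> A \<Longrightarrow> c i \<in> carrier K" "\<And>i. i \<in> A \<Longrightarrow> linear_map K X W (\<lambda>x. f x i)"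
  shows "linear_map K X W (\<lambda>x. \<Oplus>\<^bsub>W\<^esub>i\<in>A. c i \<odot>\<^bsub>W\<^esub> f x i)"
proof -
  interpret W: module K W by fact
  note cl = linear_map_closed[OF assms(4)]
  show ?thesis
  proof (rule linear_mapI)
    fix x y assume xy: "x \<in> carrier X" "y \<in> carrier X"
    have "(\<Oplus>\<^bsub>W\<^esub>i\<in>A. c i \<odot>\<^bsub>W\<^esub> f (x \<oplus>\<^bsub>X\<^esub> y) i)
        = (\<Oplus>\<^bsub>W\<^esub>i\<in>A. c i \<odot>\<^bsub>W\<^esub> f x i \<oplus>\<^bsub>W\<^esub> c i \<odot>\<^bsub>W\<^esub> f y i)"
      using assms xy cl
      by (intro W.finsum_cong') (auto simp: linear_map_add[OF assms(4)] W.smult_r_distr)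
    also have "\<dots> = (\<Oplus>\<^bsub>W\<^esub>i\<in>A. c i \<odot>\<^bsub>W\<^esub> f x i) \<oplus>\<^bsub>W\<^esub> (\<Oplus>\<^bsub>W\<^esub>i\<in>A. c i \<odot>\<^bsub>W\<^esub> f y i)"
      using assms xy cl by (intro W.finsum_addf) auto
    finally show "(\<Oplus>\<^bsub>W\<^esub>i\<in>A. c i \<odot>\<^bsub>W\<^esub> f (x \<oplus>\<^bsub>X\<^esub> y) i)
        = (\<Oplus>\<^bsub>W\<^esub>i\<in>A. c i \<odot>\<^bsub>W\<^esub> f x i) \<oplus>\<^bsub>W\<^esub> (\<Oplus>\<^bsub>W\<^esub>i\<in>A. c i \<odot>\<^bsub>W\<^esub> f y i)" .
  next
    fix a x assume ax: "a \<in> carrier K" "x \<in> carrier X"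
    show "(\<Oplus>\<^bsub>W\<^esub>i\<in>A. c i \<odot>\<^bsub>W\<^esub> f (a \<odot>\<^bsub>X\<^esub> x) i) = a \<odot>\<^bsub>W\<^esub> (\<Oplus>\<^bsub>W\<^esub>i\<in>A. c i \<odot>\<^bsub>W\<^esub> f x i)"
      using assms ax cl
      by (subst W.finsum_smult_ldistr)
        (auto intro!: W.finsum_cong' simp: linear_map_smult[OF assms(4)] W.smult_assoc1[symmetric] W.R.m_comm)
  qed (use assms cl in \<open>auto intro!: W.finsum_closed\<close>)
qed

lemma bilinear_mapI:
  assumes "\<And>u. u \<in> carrier U \<Longrightarrow> linear_map K V W (f u)"
    and "\<And>v. v \<in> carrier V \<Longrightarrow> linear_map K U W (\<lambda>u. f u v)"
  shows "bilinear_map K U V W f"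
  using assms by (simp add: bilinear_map_def)

lemma bilinear_map_right: "\<lbrakk>bilinear_map K U V W f; u \<in> carrier U\<rbrakk> \<Longrightarrow> linear_map K V W (f u)"
  by (simp add: bilinear_map_def)

lemma bilinear_map_left:
  "\<lbrakk>bilinear_map K U V W f; v \<in> carrier V\<rbrakk> \<Longrightarrow> linear_map K U W (\<lambda>u. f u v)"
  by (simp add: bilinear_map_def)

lemma bilinear_map_closed:
  "\<lbrakk>bilinear_map K U V W f; u \<in> carrier U; v \<in> carrier V\<rbrakk> \<Longrightarrow> f u v \<in> carrier W"
  by (blast dest: bilinear_map_right linear_map_closed)

lemma bilinear_map_compose_right:
  "\<lbrakk>bilinear_map K U V W f; u \<in> carrier U; linear_map K X V g\<rbrakk> \<Longrightarrow> linear_map K X W (\<lambda>x. f u (g x))"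
  by (rule linear_map_compose[OF bilinear_map_right])

lemma bilinear_map_compose_left:
  "\<lbrakk>bilinear_map K U V W f; v \<in> carrier V; linear_map K X U g\<rbrakk> \<Longrightarrow> linear_map K X W (\<lambda>x. f (g x) v)"
  by (rule linear_map_compose[OF bilinear_map_left])


section \<open>Free modules\<close>

text \<open>
  The linear extension of \<open>g\<close> from the basis to the free module.
\<close>

definition free_lift ::
  "('k, 'r) ring_scheme \<Rightarrow> ('k, 'w, 'z) module_scheme \<Rightarrow> ('a \<Rightarrow> 'w) \<Rightarrow> ('a \<Rightarrow> 'k) \<Rightarrow> 'w"
  where "free_lift K W g x = (\<Oplus>\<^bsub>W\<^esub>p\<in>{p. x p \<noteq> \<zero>\<^bsub>K\<^esub>}. x p \<odot>\<^bsub>W\<^esub> g p)"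

lemma free_module_simps:
  "x \<in> carrier (free_module K X) \<longleftrightarrow>
     (\<forall>p. x p \<in> carrier K) \<and> finite {p. x p \<noteq> \<zero>\<^bsub>K\<^esub>} \<and> {p. x p \<noteq> \<zero>\<^bsub>K\<^esub>} \<subseteq> X"
  "\<zero>\<^bsub>free_module K X\<^esub> = (\<lambda>p. \<zero>\<^bsub>K\<^esub>)"
  "x \<oplus>\<^bsub>free_module K X\<^esub> y = (\<lambda>p. x p \<oplus>\<^bsub>K\<^esub> y p)"
  "c \<odot>\<^bsub>free_module K X\<^esub> x = (\<lambda>p. c \<otimes>\<^bsub>K\<^esub> x p)"
  by (auto simp: free_module_def)

lemma (in cring) free_module_module: "module R (free_module R X)"
proof (rule moduleI)
  show "abelian_group (free_module R X)"
  proof (rule abelian_groupI)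
    fix x y assume xy: "x \<in> carrier (free_module R X)" "y \<in> carrier (free_module R X)"
    have "{p. x p \<oplus> y p \<noteq> \<zero>} \<subseteq> {p. x p \<noteq> \<zero>} \<union> {p. y p \<noteq> \<zero>}" by auto
    with xy show "x \<oplus>\<^bsub>free_module R X\<^esub> y \<in> carrier (free_module R X)"
      by (simp add: free_module_simps) (blast intro: finite_subset)
  next
    fix x assume x: "x \<in> carrier (free_module R X)"
    show "\<exists>y\<in>carrier (free_module R X). y \<oplus>\<^bsub>free_module R X\<^esub> x = \<zero>\<^bsub>free_module R X\<^esub>"
    proof
      show "(\<lambda>p. \<ominus> x p) \<in> carrier (free_module R X)"
        using x by (auto simp: free_module_simps intro!: finite_subset[of "{p. \<ominus> x p \<noteq> \<zero>}" "{p. x p \<noteq> \<zero>}"])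
      show "(\<lambda>p. \<ominus> x p) \<oplus>\<^bsub>free_module R X\<^esub> x = \<zero>\<^bsub>free_module R X\<^esub>"
        using x by (auto simp: free_module_simps l_neg)
    qed
  qed (auto simp: free_module_simps a_ac)
next
  fix c x assume "c \<in> carrier R" "x \<in> carrier (free_module R X)"
  then show "c \<odot>\<^bsub>free_module R X\<^esub> x \<in> carrier (free_module R X)"
    by (auto simp: free_module_simps intro!: finite_subset[of "{p. c \<otimes> x p \<noteq> \<zero>}" "{p. x p \<noteq> \<zero>}"])
qed (auto simp: free_module_simps l_distr r_distr m_assoc is_cring)

lemma (in cring) free_gen_closed [simp]: "p \<in> X \<Longrightarrow> free_gen R p \<in> carrier (free_module R X)"
  by (auto simp: free_module_simps free_gen_def)

lemma free_lift_superset: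
  assumes "module K W" "x \<in> carrier (free_module K X)" "g \<in> X \<rightarrow> carrier W"
    and "finite B" "B \<subseteq> X" "{p. x p \<noteq> \<zero>\<^bsub>K\<^esub>} \<subseteq> B"
  shows "free_lift K W g x = (\<Oplus>\<^bsub>W\<^esub>p\<in>B. x p \<odot>\<^bsub>W\<^esub> g p)"
proof -
  interpret W: module K W by fact
  show ?thesis unfolding free_lift_def
    using assms by (intro W.add.finprod_mono_neutral_cong_left) (auto simp: free_module_simps Pi_iff)
qed

lemma free_lift_linear:
  assumes "module K W" "g \<in> X \<rightarrow> carrier W"
  shows "linear_map K (free_module K X) W (free_lift K W g)"
proof -
  interpret W: module K W by fact
  interpret F: module K "free_module K X" by (rule W.R.free_module_module)
  note sup = free_lift_superset[OF assms(1) _ assms(2)]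
  let ?s = "\<lambda>x. {p. x p \<noteq> \<zero>\<^bsub>K\<^esub>}"
  have gcl: "g p \<in> carrier W" if "p \<in> X" for p using assms that by auto
  show ?thesis
  proof (rule linear_mapI)
    fix x assume "x \<in> carrier (free_module K X)"
    then show "free_lift K W g x \<in> carrier W"
      unfolding free_lift_def by (intro W.finsum_closed) (auto simp: free_module_simps gcl subset_iff)
  next
    fix x y assume xy: "x \<in> carrier (free_module K X)" "y \<in> carrier (free_module K X)"
    let ?B = "?s x \<union> ?s y"
    have B: "finite ?B" "?B \<subseteq> X" and k: "\<And>p. x p \<in> carrier K" "\<And>p. y p \<in> carrier K"
      using xy by (auto simp: free_module_simps)
    have "free_lift K W g (x \<oplus>\<^bsub>free_module K X\<^esub> y) = (\<Oplus>\<^bsub>W\<^esub>p\<in>?B. (x p \<oplus>\<^bsub>K\<^esub> y p) \<odot>\<^bsub>W\<^esub> g p)"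
      using F.M.add.m_closed[OF xy] B k by (subst sup[where B = ?B]) (auto simp: free_module_simps(3))
    also have "\<dots> = (\<Oplus>\<^bsub>W\<^esub>p\<in>?B. x p \<odot>\<^bsub>W\<^esub> g p \<oplus>\<^bsub>W\<^esub> y p \<odot>\<^bsub>W\<^esub> g p)"
      using B gcl k by (intro W.finsum_cong') (auto simp: subset_iff W.smult_l_distr)
    also have "\<dots> = (\<Oplus>\<^bsub>W\<^esub>p\<in>?B. x p \<odot>\<^bsub>W\<^esub> g p) \<oplus>\<^bsub>W\<^esub> (\<Oplus>\<^bsub>W\<^esub>p\<in>?B. y p \<odot>\<^bsub>W\<^esub> g p)"
      using B gcl k by (intro W.finsum_addf) (auto simp: subset_iff)
    also have "\<dots> = free_lift K W g x \<oplus>\<^bsub>W\<^esub> free_lift K W g y"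
      using xy B k by (subst (1 2) sup[where B = ?B]) auto
    finally show "free_lift K W g (x \<oplus>\<^bsub>free_module K X\<^esub> y) = free_lift K W g x \<oplus>\<^bsub>W\<^esub> free_lift K W g y" .
  next
    fix c x assume cx: "c \<in> carrier K" "x \<in> carrier (free_module K X)"
    let ?B = "?s x"
    have B: "finite ?B" "?B \<subseteq> X" and k: "\<And>p. x p \<in> carrier K"
      using cx by (auto simp: free_module_simps)
    have "free_lift K W g (c \<odot>\<^bsub>free_module K X\<^esub> x) = (\<Oplus>\<^bsub>W\<^esub>p\<in>?B. (c \<otimes>\<^bsub>K\<^esub> x p) \<odot>\<^bsub>W\<^esub> g p)"
      using cx B k F.smult_closed[OF cx] by (subst sup[where B = ?B]) (auto simp: free_module_simps(4))
    also have "\<dots> = c \<odot>\<^bsub>W\<^esub> free_lift K W g x"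
      unfolding free_lift_def using B gcl k cx
      by (subst W.finsum_smult_ldistr) (auto intro!: W.finsum_cong' simp: subset_iff W.smult_assoc1)
    finally show "free_lift K W g (c \<odot>\<^bsub>free_module K X\<^esub> x) = c \<odot>\<^bsub>W\<^esub> free_lift K W g x" .
  qed
qed

lemma free_lift_gen:
  assumes "module K W" "g \<in> X \<rightarrow> carrier W" "p \<in> X"
  shows "free_lift K W g (free_gen K p) = g p"
proof -
  interpret W: module K W by fact
  have "free_lift K W g (free_gen K p) = (\<Oplus>\<^bsub>W\<^esub>q\<in>{p}. free_gen K p q \<odot>\<^bsub>W\<^esub> g q)"
    using assms W.R.free_gen_closed[OF assms(3)]
    by (intro free_lift_superset) (auto simp: free_gen_def)
  also have "\<dots> = g p"
    using assms by (subst W.finsum_insert) (auto simp: free_gen_def Pi_iff)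
  finally show ?thesis .
qed

lemma free_module_induct:
  assumes "cring K" and x: "x \<in> carrier (free_module K X)"
    and zero: "P \<zero>\<^bsub>free_module K X\<^esub>"
    and step: "\<And>c p x. \<lbrakk>c \<in> carrier K; p \<in> X; x \<in> carrier (free_module K X); P x\<rbrakk> \<Longrightarrow>
      P (c \<odot>\<^bsub>free_module K X\<^esub> free_gen K p \<oplus>\<^bsub>free_module K X\<^esub> x)"
  shows "P x"
proof -
  interpret cring K by fact
  have "finite {p. x p \<noteq> \<zero>\<^bsub>K\<^esub>}" using x by (simp add: free_module_simps)
  then show ?thesis using x
  proof (induction "{p. x p \<noteq> \<zero>\<^bsub>K\<^esub>}" arbitrary: x rule: finite_psubset_induct)
    case psubset
    show ?case
    proof (cases "x = (\<lambda>p. \<zero>\<^bsub>K\<^esub>)")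
      case True
      then show ?thesis using zero by (simp add: free_module_simps)
    next
      case False
      then obtain p where p: "x p \<noteq> \<zero>\<^bsub>K\<^esub>" by blast
      have y: "x(p := \<zero>\<^bsub>K\<^esub>) \<in> carrier (free_module K X)"
        using psubset.prems by (auto simp: free_module_simps intro: rev_finite_subset)
      have "P (x(p := \<zero>\<^bsub>K\<^esub>))"
        using p y by (intro psubset.hyps(2)) auto
      then have "P (x p \<odot>\<^bsub>free_module K X\<^esub> free_gen K p \<oplus>\<^bsub>free_module K X\<^esub> x(p := \<zero>\<^bsub>K\<^esub>))"
        using p y psubset.prems by (intro step) (auto simp: free_module_simps)
      also have "x p \<odot>\<^bsub>free_module K X\<^esub> free_gen K p \<oplus>\<^bsub>free_module K X\<^esub> x(p := \<zero>\<^bsub>K\<^esub>) = x"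
        using psubset.prems by (auto simp: free_module_simps free_gen_def)
      finally show ?thesis .
    qed
  qed
qed

section \<open>Tensor products\<close>

definition tensor_class ::
  "('k, 'r) ring_scheme \<Rightarrow> ('k, 'u, 'x) module_scheme \<Rightarrow> ('k, 'v, 'y) module_scheme \<Rightarrow>
    ('u \<times> 'v \<Rightarrow> 'k) \<Rightarrow> ('u \<times> 'v \<Rightarrow> 'k) set"
  where "tensor_class K U V x = tensor_kernel K U V +>\<^bsub>free_on_pairs K U V\<^esub> x"

lemma pure_tensor_class: "pure_tensor K U V u v = tensor_class K U V (free_gen K (u, v))"
  by (simp add: pure_tensor_def tensor_class_def)

context
  fixes K :: "'k ring" and U :: "('k, 'u) module" and V :: "('k, 'v) module"
  assumes module_U: "module K U" and module_V: "module K V"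
begin

interpretation U: module K U by (rule module_U)
interpretation V: module K V by (rule module_V)
interpretation F: module K "free_on_pairs K U V" by (rule U.R.free_module_module)

lemma tensor_relators_closed: "tensor_relators K U V \<subseteq> carrier (free_on_pairs K U V)"
  by (auto simp: tensor_relators_def Let_def intro!: F.M.minus_closed F.M.a_closed F.smult_closed)

lemma tensor_kernel_submodule: "submodule (tensor_kernel K U V) K (free_on_pairs K U V)"
proof -
  let ?S = "{N. submodule N K (free_on_pairs K U V) \<and> tensor_relators K U V \<subseteq> N}"
  have S: "carrier (free_on_pairs K U V) \<in> ?S"
    using F.carrier_is_submodule tensor_relators_closed by simp
  have sub: "N \<subseteq> carrier (free_on_pairs K U V)" "\<zero>\<^bsub>free_on_pairs K U V\<^esub> \<in> N" if "N \<in> ?S" for N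
    using that F.submoduleE(1)[of N] subgroup.one_closed[of N "add_monoid (free_on_pairs K U V)"]
    by (auto simp: submodule_def)
  show ?thesis unfolding tensor_kernel_def
  proof (rule F.submoduleI)
    show "\<Inter> ?S \<subseteq> carrier (free_on_pairs K U V)" using S by (rule Inter_lower)
    show "\<zero>\<^bsub>free_on_pairs K U V\<^esub> \<in> \<Inter> ?S" using sub(2) by (rule InterI)
  next
    fix a assume "a \<in> \<Inter> ?S"
    then show "\<ominus>\<^bsub>free_on_pairs K U V\<^esub> a \<in> \<Inter> ?S"
      using F.submoduleE(3) by (intro InterI) (auto simp: Inter_iff)
  next
    fix a b assume "a \<in> \<Inter> ?S" "b \<in> \<Inter> ?S"
    then show "a \<oplus>\<^bsub>free_on_pairs K U V\<^esub> b \<in> \<Inter> ?S"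
      using F.submoduleE(5) by (intro InterI) (auto simp: Inter_iff)
  next
    fix c a assume "c \<in> carrier K" "a \<in> \<Inter> ?S"
    then show "c \<odot>\<^bsub>free_on_pairs K U V\<^esub> a \<in> \<Inter> ?S"
      using F.submoduleE(4) by (intro InterI) (auto simp: Inter_iff)
  qed
qed

lemma tensor_kernel_least:
  "\<lbrakk>submodule N K (free_on_pairs K U V); tensor_relators K U V \<subseteq> N\<rbrakk> \<Longrightarrow> tensor_kernel K U V \<subseteq> N"
  by (auto simp: tensor_kernel_def)

lemma tensor_relators_subset_kernel: "tensor_relators K U V \<subseteq> tensor_kernel K U V"
  by (auto simp: tensor_kernel_def)

interpretation N: abelian_subgroup "tensor_kernel K U V" "free_on_pairs K U V"
  by (rule abelian_subgroupI2[OF F.M.a_comm_group submodule.axioms(1)[OF tensor_kernel_submodule]])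

lemma tensor_class_eq:
  assumes "x \<in> carrier (free_on_pairs K U V)" "y \<in> carrier (free_on_pairs K U V)"
    and "x \<ominus>\<^bsub>free_on_pairs K U V\<^esub> y \<in> tensor_kernel K U V"
  shows "tensor_class K U V x = tensor_class K U V y"
proof -
  have "x \<in> tensor_class K U V y"
    unfolding tensor_class_def using assms N.a_rcos_module[of y x] by (simp add: F.M.minus_eq)
  then show ?thesis
    unfolding tensor_class_def
    by (rule F.M.a_repr_independence[OF _ assms(2) N.a_subgroup, symmetric])
qed

lemma in_tensor_class: "x \<in> carrier (free_on_pairs K U V) \<Longrightarrow> x \<in> tensor_class K U V x"
  unfolding tensor_class_def by (rule N.a_rcos_self)

lemma tensor_product_carrier:
  "carrier (tensor_product K U V) = tensor_class K U V ` carrier (free_on_pairs K U V)"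
  by (auto simp: tensor_product_def Let_def A_RCOSETS_def' tensor_class_def)

lemma tensor_product_add:
  "\<lbrakk>x \<in> carrier (free_on_pairs K U V); y \<in> carrier (free_on_pairs K U V)\<rbrakk> \<Longrightarrow>
    tensor_class K U V x \<oplus>\<^bsub>tensor_product K U V\<^esub> tensor_class K U V y
      = tensor_class K U V (x \<oplus>\<^bsub>free_on_pairs K U V\<^esub> y)"
  by (simp add: tensor_product_def Let_def N.a_rcos_sum tensor_class_def)

lemma tensor_product_smult:
  assumes c: "c \<in> carrier K" and x: "x \<in> carrier (free_on_pairs K U V)"
  shows "c \<odot>\<^bsub>tensor_product K U V\<^esub> tensor_class K U V x = tensor_class K U V (c \<odot>\<^bsub>free_on_pairs K U V\<^esub> x)"
proof -
  have same: "tensor_class K U V (c \<odot>\<^bsub>free_on_pairs K U V\<^esub> z) = tensor_class K U V (c \<odot>\<^bsub>free_on_pairs K U V\<^esub> x)"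
    if z: "z \<in> tensor_class K U V x" for z
  proof -
    from z obtain m where m: "m \<in> tensor_kernel K U V" "z = m \<oplus>\<^bsub>free_on_pairs K U V\<^esub> x"
      by (auto simp: tensor_class_def a_r_coset_def')
    have mc: "m \<in> carrier (free_on_pairs K U V)" using m N.a_subset by blast
    have "c \<odot>\<^bsub>free_on_pairs K U V\<^esub> z \<ominus>\<^bsub>free_on_pairs K U V\<^esub> c \<odot>\<^bsub>free_on_pairs K U V\<^esub> x
        = c \<odot>\<^bsub>free_on_pairs K U V\<^esub> m"
      using c x m mc by (simp add: F.smult_r_distr F.M.minus_eq F.M.a_assoc F.M.r_neg)
    also have "\<dots> \<in> tensor_kernel K U V"
      using submodule.smult_closed[OF tensor_kernel_submodule] c m by blast
    finally have "c \<odot>\<^bsub>free_on_pairs K U V\<^esub> z \<ominus>\<^bsub>free_on_pairs K U V\<^esub> c \<odot>\<^bsub>free_on_pairs K U V\<^esub> x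
        \<in> tensor_kernel K U V" .
    then show ?thesis by (rule tensor_class_eq[rotated 2]) (simp_all add: c x m(2) mc)
  qed
  have "(\<Union>z\<in>tensor_class K U V x. tensor_class K U V (c \<odot>\<^bsub>free_on_pairs K U V\<^esub> z))
      = tensor_class K U V (c \<odot>\<^bsub>free_on_pairs K U V\<^esub> x)"
    by (rule SUP_eq_const[OF _ same]) (use in_tensor_class[OF x] in blast)
  then show ?thesis by (simp add: tensor_product_def Let_def tensor_class_def)
qed

lemma tensor_product_zero: "\<zero>\<^bsub>tensor_product K U V\<^esub> = tensor_class K U V \<zero>\<^bsub>free_on_pairs K U V\<^esub>"
  by (simp add: tensor_product_def Let_def tensor_class_def F.M.a_coset_add_zero N.a_subset)

lemma tensor_product_module: "module K (tensor_product K U V)"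
proof (rule moduleI)
  show "cring K" ..
  show "abelian_group (tensor_product K U V)"
  proof (rule abelian_groupI)
    fix t assume "t \<in> carrier (tensor_product K U V)"
    then obtain x where x: "x \<in> carrier (free_on_pairs K U V)" "t = tensor_class K U V x"
      by (auto simp: tensor_product_carrier)
    then have "tensor_class K U V (\<ominus>\<^bsub>free_on_pairs K U V\<^esub> x) \<oplus>\<^bsub>tensor_product K U V\<^esub> t
        = \<zero>\<^bsub>tensor_product K U V\<^esub>"
      by (simp add: tensor_product_add tensor_product_zero F.M.l_neg)
    then show "\<exists>s\<in>carrier (tensor_product K U V). s \<oplus>\<^bsub>tensor_product K U V\<^esub> t = \<zero>\<^bsub>tensor_product K U V\<^esub>"
      using x by (auto simp: tensor_product_carrier)
  next
    fix s t assume "s \<in> carrier (tensor_product K U V)" "t \<in> carrier (tensor_product K U V)"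
    then show "s \<oplus>\<^bsub>tensor_product K U V\<^esub> t = t \<oplus>\<^bsub>tensor_product K U V\<^esub> s"
      by (auto simp: tensor_product_carrier tensor_product_add F.M.a_comm)
  qed (auto simp: tensor_product_carrier tensor_product_add tensor_product_zero F.M.a_assoc)
qed (auto simp: tensor_product_carrier tensor_product_add tensor_product_smult
      F.smult_l_distr F.smult_r_distr F.smult_assoc1)

interpretation T: module K "tensor_product K U V" by (rule tensor_product_module)

lemma tensor_class_linear:
  "linear_map K (free_on_pairs K U V) (tensor_product K U V) (tensor_class K U V)"
  by (rule linear_mapI) (auto simp: tensor_product_carrier tensor_product_add tensor_product_smult)

lemma pure_tensor_bilinear: "bilinear_map K U V (tensor_product K U V) (pure_tensor K U V)"
proof -
  let ?g = "\<lambda>u v. free_gen K (u, v)"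
  have rel: "tensor_class K U V x = tensor_class K U V y"
    if "x \<in> carrier (free_on_pairs K U V)" "y \<in> carrier (free_on_pairs K U V)"
      "x \<ominus>\<^bsub>free_on_pairs K U V\<^esub> y \<in> tensor_relators K U V" for x y
    using that tensor_relators_subset_kernel by (intro tensor_class_eq) auto
  show ?thesis
  proof (intro bilinear_mapI linear_mapI)
    fix u u' v assume *: "u \<in> carrier U" "u' \<in> carrier U" "v \<in> carrier V"
    have "tensor_class K U V (?g (u \<oplus>\<^bsub>U\<^esub> u') v) = tensor_class K U V (?g u v \<oplus>\<^bsub>free_on_pairs K U V\<^esub> ?g u' v)"
      using * by (intro rel) (auto simp: tensor_relators_def Let_def)
    then show "pure_tensor K U V (u \<oplus>\<^bsub>U\<^esub> u') v
        = pure_tensor K U V u v \<oplus>\<^bsub>tensor_product K U V\<^esub> pure_tensor K U V u' v"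
      using * by (simp add: pure_tensor_class tensor_product_add)
  next
    fix u v v' assume *: "u \<in> carrier U" "v \<in> carrier V" "v' \<in> carrier V"
    have "tensor_class K U V (?g u (v \<oplus>\<^bsub>V\<^esub> v')) = tensor_class K U V (?g u v \<oplus>\<^bsub>free_on_pairs K U V\<^esub> ?g u v')"
      using * by (intro rel) (auto simp: tensor_relators_def Let_def)
    then show "pure_tensor K U V u (v \<oplus>\<^bsub>V\<^esub> v')
        = pure_tensor K U V u v \<oplus>\<^bsub>tensor_product K U V\<^esub> pure_tensor K U V u v'"
      using * by (simp add: pure_tensor_class tensor_product_add)
  next
    fix c u v assume *: "c \<in> carrier K" "u \<in> carrier U" "v \<in> carrier V"
    have "tensor_class K U V (?g (c \<odot>\<^bsub>U\<^esub> u) v) = tensor_class K U V (c \<odot>\<^bsub>free_on_pairs K U V\<^esub> ?g u v)"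
      using * by (intro rel) (auto simp: tensor_relators_def Let_def)
    then show "pure_tensor K U V (c \<odot>\<^bsub>U\<^esub> u) v = c \<odot>\<^bsub>tensor_product K U V\<^esub> pure_tensor K U V u v"
      using * by (simp add: pure_tensor_class tensor_product_smult)
  next
    fix c u v assume *: "c \<in> carrier K" "u \<in> carrier U" "v \<in> carrier V"
    have "tensor_class K U V (?g u (c \<odot>\<^bsub>V\<^esub> v)) = tensor_class K U V (c \<odot>\<^bsub>free_on_pairs K U V\<^esub> ?g u v)"
      using * by (intro rel) (auto simp: tensor_relators_def Let_def)
    then show "pure_tensor K U V u (c \<odot>\<^bsub>V\<^esub> v) = c \<odot>\<^bsub>tensor_product K U V\<^esub> pure_tensor K U V u v"
      using * by (simp add: pure_tensor_class tensor_product_smult)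
  qed (auto simp: pure_tensor_class tensor_product_carrier)
qed

text \<open>
  The universal property, uniqueness part: the coset map turns both linear maps into maps
  out of a free module, which are determined by the generators.
\<close>

lemma tensor_product_ext:
  assumes W: "module K W"
    and f: "linear_map K (tensor_product K U V) W f" and g: "linear_map K (tensor_product K U V) W g"
    and eq: "\<And>u v. \<lbrakk>u \<in> carrier U; v \<in> carrier V\<rbrakk> \<Longrightarrow>
      f (pure_tensor K U V u v) = g (pure_tensor K U V u v)"
    and t: "t \<in> carrier (tensor_product K U V)"
  shows "f t = g t"
proof -
  interpret W: module K W by fact
  note f' = linear_map_compose[OF f tensor_class_linear] and g' = linear_map_compose[OF g tensor_class_linear]
  from t obtain x where x: "x \<in> carrier (free_on_pairs K U V)" "t = tensor_class K U V x"
    by (auto simp: tensor_product_carrier)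
  from U.R.is_cring x(1) have "f (tensor_class K U V x) = g (tensor_class K U V x)"
  proof (rule free_module_induct)
    show "f (tensor_class K U V \<zero>\<^bsub>free_on_pairs K U V\<^esub>) = g (tensor_class K U V \<zero>\<^bsub>free_on_pairs K U V\<^esub>)"
      using linear_map_zero[OF F.module_axioms W f'] linear_map_zero[OF F.module_axioms W g'] by simp
  next
    fix c p x
    assume *: "c \<in> carrier K" "p \<in> carrier U \<times> carrier V" "x \<in> carrier (free_on_pairs K U V)"
      and IH: "f (tensor_class K U V x) = g (tensor_class K U V x)"
    from * have "f (tensor_class K U V (free_gen K p)) = g (tensor_class K U V (free_gen K p))"
      using eq by (auto simp: pure_tensor_class)
    with * IH show "f (tensor_class K U V (c \<odot>\<^bsub>free_on_pairs K U V\<^esub> free_gen K p \<oplus>\<^bsub>free_on_pairs K U V\<^esub> x))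
        = g (tensor_class K U V (c \<odot>\<^bsub>free_on_pairs K U V\<^esub> free_gen K p \<oplus>\<^bsub>free_on_pairs K U V\<^esub> x))"
      by (simp add: linear_map_add[OF f'] linear_map_add[OF g'] linear_map_smult[OF f'] linear_map_smult[OF g'])
  qed
  then show ?thesis using x by simp
qed

text \<open>
  The vectors that the linear extension of a bilinear map sends to zero form a submodule, and it
  contains the relators; the tensor kernel is the least such submodule.
\<close>

lemma free_lift_vanishes_on_kernel:
  assumes W: "module K W" and f: "bilinear_map K U V W f" and x: "x \<in> tensor_kernel K U V"
  shows "free_lift K W (\<lambda>p. f (fst p) (snd p)) x = \<zero>\<^bsub>W\<^esub>"
proof -
  interpret W: module K W by fact
  let ?L = "free_lift K W (\<lambda>p. f (fst p) (snd p))"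
  have g: "(\<lambda>p. f (fst p) (snd p)) \<in> carrier U \<times> carrier V \<rightarrow> carrier W"
    using bilinear_map_closed[OF f] by auto
  note lin = free_lift_linear[OF W g]
  note gen = free_lift_gen[OF W g]
  note min = linear_map_minus[OF F.module_axioms W lin]
  note add = linear_map_add[OF lin] and smult = linear_map_smult[OF lin]
  let ?N = "{x \<in> carrier (free_on_pairs K U V). ?L x = \<zero>\<^bsub>W\<^esub>}"
  have "submodule ?N K (free_on_pairs K U V)"
  proof (rule F.submoduleI)
    fix a assume a: "a \<in> ?N"
    have "?L (\<zero>\<^bsub>free_on_pairs K U V\<^esub> \<ominus>\<^bsub>free_on_pairs K U V\<^esub> a) = \<zero>\<^bsub>W\<^esub>"
      using a by (subst min) (auto simp: linear_map_zero[OF F.module_axioms W lin] W.M.minus_eq)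
    then show "\<ominus>\<^bsub>free_on_pairs K U V\<^esub> a \<in> ?N" using a by (simp add: F.M.minus_eq)
  qed (auto simp: add smult linear_map_zero[OF F.module_axioms W lin])
  moreover have "tensor_relators K U V \<subseteq> ?N"
  proof
    fix y assume y: "y \<in> tensor_relators K U V"
    have yc: "y \<in> carrier (free_on_pairs K U V)" using y tensor_relators_closed by blast
    have "?L y = \<zero>\<^bsub>W\<^esub>"
      using y bilinear_map_closed[OF f]
      by (auto simp: tensor_relators_def Let_def min add smult gen W.M.minus_eq W.M.r_neg
          linear_map_add[OF bilinear_map_left[OF f]] linear_map_add[OF bilinear_map_right[OF f]]
          linear_map_smult[OF bilinear_map_left[OF f]] linear_map_smult[OF bilinear_map_right[OF f]])
    with yc show "y \<in> ?N" by simp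
  qed
  ultimately show ?thesis using tensor_kernel_least x by blast
qed

text \<open>
  Two representatives differ by an element of the kernel, so the one that \<open>tensor_lift\<close>
  happens to choose does not matter.
\<close>

lemma tensor_lift_class:
  assumes W: "module K W" and f: "bilinear_map K U V W f" and x: "x \<in> carrier (free_on_pairs K U V)"
  shows "tensor_lift K U V W f (tensor_class K U V x) = free_lift K W (\<lambda>p. f (fst p) (snd p)) x"
proof -
  interpret W: module K W by fact
  have g: "(\<lambda>p. f (fst p) (snd p)) \<in> carrier U \<times> carrier V \<rightarrow> carrier W"
    using bilinear_map_closed[OF f] by auto
  note lin = free_lift_linear[OF W g]
  define y where "y = (SOME y. y \<in> tensor_class K U V x)"
  have "y \<in> tensor_class K U V x" unfolding y_def some_in_eq using in_tensor_class[OF x] by blast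
  then obtain m where m: "m \<in> tensor_kernel K U V" "y = m \<oplus>\<^bsub>free_on_pairs K U V\<^esub> x"
    by (auto simp: tensor_class_def a_r_coset_def')
  have mc: "m \<in> carrier (free_on_pairs K U V)" using m N.a_subset by blast
  have "tensor_lift K U V W f (tensor_class K U V x) = free_lift K W (\<lambda>p. f (fst p) (snd p)) y"
    by (simp add: tensor_lift_def free_lift_def y_def Let_def)
  also have "\<dots> = free_lift K W (\<lambda>p. f (fst p) (snd p)) x"
    using x mc linear_map_closed[OF lin]
    by (simp add: m(2) linear_map_add[OF lin] free_lift_vanishes_on_kernel[OF W f m(1)])
  finally show ?thesis .
qed

lemma tensor_lift_linear:
  assumes W: "module K W" and f: "bilinear_map K U V W f"
  shows "linear_map K (tensor_product K U V) W (tensor_lift K U V W f)"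
proof -
  have g: "(\<lambda>p. f (fst p) (snd p)) \<in> carrier U \<times> carrier V \<rightarrow> carrier W"
    using bilinear_map_closed[OF f] by auto
  note lin = free_lift_linear[OF W g]
  note [simp] = tensor_lift_class[OF W f]
  show ?thesis
    by (rule linear_mapI)
      (auto simp: tensor_product_carrier tensor_product_add tensor_product_smult
        linear_map_closed[OF lin] linear_map_add[OF lin] linear_map_smult[OF lin])
qed

lemma tensor_lift_pure:
  assumes W: "module K W" and f: "bilinear_map K U V W f" and "u \<in> carrier U" "v \<in> carrier V"
  shows "tensor_lift K U V W f (pure_tensor K U V u v) = f u v"
proof -
  have g: "(\<lambda>p. f (fst p) (snd p)) \<in> carrier U \<times> carrier V \<rightarrow> carrier W"
    using bilinear_map_closed[OF f] by auto
  show ?thesis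
    using free_lift_gen[OF W g] assms by (simp add: pure_tensor_class tensor_lift_class[OF W f])
qed

text \<open>
  Since \<open>tensor_lift\<close> evaluates one representative of \<open>t\<close>, its value is a finite linear combination
  of values of \<open>f\<close> whose coefficients depend on \<open>t\<close> alone. The facts below are verified term by term.
\<close>

lemma some_representative:
  assumes "t \<in> carrier (tensor_product K U V)"
  shows "(SOME x. x \<in> t) \<in> carrier (free_on_pairs K U V)"
proof -
  obtain z where z: "z \<in> carrier (free_on_pairs K U V)" "t = tensor_class K U V z"
    using assms by (auto simp: tensor_product_carrier)
  have "(SOME x. x \<in> t) \<in> t" unfolding z(2) some_in_eq using in_tensor_class[OF z(1)] by blast
  then show ?thesis using z F.M.a_r_coset_subset_G[OF N.a_subset z(1)] by (auto simp: tensor_class_def)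
qed

lemma tensor_lift_closed:
  assumes "module K W" "t \<in> carrier (tensor_product K U V)"
    and "\<And>u v. \<lbrakk>u \<in> carrier U; v \<in> carrier V\<rbrakk> \<Longrightarrow> f u v \<in> carrier W"
  shows "tensor_lift K U V W f t \<in> carrier W"
proof -
  interpret W: module K W by fact
  define x where "x = (SOME z. z \<in> t)"
  let ?B = "{p. x p \<noteq> \<zero>\<^bsub>K\<^esub>}"
  have B: "finite ?B" "?B \<subseteq> carrier U \<times> carrier V" "\<And>p. x p \<in> carrier K"
    using some_representative[OF assms(2)] by (auto simp: x_def free_module_simps)
  have eq: "tensor_lift K U V W h t = (\<Oplus>\<^bsub>W\<^esub>p\<in>?B. x p \<odot>\<^bsub>W\<^esub> h (fst p) (snd p))" for h
    by (simp add: tensor_lift_def Let_def x_def)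
  show ?thesis unfolding eq using B assms(3) by (intro W.finsum_closed) (auto simp: subset_iff)
qed

lemma tensor_lift_cong:
  assumes "module K W" "t \<in> carrier (tensor_product K U V)"
    and "\<And>u v. \<lbrakk>u \<in> carrier U; v \<in> carrier V\<rbrakk> \<Longrightarrow> g u v \<in> carrier W"
    and "\<And>u v. \<lbrakk>u \<in> carrier U; v \<in> carrier V\<rbrakk> \<Longrightarrow> f u v = g u v"
  shows "tensor_lift K U V W f t = tensor_lift K U V W g t"
proof -
  interpret W: module K W by fact
  define x where "x = (SOME z. z \<in> t)"
  let ?B = "{p. x p \<noteq> \<zero>\<^bsub>K\<^esub>}"
  have B: "finite ?B" "?B \<subseteq> carrier U \<times> carrier V" "\<And>p. x p \<in> carrier K"
    using some_representative[OF assms(2)] by (auto simp: x_def free_module_simps)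
  have eq: "tensor_lift K U V W h t = (\<Oplus>\<^bsub>W\<^esub>p\<in>?B. x p \<odot>\<^bsub>W\<^esub> h (fst p) (snd p))" for h
    by (simp add: tensor_lift_def Let_def x_def)
  show ?thesis unfolding eq using B assms(3,4) by (intro W.finsum_cong') (auto simp: subset_iff)
qed

lemma tensor_lift_param_linear:
  assumes "module K W" "t \<in> carrier (tensor_product K U V)"
    and "\<And>u v. \<lbrakk>u \<in> carrier U; v \<in> carrier V\<rbrakk> \<Longrightarrow> linear_map K X W (\<lambda>x. f x u v)"
  shows "linear_map K X W (\<lambda>x. tensor_lift K U V W (f x) t)"
proof -
  define c where "c = (SOME z. z \<in> t)"
  let ?B = "{p. c p \<noteq> \<zero>\<^bsub>K\<^esub>}"
  have B: "finite ?B" "?B \<subseteq> carrier U \<times> carrier V" "\<And>p. c p \<in> carrier K"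
    using some_representative[OF assms(2)] by (auto simp: c_def free_module_simps)
  have eq: "tensor_lift K U V W h t = (\<Oplus>\<^bsub>W\<^esub>p\<in>?B. c p \<odot>\<^bsub>W\<^esub> h (fst p) (snd p))" for h
    by (simp add: tensor_lift_def Let_def c_def)
  show ?thesis unfolding eq using assms B by (intro linear_map_finsum_param) auto
qed

end

lemma linear_map_tensor_lift:
  fixes K :: "'k ring" and U :: "('k, 'u) module" and V :: "('k, 'v) module"
  assumes U: "module K U" and V: "module K V" and W: "module K W" and Y: "module K Y"
    and t: "t \<in> carrier (tensor_product K U V)"
    and g: "linear_map K W Y g"
    and f: "\<And>u v. \<lbrakk>u \<in> carrier U; v \<in> carrier V\<rbrakk> \<Longrightarrow> f u v \<in> carrier W"
  shows "g (tensor_lift K U V W f t) = tensor_lift K U V Y (\<lambda>u v. g (f u v)) t"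
proof -
  interpret W: module K W by fact
  interpret Y: module K Y by fact
  define x where "x = (SOME z. z \<in> t)"
  let ?B = "{p. x p \<noteq> \<zero>\<^bsub>K\<^esub>}"
  have B: "finite ?B" "?B \<subseteq> carrier U \<times> carrier V" "\<And>p. x p \<in> carrier K"
    using some_representative[OF U V t] by (auto simp: x_def free_module_simps)
  have "g (\<Oplus>\<^bsub>W\<^esub>p\<in>?B. x p \<odot>\<^bsub>W\<^esub> f (fst p) (snd p)) = (\<Oplus>\<^bsub>Y\<^esub>p\<in>?B. g (x p \<odot>\<^bsub>W\<^esub> f (fst p) (snd p)))"
    using B f by (intro linear_map_finsum[OF W Y g]) (auto simp: subset_iff)
  also have "\<dots> = (\<Oplus>\<^bsub>Y\<^esub>p\<in>?B. x p \<odot>\<^bsub>Y\<^esub> g (f (fst p) (snd p)))"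
    using B f linear_map_closed[OF g]
    by (intro Y.finsum_cong') (auto simp: subset_iff linear_map_smult[OF g])
  finally show ?thesis by (simp add: tensor_lift_def Let_def x_def)
qed

section \<open>Sweedler calculus\<close>

lemma assoc_algebra_simps:
  assumes "assoc_algebra K A"
  shows "module K A"
    and "\<one>\<^bsub>A\<^esub> \<in> carrier A"
    and "\<lbrakk>a \<in> carrier A; b \<in> carrier A\<rbrakk> \<Longrightarrow> a \<otimes>\<^bsub>A\<^esub> b \<in> carrier A"
    and "\<lbrakk>a \<in> carrier A; b \<in> carrier A; c \<in> carrier A\<rbrakk> \<Longrightarrow> (a \<otimes>\<^bsub>A\<^esub> b) \<otimes>\<^bsub>A\<^esub> c = a \<otimes>\<^bsub>A\<^esub> (b \<otimes>\<^bsub>A\<^esub> c)"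
    and "a \<in> carrier A \<Longrightarrow> \<one>\<^bsub>A\<^esub> \<otimes>\<^bsub>A\<^esub> a = a"
    and "a \<in> carrier A \<Longrightarrow> a \<otimes>\<^bsub>A\<^esub> \<one>\<^bsub>A\<^esub> = a"
    and "bilinear_map K A A A (mult A)"
proof -
  interpret A: ring A using assms by (simp add: assoc_algebra_def)
  show "module K A" using assms by (simp add: assoc_algebra_def)
  show "\<one>\<^bsub>A\<^esub> \<in> carrier A" by simp
  show "a \<otimes>\<^bsub>A\<^esub> b \<in> carrier A" if "a \<in> carrier A" "b \<in> carrier A" using that by simp
  show "(a \<otimes>\<^bsub>A\<^esub> b) \<otimes>\<^bsub>A\<^esub> c = a \<otimes>\<^bsub>A\<^esub> (b \<otimes>\<^bsub>A\<^esub> c)"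
    if "a \<in> carrier A" "b \<in> carrier A" "c \<in> carrier A" using that by (simp add: A.m_assoc)
  show "\<one>\<^bsub>A\<^esub> \<otimes>\<^bsub>A\<^esub> a = a" "a \<otimes>\<^bsub>A\<^esub> \<one>\<^bsub>A\<^esub> = a" if "a \<in> carrier A" using that by simp_all
  show "bilinear_map K A A A (mult A)"
    by (intro bilinear_mapI linear_mapI) (auto simp: A.l_distr A.r_distr
        assoc_algebra.smult_mult_left[OF assms] assoc_algebra.smult_mult_right[OF assms])
qed

context hopf_algebra
begin

abbreviation (input) H_mult (infixl "\<star>" 70) where "H_mult \<equiv> mult H"

abbreviation (input) sw where "sw \<equiv> sweedler K H \<Delta>"

lemma H_algebra: "assoc_algebra K H" ..

lemmas H_module = assoc_algebra_simps(1)[OF H_algebra]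
  and H_one_closed [simp] = assoc_algebra_simps(2)[OF H_algebra]
  and H_mult_closed [simp] = assoc_algebra_simps(3)[OF H_algebra]
  and H_one_mult [simp] = assoc_algebra_simps(5)[OF H_algebra]
  and H_mult_one [simp] = assoc_algebra_simps(6)[OF H_algebra]
  and H_mult_bilinear = assoc_algebra_simps(7)[OF H_algebra]

lemmas HH_module = tensor_product_module[OF H_module H_module]
  and HHH_module = tensor_product_module[OF tensor_product_module[OF H_module H_module] H_module]

lemma comult_linear: "linear_map K H (tensor_product K H H) \<Delta>"
  using comult_hom by (simp add: algebra_hom_def linear_map_def tensor_algebra_def Let_def)

lemmas comult_closed = linear_map_closed[OF comult_linear]

lemma sweedler_closed:
  "\<lbrakk>module K W; h \<in> carrier H; \<And>a b. \<lbrakk>a \<in> carrier H; b \<in> carrier H\<rbrakk> \<Longrightarrow> f a b \<in> carrier W\<rbrakk> \<Longrightarrow>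
    sw W f h \<in> carrier W"
  unfolding sweedler_def by (rule tensor_lift_closed[OF H_module H_module _ comult_closed])

lemma sweedler_cong:
  "\<lbrakk>module K W; h \<in> carrier H;
    \<And>a b. \<lbrakk>a \<in> carrier H; b \<in> carrier H\<rbrakk> \<Longrightarrow> g a b \<in> carrier W;
    \<And>a b. \<lbrakk>a \<in> carrier H; b \<in> carrier H\<rbrakk> \<Longrightarrow> f a b = g a b\<rbrakk> \<Longrightarrow>
    sw W f h = sw W g h"
  unfolding sweedler_def by (rule tensor_lift_cong[OF H_module H_module _ comult_closed])

lemma sweedler_linear:
  "\<lbrakk>module K W; bilinear_map K H H W f\<rbrakk> \<Longrightarrow> linear_map K H W (sw W f)"
  unfolding sweedler_def
  by (rule linear_map_compose[OF tensor_lift_linear[OF H_module H_module] comult_linear])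

lemma sweedler_param_linear:
  "\<lbrakk>module K W; h \<in> carrier H;
    \<And>a b. \<lbrakk>a \<in> carrier H; b \<in> carrier H\<rbrakk> \<Longrightarrow> linear_map K X W (\<lambda>x. f x a b)\<rbrakk> \<Longrightarrow>
    linear_map K X W (\<lambda>x. sw W (f x) h)"
  unfolding sweedler_def by (rule tensor_lift_param_linear[OF H_module H_module _ comult_closed])

lemma linear_map_sweedler:
  "\<lbrakk>module K W; module K Y; linear_map K W Y g; h \<in> carrier H;
    \<And>a b. \<lbrakk>a \<in> carrier H; b \<in> carrier H\<rbrakk> \<Longrightarrow> f a b \<in> carrier W\<rbrakk> \<Longrightarrow>
    g (sw W f h) = sw Y (\<lambda>a b. g (f a b)) h"
  unfolding sweedler_def
  by (rule linear_map_tensor_lift[OF H_module H_module _ _ comult_closed, where g = g and f = f])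

text \<open>
  This and the next lemma hold because \<open>\<Delta>\<close> is an algebra map: \<open>\<Delta> 1 = 1 \<otimes> 1\<close> and
  \<open>\<Delta> (h k) = h\<^sub>1 k\<^sub>1 \<otimes> h\<^sub>2 k\<^sub>2\<close>.
\<close>

lemma sweedler_one:
  assumes "module K W" "bilinear_map K H H W f"
  shows "sw W f \<one>\<^bsub>H\<^esub> = f \<one>\<^bsub>H\<^esub> \<one>\<^bsub>H\<^esub>"
proof -
  have "\<Delta> \<one>\<^bsub>H\<^esub> = pure_tensor K H H \<one>\<^bsub>H\<^esub> \<one>\<^bsub>H\<^esub>"
    using comult_hom by (simp add: algebra_hom_def tensor_algebra_def Let_def)
  then show ?thesis
    by (simp add: sweedler_def tensor_lift_pure[OF H_module H_module assms])
qed

lemma sweedler_mult: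
  assumes W: "module K W" and f: "bilinear_map K H H W f" and h: "h \<in> carrier H" and k: "k \<in> carrier H"
  shows "sw W f (h \<star> k) =
    sw W (\<lambda>a b. sw W (\<lambda>c d. f (a \<star> c) (b \<star> d)) k) h"
proof -
  let ?T = "tensor_product K H H"
  let ?tens = "\<lambda>a b c d. pure_tensor K H H (a \<star> c) (b \<star> d)"
  note lift = tensor_lift_linear[OF H_module H_module W f]
  have tens: "?tens a b c d \<in> carrier ?T"
    if "a \<in> carrier H" "b \<in> carrier H" "c \<in> carrier H" "d \<in> carrier H" for a b c d
    using that by (intro bilinear_map_closed[OF pure_tensor_bilinear[OF H_module H_module]]) auto
  have "\<Delta> (h \<star> k) = sw ?T (\<lambda>a b. sw ?T (?tens a b) k) h"
    using comult_hom h k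
    by (simp add: algebra_hom_def tensor_algebra_def Let_def sweedler_def tensor_lift_def)
  then have "sw W f (h \<star> k) = tensor_lift K H H W f
      (sw ?T (\<lambda>a b. sw ?T (?tens a b) k) h)"
    by (simp add: sweedler_def)
  also have "\<dots> = sw W
      (\<lambda>a b. tensor_lift K H H W f (sw ?T (?tens a b) k)) h"
    by (intro linear_map_sweedler[OF HH_module W lift h] sweedler_closed HH_module k tens)
  also have "\<dots> = sw W (\<lambda>a b. sw W (\<lambda>c d. f (a \<star> c) (b \<star> d)) k) h"
  proof (rule sweedler_cong[OF W h])
    fix a b assume ab: "a \<in> carrier H" "b \<in> carrier H"
    show "sw W (\<lambda>c d. f (a \<star> c) (b \<star> d)) k \<in> carrier W"
      using ab by (intro sweedler_closed W k bilinear_map_closed[OF f]) auto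
    have "tensor_lift K H H W f (sw ?T (?tens a b) k)
        = sw W (\<lambda>c d. tensor_lift K H H W f (?tens a b c d)) k"
      using ab by (intro linear_map_sweedler[OF HH_module W lift k] tens)
    also have "\<dots> = sw W (\<lambda>c d. f (a \<star> c) (b \<star> d)) k"
      using ab by (intro sweedler_cong[OF W k] bilinear_map_closed[OF f]
            tensor_lift_pure[OF H_module H_module W f]) auto
    finally show "tensor_lift K H H W f (sw ?T (?tens a b) k) = \<dots>" .
  qed
  finally show ?thesis .
qed

text \<open>
  A trilinear \<open>F\<close> induces a linear map on \<open>(H \<otimes> H) \<otimes> H\<close>. Applied to the two sides of
  coassociativity, this map gives the two sides of the equation.
\<close>

lemma sweedler_coassoc:
  assumes W: "module K W" and h: "h \<in> carrier H"
    and F3: "\<And>a b. \<lbrakk>a \<in> carrier H; b \<in> carrier H\<rbrakk> \<Longrightarrow> linear_map K H W (\<lambda>c. F a b c)"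
    and F2: "\<And>a c. \<lbrakk>a \<in> carrier H; c \<in> carrier H\<rbrakk> \<Longrightarrow> linear_map K H W (\<lambda>b. F a b c)"
    and F1: "\<And>b c. \<lbrakk>b \<in> carrier H; c \<in> carrier H\<rbrakk> \<Longrightarrow> linear_map K H W (\<lambda>a. F a b c)"
  shows "sw W (\<lambda>a c. sw W (\<lambda>a\<^sub>1 a\<^sub>2. F a\<^sub>1 a\<^sub>2 c) a) h =
    sw W (\<lambda>a c. sw W (\<lambda>c\<^sub>1 c\<^sub>2. F a c\<^sub>1 c\<^sub>2) c) h"
proof -
  let ?T = "tensor_product K H H"
  let ?TT = "tensor_product K ?T H"
  let ?G = "\<lambda>t c. tensor_lift K H H W (\<lambda>a b. F a b c) t"
  have Fbil: "bilinear_map K H H W (\<lambda>a b. F a b c)" if "c \<in> carrier H" for c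
    using F1 F2 that by (intro bilinear_mapI)
  have G: "bilinear_map K ?T H W ?G"
    using F3 by (intro bilinear_mapI tensor_lift_linear tensor_lift_param_linear H_module W Fbil)
  let ?L = "tensor_lift K ?T H W ?G"
  note L = tensor_lift_linear[OF HH_module H_module W G]
  note L_pure = tensor_lift_pure[OF HH_module H_module W G]
  have pHH: "pure_tensor K H H a b \<in> carrier ?T" if "a \<in> carrier H" "b \<in> carrier H" for a b
    using that by (rule bilinear_map_closed[OF pure_tensor_bilinear[OF H_module H_module]])
  have pHHH: "pure_tensor K ?T H t b \<in> carrier ?TT" if "t \<in> carrier ?T" "b \<in> carrier H" for t b
    using that by (rule bilinear_map_closed[OF pure_tensor_bilinear[OF HH_module H_module]])
  have "sw W (\<lambda>a c. sw W (\<lambda>a\<^sub>1 a\<^sub>2. F a\<^sub>1 a\<^sub>2 c) a) h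
      = sw W (\<lambda>a c. ?L (pure_tensor K ?T H (\<Delta> a) c)) h"
    by (rule sweedler_cong[OF W h])
      (auto simp: L_pure comult_closed sweedler_def intro!: bilinear_map_closed[OF G] linear_map_closed[OF L] pHHH)
  also have "\<dots> = ?L (sw ?TT (\<lambda>a c. pure_tensor K ?T H (\<Delta> a) c) h)"
    by (rule linear_map_sweedler[OF HHH_module W L h, symmetric]) (intro pHHH comult_closed)
  also have "\<dots> = ?L (sw ?TT (\<lambda>a c. sw ?TT
      (\<lambda>c\<^sub>1 c\<^sub>2. pure_tensor K ?T H (pure_tensor K H H a c\<^sub>1) c\<^sub>2) c) h)"
    using coassociative[OF h] by (simp add: Let_def)
  also have "\<dots> = sw W (\<lambda>a c. ?L (sw ?TT
      (\<lambda>c\<^sub>1 c\<^sub>2. pure_tensor K ?T H (pure_tensor K H H a c\<^sub>1) c\<^sub>2) c)) h"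
    by (rule linear_map_sweedler[OF HHH_module W L h]) (intro sweedler_closed HHH_module pHHH pHH)
  also have "\<dots> = sw W (\<lambda>a c. sw W (\<lambda>c\<^sub>1 c\<^sub>2. F a c\<^sub>1 c\<^sub>2) c) h"
  proof (rule sweedler_cong[OF W h])
    fix a c assume ac: "a \<in> carrier H" "c \<in> carrier H"
    have Fcl: "F a b d \<in> carrier W" if "b \<in> carrier H" "d \<in> carrier H" for b d
      using linear_map_closed[OF F3] that ac by blast
    then show "sw W (\<lambda>c\<^sub>1 c\<^sub>2. F a c\<^sub>1 c\<^sub>2) c \<in> carrier W"
      by (intro sweedler_closed W ac)
    have "?L (sw ?TT (\<lambda>c\<^sub>1 c\<^sub>2. pure_tensor K ?T H (pure_tensor K H H a c\<^sub>1) c\<^sub>2) c)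
        = sw W (\<lambda>c\<^sub>1 c\<^sub>2. ?L (pure_tensor K ?T H (pure_tensor K H H a c\<^sub>1) c\<^sub>2)) c"
      by (rule linear_map_sweedler[OF HHH_module W L ac(2)]) (intro pHHH pHH ac)
    also have "\<dots> = sw W (\<lambda>c\<^sub>1 c\<^sub>2. F a c\<^sub>1 c\<^sub>2) c"
      by (rule sweedler_cong[OF W ac(2)])
        (use ac in \<open>auto simp: L_pure pHH tensor_lift_pure[OF H_module H_module W Fbil] Fcl\<close>)
    finally show "?L (sw ?TT (\<lambda>c\<^sub>1 c\<^sub>2. pure_tensor K ?T H (pure_tensor K H H a c\<^sub>1) c\<^sub>2) c) = \<dots>" .
  qed
  finally show ?thesis .
qed

text \<open>
  The linear extensions of both sides from \<open>\<Delta> h\<close> to all of \<open>H \<otimes> H\<close> agree on pure tensors.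
\<close>

lemma sweedler_swap:
  assumes W: "module K W" and h: "h \<in> carrier H" and k: "k \<in> carrier H"
    and F1: "\<And>b c d. \<lbrakk>b \<in> carrier H; c \<in> carrier H; d \<in> carrier H\<rbrakk> \<Longrightarrow> linear_map K H W (\<lambda>a. F a b c d)"
    and F2: "\<And>a c d. \<lbrakk>a \<in> carrier H; c \<in> carrier H; d \<in> carrier H\<rbrakk> \<Longrightarrow> linear_map K H W (\<lambda>b. F a b c d)"
  shows "sw W (\<lambda>a b. sw W (\<lambda>c d. F a b c d) k) h =
    sw W (\<lambda>c d. sw W (\<lambda>a b. F a b c d) h) k"
proof -
  let ?T = "tensor_product K H H"
  have 1: "bilinear_map K H H W (\<lambda>a b. sw W (\<lambda>c d. F a b c d) k)"
    by (intro bilinear_mapI sweedler_param_linear W k F1 F2)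
  have 2: "bilinear_map K H H W (\<lambda>a b. F a b c d)" if "c \<in> carrier H" "d \<in> carrier H" for c d
    using that by (intro bilinear_mapI F1 F2)
  have "tensor_lift K H H W (\<lambda>a b. sw W (\<lambda>c d. F a b c d) k) (\<Delta> h) =
    sw W (\<lambda>c d. tensor_lift K H H W (\<lambda>a b. F a b c d) (\<Delta> h)) k"
  proof (rule tensor_product_ext[OF H_module H_module W])
    fix a b assume ab: "a \<in> carrier H" "b \<in> carrier H"
    show "tensor_lift K H H W (\<lambda>a b. sw W (\<lambda>c d. F a b c d) k) (pure_tensor K H H a b) =
      sw W (\<lambda>c d. tensor_lift K H H W (\<lambda>a b. F a b c d) (pure_tensor K H H a b)) k"
      unfolding tensor_lift_pure[OF H_module H_module W 1 ab]
      by (rule sweedler_cong[OF W k])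
        (simp_all add: tensor_lift_pure[OF H_module H_module W 2] ab bilinear_map_closed[OF 2])
  next
    show "linear_map K ?T W (\<lambda>t. sw W (\<lambda>c d. tensor_lift K H H W (\<lambda>a b. F a b c d) t) k)"
      by (intro sweedler_param_linear tensor_lift_linear H_module W k 2)
  qed (intro tensor_lift_linear H_module W 1 comult_closed h)+
  then show ?thesis by (simp add: sweedler_def)
qed

end

lemma (in hopf_algebra) sweedler_add:
  assumes W: "module K W" and h: "h \<in> carrier H"
    and f: "\<And>a b. \<lbrakk>a \<in> carrier H; b \<in> carrier H\<rbrakk> \<Longrightarrow> f a b \<in> carrier W"
    and g: "\<And>a b. \<lbrakk>a \<in> carrier H; b \<in> carrier H\<rbrakk> \<Longrightarrow> g a b \<in> carrier W"
  shows "sw W (\<lambda>a b. f a b \<oplus>\<^bsub>W\<^esub> g a b) h = sw W f h \<oplus>\<^bsub>W\<^esub> sw W g h"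
proof -
  interpret W: module K W by fact
  define x where "x = (SOME z. z \<in> \<Delta> h)"
  let ?B = "{p. x p \<noteq> \<zero>\<^bsub>K\<^esub>}"
  have B: "finite ?B" "?B \<subseteq> carrier H \<times> carrier H" "\<And>p. x p \<in> carrier K"
    using some_representative[OF H_module H_module comult_closed[OF h]]
    by (auto simp: x_def free_module_simps)
  have eq: "sw W f h = (\<Oplus>\<^bsub>W\<^esub>p\<in>?B. x p \<odot>\<^bsub>W\<^esub> f (fst p) (snd p))" for f
    by (simp add: sweedler_def tensor_lift_def Let_def x_def)
  have "sw W (\<lambda>a b. f a b \<oplus>\<^bsub>W\<^esub> g a b) h
      = (\<Oplus>\<^bsub>W\<^esub>p\<in>?B. x p \<odot>\<^bsub>W\<^esub> f (fst p) (snd p) \<oplus>\<^bsub>W\<^esub> x p \<odot>\<^bsub>W\<^esub> g (fst p) (snd p))"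
    unfolding eq using B f g
    by (intro W.finsum_cong') (auto simp: subset_iff W.smult_r_distr)
  then show ?thesis
    unfolding eq using B f g by (subst W.finsum_addf[symmetric]) (auto simp: subset_iff)
qed

lemma (in hopf_algebra) sweedler_zero:
  assumes W: "module K W" and h: "h \<in> carrier H"
  shows "sw W (\<lambda>a b. \<zero>\<^bsub>W\<^esub>) h = \<zero>\<^bsub>W\<^esub>"
proof -
  interpret W: module K W by fact
  have "linear_map K W W (\<lambda>w. \<zero>\<^bsub>W\<^esub>)" by (rule linear_mapI) auto
  from linear_map_sweedler[OF W W this h, of "\<lambda>a b. \<zero>\<^bsub>W\<^esub>"] show ?thesis by simp
qed

lemma (in hopf_algebra) sweedler_finsum:
  assumes W: "module K W" and h: "h \<in> carrier H" and B: "finite B"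
    and f: "\<And>i a b. \<lbrakk>i \<in> B; a \<in> carrier H; b \<in> carrier H\<rbrakk> \<Longrightarrow> f i a b \<in> carrier W"
  shows "sw W (\<lambda>a b. \<Oplus>\<^bsub>W\<^esub>i\<in>B. f i a b) h = (\<Oplus>\<^bsub>W\<^esub>i\<in>B. sw W (f i) h)"
proof -
  interpret W: module K W by fact
  show ?thesis using B f
  proof (induction B rule: finite_induct)
    case empty
    then show ?case by (simp add: sweedler_zero[OF W h])
  next
    case (insert j B)
    have "sw W (\<lambda>a b. \<Oplus>\<^bsub>W\<^esub>i\<in>insert j B. f i a b) h
        = sw W (\<lambda>a b. f j a b \<oplus>\<^bsub>W\<^esub> (\<Oplus>\<^bsub>W\<^esub>i\<in>B. f i a b)) h"
      using insert by (intro sweedler_cong W h) (auto intro!: W.finsum_closed)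
    also have "\<dots> = sw W (f j) h \<oplus>\<^bsub>W\<^esub> sw W (\<lambda>a b. \<Oplus>\<^bsub>W\<^esub>i\<in>B. f i a b) h"
      using insert by (intro sweedler_add W h) (auto intro!: W.finsum_closed)
    also have "\<dots> = (\<Oplus>\<^bsub>W\<^esub>i\<in>insert j B. sw W (f i) h)"
      using insert by (subst W.finsum_insert) (auto intro!: sweedler_closed W h)
    finally show ?case .
  qed
qed

section \<open>Partial actions and left smash products\<close>

text \<open>
  Rules for proving that an expression is linear in one of its variables. They peel off the outermost
  operation. No choice arises between the rules for the left and the right argument, because the
  argument that is held fixed must not contain the variable.
\<close>

named_theorems linear_intros

declare linear_map_id [linear_intros]

locale acted_algebra = hopf_algebra K H \<Delta> \<epsilon> S
  for K :: "'k ring" and H :: "('k, 'h) module" and \<Delta> and \<epsilon> and S +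
  fixes A :: "('k, 'a) module" and act :: "'h \<Rightarrow> 'a \<Rightarrow> 'a"
  assumes A_algebra: "assoc_algebra K A"
    and A_partial_action: "left_partial_action K H \<Delta> A act"
begin

abbreviation (input) A_mult (infixl "\<bullet>" 70) where "A_mult \<equiv> mult A"

abbreviation (input) AH where "AH \<equiv> tensor_product K A H"

abbreviation (input) HA where "HA \<equiv> tensor_product K H A"

lemmas A_module = assoc_algebra_simps(1)[OF A_algebra]
  and A_one_closed [simp] = assoc_algebra_simps(2)[OF A_algebra]
  and A_mult_closed [simp] = assoc_algebra_simps(3)[OF A_algebra]
  and A_mult_assoc = assoc_algebra_simps(4)[OF A_algebra]
  and A_one_mult [simp] = assoc_algebra_simps(5)[OF A_algebra]
  and A_mult_one [simp] = assoc_algebra_simps(6)[OF A_algebra]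
  and A_mult_bilinear = assoc_algebra_simps(7)[OF A_algebra]

lemma act_bilinear: "bilinear_map K H A A act"
  and act_one [simp]: "a \<in> carrier A \<Longrightarrow> act \<one>\<^bsub>H\<^esub> a = a"
  and act_mult: "\<lbrakk>h \<in> carrier H; a \<in> carrier A; b \<in> carrier A\<rbrakk> \<Longrightarrow>
    act h (a \<bullet> b) = sw A (\<lambda>h\<^sub>1 h\<^sub>2. act h\<^sub>1 a \<bullet> act h\<^sub>2 b) h"
  and act_act_left: "\<lbrakk>h \<in> carrier H; k \<in> carrier H; a \<in> carrier A\<rbrakk> \<Longrightarrow>
    act h (act k a) = sw A (\<lambda>h\<^sub>1 h\<^sub>2. act h\<^sub>1 \<one>\<^bsub>A\<^esub> \<bullet> act (h\<^sub>2 \<star> k) a) h"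
  and act_act_right: "\<lbrakk>h \<in> carrier H; k \<in> carrier H; a \<in> carrier A\<rbrakk> \<Longrightarrow>
    act h (act k a) = sw A (\<lambda>h\<^sub>1 h\<^sub>2. act (h\<^sub>1 \<star> k) a \<bullet> act h\<^sub>2 \<one>\<^bsub>A\<^esub>) h"
  using A_partial_action unfolding left_partial_action_def by blast+

lemmas act_closed [simp] = bilinear_map_closed[OF act_bilinear]

lemmas AH_module = tensor_product_module[OF A_module H_module]
  and pure_AH_bilinear = pure_tensor_bilinear[OF A_module H_module]
  and HA_module = tensor_product_module[OF H_module A_module]
  and pure_HA_bilinear = pure_tensor_bilinear[OF H_module A_module]

lemmas pure_AH_closed [simp] = bilinear_map_closed[OF pure_AH_bilinear]
  and pure_HA_closed [simp] = bilinear_map_closed[OF pure_HA_bilinear]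

lemmas [linear_intros] =
  bilinear_map_compose_left[OF A_mult_bilinear] bilinear_map_compose_right[OF A_mult_bilinear]
  bilinear_map_compose_left[OF H_mult_bilinear] bilinear_map_compose_right[OF H_mult_bilinear]
  bilinear_map_compose_left[OF act_bilinear] bilinear_map_compose_right[OF act_bilinear]
  bilinear_map_compose_left[OF pure_AH_bilinear] bilinear_map_compose_right[OF pure_AH_bilinear]
  bilinear_map_compose_left[OF pure_HA_bilinear] bilinear_map_compose_right[OF pure_HA_bilinear]

abbreviation (input) left_product :: "('a \<times> 'h \<Rightarrow> 'k) set \<Rightarrow> ('a \<times> 'h \<Rightarrow> 'k) set \<Rightarrow> ('a \<times> 'h \<Rightarrow> 'k) set"
  where "left_product \<equiv> mult (left_smash_ambient K H \<Delta> A act)"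

lemma left_smash_simps:
  "carrier (left_smash K H \<Delta> A act) =
    (\<lambda>x. left_product x (pure_tensor K A H \<one>\<^bsub>A\<^esub> \<one>\<^bsub>H\<^esub>)) ` carrier AH"
  "mult (left_smash K H \<Delta> A act) = left_product"
  "\<one>\<^bsub>left_smash K H \<Delta> A act\<^esub> = left_hash K H \<Delta> A act \<one>\<^bsub>A\<^esub> \<one>\<^bsub>H\<^esub>"
  "add (left_smash K H \<Delta> A act) = add AH"
  "smult (left_smash K H \<Delta> A act) = smult AH"
  by (simp_all add: left_smash_def left_smash_ambient_def Let_def)

abbreviation (input) left_term :: "'a \<Rightarrow> 'h \<Rightarrow> 'a \<Rightarrow> 'h \<Rightarrow> ('a \<times> 'h \<Rightarrow> 'k) set"
  where "left_term a h b k \<equiv> sw AH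
    (\<lambda>h\<^sub>1 h\<^sub>2. pure_tensor K A H (a \<bullet> act h\<^sub>1 b) (h\<^sub>2 \<star> k)) h"

lemma left_term_linear:
  assumes "a \<in> carrier A" "h \<in> carrier H" "b \<in> carrier A" "k \<in> carrier H"
  shows "linear_map K A AH (\<lambda>a. left_term a h b k)"
    and "linear_map K H AH (\<lambda>h. left_term a h b k)"
    and "linear_map K A AH (\<lambda>b. left_term a h b k)"
    and "linear_map K H AH (\<lambda>k. left_term a h b k)"
  using assms
  by (intro sweedler_param_linear sweedler_linear bilinear_mapI AH_module linear_intros; simp)+

lemma left_product_bilinear:
  "bilinear_map K AH AH AH left_product"
  and left_product_pure: "\<lbrakk>a \<in> carrier A; h \<in> carrier H; b \<in> carrier A; k \<in> carrier H\<rbrakk> \<Longrightarrow>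
    left_product (pure_tensor K A H a h) (pure_tensor K A H b k) = left_term a h b k"
proof -
  let ?T = AH
  let ?inner = "\<lambda>y a h. tensor_lift K A H ?T (\<lambda>b k. left_term a h b k) y"
  have prod: "left_product x y = tensor_lift K A H ?T (?inner y) x" for x y
    by (simp add: left_smash_ambient_def Let_def)
  note lift = tensor_lift_linear[OF A_module H_module AH_module]
    and param = tensor_lift_param_linear[OF A_module H_module AH_module]
  have inner: "bilinear_map K A H ?T (?inner y)" if "y \<in> carrier ?T" for y
    using that by (intro bilinear_mapI param left_term_linear) auto
  have bil: "bilinear_map K A H ?T (left_term a h)" if "a \<in> carrier A" "h \<in> carrier H" for a h
    using that by (intro bilinear_mapI left_term_linear) auto
  show "bilinear_map K ?T ?T ?T left_product"
    unfolding prod by (intro bilinear_mapI param lift inner bil)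
  show "left_product (pure_tensor K A H a h) (pure_tensor K A H b k) = left_term a h b k"
    if "a \<in> carrier A" "h \<in> carrier H" "b \<in> carrier A" "k \<in> carrier H"
    using that unfolding prod
    by (simp add: tensor_lift_pure[OF A_module H_module AH_module] inner bil)
qed

lemma left_hash_bilinear: "bilinear_map K A H AH (left_hash K H \<Delta> A act)"
  unfolding left_hash_def
  by (intro bilinear_mapI sweedler_param_linear sweedler_linear AH_module linear_intros; simp)

text \<open>
  Thus \<open>a # h\<close> is the projection of \<open>a \<otimes> h\<close> to the unital part \<open>(A \<otimes> H)(1 \<otimes> 1)\<close>.
\<close>

lemma left_hash_product:
  assumes "a \<in> carrier A" "h \<in> carrier H"
  shows "left_hash K H \<Delta> A act a h
    = left_product (pure_tensor K A H a h) (pure_tensor K A H \<one>\<^bsub>A\<^esub> \<one>\<^bsub>H\<^esub>)"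
  unfolding left_product_pure[OF assms A_one_closed H_one_closed] left_hash_def
  by (rule sweedler_cong[OF AH_module]) (use assms in auto)

lemma left_hash_closed:
  "\<lbrakk>a \<in> carrier A; h \<in> carrier H\<rbrakk> \<Longrightarrow>
    left_hash K H \<Delta> A act a h \<in> carrier (left_smash K H \<Delta> A act)"
  by (auto simp: left_hash_product left_smash_simps)

lemma left_smash_subset: "carrier (left_smash K H \<Delta> A act) \<subseteq> carrier AH"
  by (auto simp: left_smash_simps intro!: bilinear_map_closed[OF left_product_bilinear])

end


text \<open>
  The compatibility of a partial action of \<open>H\<close> on an \<open>A\<close>-module \<open>V\<close> with that on \<open>A\<close>: what a
  block of a generalized matrix algebra carries over the diagonal algebra of its row. The algebra
  \<open>A\<close>, acting on itself by multiplication, is another instance.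
\<close>

locale left_partial_module = acted_algebra K H \<Delta> \<epsilon> S A act
  for K :: "'k ring" and H :: "('k, 'h) module" and \<Delta> and \<epsilon> and S
    and A :: "('k, 'a) module" and act +
  fixes V :: "('k, 'v) module" and \<nu> :: "'a \<Rightarrow> 'v \<Rightarrow> 'v" and D :: "'h \<Rightarrow> 'v \<Rightarrow> 'v"
  assumes V_module: "module K V"
    and \<nu>_bilinear: "bilinear_map K A V V \<nu>"
    and \<nu>_mult: "\<lbrakk>a \<in> carrier A; b \<in> carrier A; v \<in> carrier V\<rbrakk> \<Longrightarrow> \<nu> (a \<bullet> b) v = \<nu> a (\<nu> b v)"
    and \<nu>_one [simp]: "v \<in> carrier V \<Longrightarrow> \<nu> \<one>\<^bsub>A\<^esub> v = v"
    and D_bilinear: "bilinear_map K H V V D"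
    and D_one [simp]: "v \<in> carrier V \<Longrightarrow> D \<one>\<^bsub>H\<^esub> v = v"
    and D_mult: "\<lbrakk>h \<in> carrier H; a \<in> carrier A; v \<in> carrier V\<rbrakk> \<Longrightarrow>
      D h (\<nu> a v) = sw V (\<lambda>h\<^sub>1 h\<^sub>2. \<nu> (act h\<^sub>1 a) (D h\<^sub>2 v)) h"
    and D_D: "\<lbrakk>h \<in> carrier H; k \<in> carrier H; v \<in> carrier V\<rbrakk> \<Longrightarrow>
      D h (D k v) = sw V (\<lambda>h\<^sub>1 h\<^sub>2. \<nu> (act h\<^sub>1 \<one>\<^bsub>A\<^esub>) (D (h\<^sub>2 \<star> k) v)) h"
begin

lemmas \<nu>_closed [simp] = bilinear_map_closed[OF \<nu>_bilinear]
  and D_closed [simp] = bilinear_map_closed[OF D_bilinear]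

lemmas [linear_intros] =
  bilinear_map_compose_left[OF \<nu>_bilinear] bilinear_map_compose_right[OF \<nu>_bilinear]
  bilinear_map_compose_left[OF D_bilinear] bilinear_map_compose_right[OF D_bilinear]

text \<open>
  Multiplicativity and the composition law give \<open>(h\<^sub>1 \<cdot> b) (h\<^sub>2 \<cdot> 1) (h\<^sub>3 k \<cdot> v)\<close>, and the first two factors
  combine to \<open>h\<^sub>1 \<cdot> (b 1)\<close>, so that the factor \<open>h\<^sub>2 \<cdot> 1\<close> disappears. The
  modules over smash products and the multiplication table of the smash product both rest on this identity.
\<close>

lemma D_mult_D:
  assumes h: "h \<in> carrier H" and b: "b \<in> carrier A" and k: "k \<in> carrier H" and v: "v \<in> carrier V"
  shows "D h (\<nu> b (D k v)) = sw V (\<lambda>h\<^sub>1 h\<^sub>2. \<nu> (act h\<^sub>1 b) (D (h\<^sub>2 \<star> k) v)) h"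
proof -
  have "D h (\<nu> b (D k v)) = sw V (\<lambda>x y. \<nu> (act x b) (D y (D k v))) h"
    using assms by (intro D_mult) auto
  also have "\<dots> = sw V (\<lambda>x y. sw V
      (\<lambda>y\<^sub>1 y\<^sub>2. \<nu> (act x b) (\<nu> (act y\<^sub>1 \<one>\<^bsub>A\<^esub>) (D (y\<^sub>2 \<star> k) v))) y) h"
  proof (rule sweedler_cong[OF V_module h])
    fix x y assume xy: "x \<in> carrier H" "y \<in> carrier H"
    show "sw V (\<lambda>y\<^sub>1 y\<^sub>2. \<nu> (act x b) (\<nu> (act y\<^sub>1 \<one>\<^bsub>A\<^esub>) (D (y\<^sub>2 \<star> k) v))) y \<in> carrier V"
      using assms xy by (intro sweedler_closed V_module) auto
    show "\<nu> (act x b) (D y (D k v)) = sw V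
        (\<lambda>y\<^sub>1 y\<^sub>2. \<nu> (act x b) (\<nu> (act y\<^sub>1 \<one>\<^bsub>A\<^esub>) (D (y\<^sub>2 \<star> k) v))) y"
      unfolding D_D[OF xy(2) k v]
      by (rule linear_map_sweedler[OF V_module V_module bilinear_map_right[OF \<nu>_bilinear]])
        (use assms xy in auto)
  qed
  also have "\<dots> = sw V (\<lambda>x y. sw V
      (\<lambda>x\<^sub>1 x\<^sub>2. \<nu> (act x\<^sub>1 b) (\<nu> (act x\<^sub>2 \<one>\<^bsub>A\<^esub>) (D (y \<star> k) v))) x) h"
    using assms by (intro sweedler_coassoc[symmetric] V_module linear_intros; simp)
  also have "\<dots> = sw V (\<lambda>x y. \<nu> (act x b) (D (y \<star> k) v)) h"
  proof (rule sweedler_cong[OF V_module h])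
    fix x y assume xy: "x \<in> carrier H" "y \<in> carrier H"
    let ?w = "D (y \<star> k) v"
    show "\<nu> (act x b) ?w \<in> carrier V" using assms xy by simp
    have "\<nu> (act x b) ?w = \<nu> (act x (b \<bullet> \<one>\<^bsub>A\<^esub>)) ?w" using b by simp
    also have "\<dots> = \<nu> (sw A (\<lambda>x\<^sub>1 x\<^sub>2. act x\<^sub>1 b \<bullet> act x\<^sub>2 \<one>\<^bsub>A\<^esub>) x) ?w"
      using b xy by (simp only: act_mult A_one_closed)
    also have "\<dots> = sw V (\<lambda>x\<^sub>1 x\<^sub>2. \<nu> (act x\<^sub>1 b \<bullet> act x\<^sub>2 \<one>\<^bsub>A\<^esub>) ?w) x"
      by (rule linear_map_sweedler[OF A_module V_module bilinear_map_left[OF \<nu>_bilinear]])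
        (use assms xy in auto)
    also have "\<dots> = sw V (\<lambda>x\<^sub>1 x\<^sub>2. \<nu> (act x\<^sub>1 b) (\<nu> (act x\<^sub>2 \<one>\<^bsub>A\<^esub>) ?w)) x"
      by (rule sweedler_cong[OF V_module]) (use assms xy in \<open>auto simp: \<nu>_mult\<close>)
    finally show "sw V (\<lambda>x\<^sub>1 x\<^sub>2. \<nu> (act x\<^sub>1 b) (\<nu> (act x\<^sub>2 \<one>\<^bsub>A\<^esub>) ?w)) x = \<nu> (act x b) ?w"
      by simp
  qed
  finally show ?thesis .
qed

definition smash_act :: "('a \<times> 'h \<Rightarrow> 'k) set \<Rightarrow> 'v \<Rightarrow> 'v"
  where "smash_act t v = tensor_lift K A H V (\<lambda>a h. \<nu> a (D h v)) t"

lemma smash_act_bilinear: "bilinear_map K AH V V smash_act"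
  and smash_act_pure: "\<lbrakk>a \<in> carrier A; h \<in> carrier H; v \<in> carrier V\<rbrakk> \<Longrightarrow>
    smash_act (pure_tensor K A H a h) v = \<nu> a (D h v)"
proof -
  have bil: "bilinear_map K A H V (\<lambda>a h. \<nu> a (D h v))" if "v \<in> carrier V" for v
    using that by (intro bilinear_mapI linear_intros; simp)
  show "bilinear_map K AH V V smash_act"
    unfolding smash_act_def
    by (intro bilinear_mapI tensor_lift_linear tensor_lift_param_linear A_module H_module V_module bil
        linear_intros; simp)
  show "smash_act (pure_tensor K A H a h) v = \<nu> a (D h v)"
    if "a \<in> carrier A" "h \<in> carrier H" "v \<in> carrier V"
    unfolding smash_act_def using that by (simp add: tensor_lift_pure[OF A_module H_module V_module bil])
qed

lemma smash_act_product_pure: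
  assumes "a \<in> carrier A" "h \<in> carrier H" "b \<in> carrier A" "k \<in> carrier H" "v \<in> carrier V"
  shows "smash_act (left_product (pure_tensor K A H a h) (pure_tensor K A H b k)) v = \<nu> a (D h (\<nu> b (D k v)))"
proof -
  have "smash_act (left_product (pure_tensor K A H a h) (pure_tensor K A H b k)) v
      = sw V (\<lambda>h\<^sub>1 h\<^sub>2. smash_act (pure_tensor K A H (a \<bullet> act h\<^sub>1 b) (h\<^sub>2 \<star> k)) v) h"
    unfolding left_product_pure[OF assms(1-4)]
    by (rule linear_map_sweedler[OF AH_module V_module bilinear_map_left[OF smash_act_bilinear]])
      (use assms in auto)
  also have "\<dots> = sw V (\<lambda>h\<^sub>1 h\<^sub>2. \<nu> a (\<nu> (act h\<^sub>1 b) (D (h\<^sub>2 \<star> k) v))) h"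
    by (rule sweedler_cong[OF V_module]) (use assms in \<open>auto simp: smash_act_pure \<nu>_mult\<close>)
  also have "\<dots> = \<nu> a (sw V (\<lambda>h\<^sub>1 h\<^sub>2. \<nu> (act h\<^sub>1 b) (D (h\<^sub>2 \<star> k) v)) h)"
    by (rule linear_map_sweedler[OF V_module V_module bilinear_map_right[OF \<nu>_bilinear], symmetric])
      (use assms in auto)
  finally show ?thesis using assms by (simp add: D_mult_D)
qed

text \<open>
  By \<open>D_mult_D\<close> the formula \<open>(a \<otimes> h) v = a (h \<cdot> v)\<close> respects products already on the whole non-unital
  algebra \<open>A \<otimes> H\<close>; passing to the unital part only adds that the unit acts as the identity.
\<close>

lemma smash_act_product:
  assumes x: "x \<in> carrier AH" and y: "y \<in> carrier AH"
    and v: "v \<in> carrier V"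
  shows "smash_act (left_product x y) v = smash_act x (smash_act y v)"
proof -
  let ?T = AH
  note lin = bilinear_map_compose_left[OF smash_act_bilinear v]
    and cl = bilinear_map_closed[OF smash_act_bilinear]
  note prod_left = bilinear_map_left[OF left_product_bilinear]
    and prod_right = bilinear_map_right[OF left_product_bilinear]
  show ?thesis
  proof (rule tensor_product_ext[OF A_module H_module V_module _ _ _ x])
    show "linear_map K ?T V (\<lambda>x. smash_act (left_product x y) v)"
      using y by (intro lin prod_left)
    show "linear_map K ?T V (\<lambda>x. smash_act x (smash_act y v))"
      using y v by (intro bilinear_map_left[OF smash_act_bilinear] cl)
    fix a h assume ah: "a \<in> carrier A" "h \<in> carrier H"
    show "smash_act (left_product (pure_tensor K A H a h) y) v
        = smash_act (pure_tensor K A H a h) (smash_act y v)"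
    proof (rule tensor_product_ext[OF A_module H_module V_module _ _ _ y])
      show "linear_map K ?T V (\<lambda>y. smash_act (left_product (pure_tensor K A H a h) y) v)"
        using ah by (intro lin prod_right) auto
      show "linear_map K ?T V (\<lambda>y. smash_act (pure_tensor K A H a h) (smash_act y v))"
        using ah v by (intro bilinear_map_compose_right[OF smash_act_bilinear]
            bilinear_map_left[OF smash_act_bilinear]) auto
      show "smash_act (left_product (pure_tensor K A H a h) (pure_tensor K A H b k)) v
          = smash_act (pure_tensor K A H a h) (smash_act (pure_tensor K A H b k) v)"
        if "b \<in> carrier A" "k \<in> carrier H" for b k
        using that ah v by (simp add: smash_act_product_pure smash_act_pure)
    qed
  qed
qed

lemma smash_act_hash:
  assumes "a \<in> carrier A" "h \<in> carrier H" "v \<in> carrier V"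
  shows "smash_act (left_hash K H \<Delta> A act a h) v = \<nu> a (D h v)"
  using assms smash_act_product_pure[of a h "\<one>\<^bsub>A\<^esub>" "\<one>\<^bsub>H\<^esub>" v] by (simp add: left_hash_product)

lemma smash_act_module: "left_module_over K (left_smash K H \<Delta> A act) V smash_act"
proof -
  have sub: "x \<in> carrier (left_smash K H \<Delta> A act) \<Longrightarrow> x \<in> carrier AH" for x
    using left_smash_subset by blast
  have "bilinear_map K (left_smash K H \<Delta> A act) V V smash_act"
    using smash_act_bilinear sub
    by (auto simp: bilinear_map_def linear_map_def left_smash_simps(4,5) Pi_iff)
  then show ?thesis
    by (auto simp: left_module_over_def left_smash_simps(2,3) smash_act_product sub smash_act_hash)
qed

end

context acted_algebra
begin

lemma regular_left_partial_module: "left_partial_module K H \<Delta> \<epsilon> S A act A (mult A) act"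
  by (intro left_partial_module.intro left_partial_module_axioms.intro)
    (rule acted_algebra_axioms A_module A_mult_bilinear A_mult_assoc A_one_mult
      act_bilinear act_one act_mult act_act_left; assumption)+

lemma act_mult_act_left:
  "\<lbrakk>h \<in> carrier H; b \<in> carrier A; k \<in> carrier H; a \<in> carrier A\<rbrakk> \<Longrightarrow>
    act h (b \<bullet> act k a) = sw A (\<lambda>h\<^sub>1 h\<^sub>2. act h\<^sub>1 b \<bullet> act (h\<^sub>2 \<star> k) a) h"
  by (rule left_partial_module.D_mult_D[OF regular_left_partial_module])

lemmas left_hash_ambient_closed [simp] = bilinear_map_closed[OF left_hash_bilinear]

lemmas [linear_intros] =
  bilinear_map_compose_left[OF left_hash_bilinear] bilinear_map_compose_right[OF left_hash_bilinear]

lemma left_hash_H_mult: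
  assumes c: "c \<in> carrier A" and g: "g \<in> carrier H" and k: "k \<in> carrier H"
  shows "left_hash K H \<Delta> A act c (g \<star> k) = sw AH
    (\<lambda>k\<^sub>1 k\<^sub>2. sw AH
      (\<lambda>g\<^sub>1 g\<^sub>2. pure_tensor K A H (c \<bullet> act (g\<^sub>1 \<star> k\<^sub>1) \<one>\<^bsub>A\<^esub>) (g\<^sub>2 \<star> k\<^sub>2)) g) k"
proof -
  have "bilinear_map K H H AH (\<lambda>x y. pure_tensor K A H (c \<bullet> act x \<one>\<^bsub>A\<^esub>) y)"
    using c by (intro bilinear_mapI linear_intros; simp)
  then have "left_hash K H \<Delta> A act c (g \<star> k) = sw AH
    (\<lambda>g\<^sub>1 g\<^sub>2. sw AH
      (\<lambda>k\<^sub>1 k\<^sub>2. pure_tensor K A H (c \<bullet> act (g\<^sub>1 \<star> k\<^sub>1) \<one>\<^bsub>A\<^esub>) (g\<^sub>2 \<star> k\<^sub>2)) k) g"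
    unfolding left_hash_def by (rule sweedler_mult[OF AH_module _ g k])
  also have "\<dots> = sw AH
    (\<lambda>k\<^sub>1 k\<^sub>2. sw AH
      (\<lambda>g\<^sub>1 g\<^sub>2. pure_tensor K A H (c \<bullet> act (g\<^sub>1 \<star> k\<^sub>1) \<one>\<^bsub>A\<^esub>) (g\<^sub>2 \<star> k\<^sub>2)) g) k"
    using c by (intro sweedler_swap AH_module g k linear_intros; simp)
  finally show ?thesis .
qed

text \<open>
  The second factor is \<open>b (k\<^sub>1 \<cdot> 1) \<otimes> k\<^sub>2\<close>, so the product is \<open>a (h\<^sub>1 \<cdot> (b (k\<^sub>1 \<cdot> 1))) \<otimes> h\<^sub>2 k\<^sub>2\<close>, that is
  \<open>a (h\<^sub>1 \<cdot> b) (h\<^sub>2 k\<^sub>1 \<cdot> 1) \<otimes> h\<^sub>3 k\<^sub>2\<close>. The factors \<open>h\<^sub>2 k\<^sub>1\<close> and \<open>h\<^sub>3 k\<^sub>2\<close> make up the coproduct of \<open>h\<^sub>2 k\<close>.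
\<close>

lemma left_product_pure_hash:
  assumes a: "a \<in> carrier A" and h: "h \<in> carrier H" and b: "b \<in> carrier A" and k: "k \<in> carrier H"
  shows "left_product (pure_tensor K A H a h) (left_hash K H \<Delta> A act b k) =
    sw AH
      (\<lambda>h\<^sub>1 h\<^sub>2. left_hash K H \<Delta> A act (a \<bullet> act h\<^sub>1 b) (h\<^sub>2 \<star> k)) h"
proof -
  let ?p = "pure_tensor K A H" and ?sw = "sw AH"
  have inner: "left_product (?p a h) (?p (b \<bullet> act k\<^sub>1 \<one>\<^bsub>A\<^esub>) k\<^sub>2)
      = ?sw (\<lambda>x y. ?sw (\<lambda>y\<^sub>1 y\<^sub>2. ?p (a \<bullet> (act x b \<bullet> act (y\<^sub>1 \<star> k\<^sub>1) \<one>\<^bsub>A\<^esub>)) (y\<^sub>2 \<star> k\<^sub>2)) y) h"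
    if k12: "k\<^sub>1 \<in> carrier H" "k\<^sub>2 \<in> carrier H" for k\<^sub>1 k\<^sub>2
  proof -
    have "left_product (?p a h) (?p (b \<bullet> act k\<^sub>1 \<one>\<^bsub>A\<^esub>) k\<^sub>2)
        = ?sw (\<lambda>x y. ?p (a \<bullet> act x (b \<bullet> act k\<^sub>1 \<one>\<^bsub>A\<^esub>)) (y \<star> k\<^sub>2)) h"
      using a b h k12 by (intro left_product_pure) auto
    also have "\<dots> = ?sw (\<lambda>x y. ?sw (\<lambda>x\<^sub>1 x\<^sub>2. ?p (a \<bullet> (act x\<^sub>1 b \<bullet> act (x\<^sub>2 \<star> k\<^sub>1) \<one>\<^bsub>A\<^esub>)) (y \<star> k\<^sub>2)) x) h"
    proof (rule sweedler_cong[OF AH_module h])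
      fix x y assume xy: "x \<in> carrier H" "y \<in> carrier H"
      show "?sw (\<lambda>x\<^sub>1 x\<^sub>2. ?p (a \<bullet> (act x\<^sub>1 b \<bullet> act (x\<^sub>2 \<star> k\<^sub>1) \<one>\<^bsub>A\<^esub>)) (y \<star> k\<^sub>2)) x
          \<in> carrier AH"
        using a b k12 xy by (intro sweedler_closed AH_module) auto
      have lin: "linear_map K A AH (\<lambda>z. ?p (a \<bullet> z) (y \<star> k\<^sub>2))"
        using a k12 xy by (intro linear_intros; simp)
      have "act x (b \<bullet> act k\<^sub>1 \<one>\<^bsub>A\<^esub>) = sw A (\<lambda>x\<^sub>1 x\<^sub>2. act x\<^sub>1 b \<bullet> act (x\<^sub>2 \<star> k\<^sub>1) \<one>\<^bsub>A\<^esub>) x"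
        using b k12 xy by (intro act_mult_act_left) auto
      also have "?p (a \<bullet> \<dots>) (y \<star> k\<^sub>2)
          = ?sw (\<lambda>x\<^sub>1 x\<^sub>2. ?p (a \<bullet> (act x\<^sub>1 b \<bullet> act (x\<^sub>2 \<star> k\<^sub>1) \<one>\<^bsub>A\<^esub>)) (y \<star> k\<^sub>2)) x"
        using b k12 xy by (intro linear_map_sweedler[OF A_module AH_module lin]) auto
      finally show "?p (a \<bullet> act x (b \<bullet> act k\<^sub>1 \<one>\<^bsub>A\<^esub>)) (y \<star> k\<^sub>2) = \<dots>" .
    qed
    also have "\<dots> = ?sw (\<lambda>x y. ?sw (\<lambda>y\<^sub>1 y\<^sub>2. ?p (a \<bullet> (act x b \<bullet> act (y\<^sub>1 \<star> k\<^sub>1) \<one>\<^bsub>A\<^esub>)) (y\<^sub>2 \<star> k\<^sub>2)) y) h"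
      using a b k12 by (intro sweedler_coassoc AH_module h linear_intros; simp)
    finally show ?thesis .
  qed
  have "left_product (?p a h) (left_hash K H \<Delta> A act b k)
      = ?sw (\<lambda>k\<^sub>1 k\<^sub>2. left_product (?p a h) (?p (b \<bullet> act k\<^sub>1 \<one>\<^bsub>A\<^esub>) k\<^sub>2)) k"
    unfolding left_hash_def
    by (rule linear_map_sweedler[OF AH_module AH_module bilinear_map_right[OF left_product_bilinear] k])
      (use a b h in auto)
  also have "\<dots> = ?sw (\<lambda>k\<^sub>1 k\<^sub>2. ?sw (\<lambda>x y. ?sw (\<lambda>y\<^sub>1 y\<^sub>2.
      ?p (a \<bullet> (act x b \<bullet> act (y\<^sub>1 \<star> k\<^sub>1) \<one>\<^bsub>A\<^esub>)) (y\<^sub>2 \<star> k\<^sub>2)) y) h) k"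
    by (intro sweedler_cong AH_module k inner sweedler_closed h) (use a b in auto)
  also have "\<dots> = ?sw (\<lambda>x y. ?sw (\<lambda>k\<^sub>1 k\<^sub>2. ?sw (\<lambda>y\<^sub>1 y\<^sub>2.
      ?p (a \<bullet> (act x b \<bullet> act (y\<^sub>1 \<star> k\<^sub>1) \<one>\<^bsub>A\<^esub>)) (y\<^sub>2 \<star> k\<^sub>2)) y) k) h"
    using a b by (intro sweedler_swap sweedler_param_linear AH_module h k linear_intros; simp)
  also have "\<dots> = ?sw (\<lambda>x y. left_hash K H \<Delta> A act (a \<bullet> act x b) (y \<star> k)) h"
  proof (rule sweedler_cong[OF AH_module h])
    fix x y assume xy: "x \<in> carrier H" "y \<in> carrier H"
    have "?sw (\<lambda>k\<^sub>1 k\<^sub>2. ?sw (\<lambda>y\<^sub>1 y\<^sub>2. ?p (a \<bullet> (act x b \<bullet> act (y\<^sub>1 \<star> k\<^sub>1) \<one>\<^bsub>A\<^esub>)) (y\<^sub>2 \<star> k\<^sub>2)) y) k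
        = ?sw (\<lambda>k\<^sub>1 k\<^sub>2. ?sw (\<lambda>y\<^sub>1 y\<^sub>2. ?p (a \<bullet> act x b \<bullet> act (y\<^sub>1 \<star> k\<^sub>1) \<one>\<^bsub>A\<^esub>) (y\<^sub>2 \<star> k\<^sub>2)) y) k"
      using a b xy by (intro sweedler_cong sweedler_closed AH_module k) (simp_all add: A_mult_assoc)
    also have "\<dots> = left_hash K H \<Delta> A act (a \<bullet> act x b) (y \<star> k)"
      using a b xy k by (intro left_hash_H_mult[symmetric]) simp_all
    finally show "?sw (\<lambda>k\<^sub>1 k\<^sub>2. ?sw (\<lambda>y\<^sub>1 y\<^sub>2. ?p (a \<bullet> (act x b \<bullet> act (y\<^sub>1 \<star> k\<^sub>1) \<one>\<^bsub>A\<^esub>)) (y\<^sub>2 \<star> k\<^sub>2)) y) k = \<dots>" .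
  qed (use a b k in auto)
  finally show ?thesis .
qed

text \<open>
  In \<open>(a (h\<^sub>1 \<cdot> 1) \<otimes> h\<^sub>2)(b # k)\<close> the factor \<open>h\<^sub>1 \<cdot> 1\<close> is absorbed by \<open>h\<^sub>2 \<cdot> b\<close>, which reduces the
  product of \<open>a # h\<close> and \<open>b # k\<close> to \<open>(a \<otimes> h)(b # k)\<close>. The result is the multiplication table of the
  smash product.
\<close>

lemma left_product_hash_hash:
  assumes a: "a \<in> carrier A" and h: "h \<in> carrier H" and b: "b \<in> carrier A" and k: "k \<in> carrier H"
  shows "left_product (left_hash K H \<Delta> A act a h) (left_hash K H \<Delta> A act b k) =
    sw AH
      (\<lambda>h\<^sub>1 h\<^sub>2. left_hash K H \<Delta> A act (a \<bullet> act h\<^sub>1 b) (h\<^sub>2 \<star> k)) h"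
proof -
  let ?p = "pure_tensor K A H" and ?sw = "sw AH"
  let ?hash = "left_hash K H \<Delta> A act"
  have "left_product (?hash a h) (?hash b k) = ?sw (\<lambda>x y. left_product (?p (a \<bullet> act x \<one>\<^bsub>A\<^esub>) y) (?hash b k)) h"
    unfolding left_hash_def[of K H \<Delta> A act a h]
    by (rule linear_map_sweedler[OF AH_module AH_module bilinear_map_left[OF left_product_bilinear] h])
      (use a b k in auto)
  also have "\<dots> = ?sw (\<lambda>x y. ?sw (\<lambda>y\<^sub>1 y\<^sub>2. ?hash (a \<bullet> act x \<one>\<^bsub>A\<^esub> \<bullet> act y\<^sub>1 b) (y\<^sub>2 \<star> k)) y) h"
    by (intro sweedler_cong AH_module h left_product_pure_hash sweedler_closed) (use a b k in auto)
  also have "\<dots> = ?sw (\<lambda>x y. ?sw (\<lambda>x\<^sub>1 x\<^sub>2. ?hash (a \<bullet> act x\<^sub>1 \<one>\<^bsub>A\<^esub> \<bullet> act x\<^sub>2 b) (y \<star> k)) x) h"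
    using a b k by (intro sweedler_coassoc[symmetric] AH_module h linear_intros; simp)
  also have "\<dots> = ?sw (\<lambda>x y. ?hash (a \<bullet> act x b) (y \<star> k)) h"
  proof (rule sweedler_cong[OF AH_module h])
    fix x y assume xy: "x \<in> carrier H" "y \<in> carrier H"
    have lin: "linear_map K A AH (\<lambda>z. ?hash (a \<bullet> z) (y \<star> k))"
      using a k xy by (intro linear_intros; simp)
    have "?sw (\<lambda>x\<^sub>1 x\<^sub>2. ?hash (a \<bullet> act x\<^sub>1 \<one>\<^bsub>A\<^esub> \<bullet> act x\<^sub>2 b) (y \<star> k)) x
        = ?sw (\<lambda>x\<^sub>1 x\<^sub>2. ?hash (a \<bullet> (act x\<^sub>1 \<one>\<^bsub>A\<^esub> \<bullet> act x\<^sub>2 b)) (y \<star> k)) x"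
      using a b k xy by (intro sweedler_cong AH_module) (auto simp: A_mult_assoc)
    also have "\<dots> = ?hash (a \<bullet> sw A (\<lambda>x\<^sub>1 x\<^sub>2. act x\<^sub>1 \<one>\<^bsub>A\<^esub> \<bullet> act x\<^sub>2 b) x) (y \<star> k)"
      using b xy by (intro linear_map_sweedler[OF A_module AH_module lin, symmetric]) auto
    also have "\<dots> = ?hash (a \<bullet> act x b) (y \<star> k)"
      using act_mult[OF xy(1) A_one_closed b] b by simp
    finally show "?sw (\<lambda>x\<^sub>1 x\<^sub>2. ?hash (a \<bullet> act x\<^sub>1 \<one>\<^bsub>A\<^esub> \<bullet> act x\<^sub>2 b) (y \<star> k)) x = \<dots>" .
  qed (use a b k in auto)
  finally show ?thesis .
qed

lemma left_product_hash_one: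
  assumes "a \<in> carrier A" "k \<in> carrier H"
  shows "left_product (left_hash K H \<Delta> A act a \<one>\<^bsub>H\<^esub>) (left_hash K H \<Delta> A act \<one>\<^bsub>A\<^esub> k) = left_hash K H \<Delta> A act a k"
proof -
  have "bilinear_map K H H AH
      (\<lambda>h\<^sub>1 h\<^sub>2. left_hash K H \<Delta> A act (a \<bullet> act h\<^sub>1 \<one>\<^bsub>A\<^esub>) (h\<^sub>2 \<star> k))"
    using assms by (intro bilinear_mapI linear_intros; simp)
  then show ?thesis
    using assms by (simp add: left_product_hash_hash sweedler_one[OF AH_module])
qed

text \<open>
  A module over the smash product returns a partial action by \<open>h \<cdot> v = (1 # h) v\<close>: the multiplication
  table gives \<open>(1 # h)(1 # k) = (h\<^sub>1 \<cdot> 1) # h\<^sub>2 k = ((h\<^sub>1 \<cdot> 1) # 1)(1 # h\<^sub>2 k)\<close>.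
\<close>

lemma left_smash_module_partial:
  assumes V: "module K V" and lact: "left_module_over K (left_smash K H \<Delta> A act) V lact"
  defines "D \<equiv> \<lambda>h. lact (left_hash K H \<Delta> A act \<one>\<^bsub>A\<^esub> h)"
  shows "bilinear_map K H V V D"
    and "v \<in> carrier V \<Longrightarrow> D \<one>\<^bsub>H\<^esub> v = v"
    and "\<lbrakk>h \<in> carrier H; k \<in> carrier H; v \<in> carrier V\<rbrakk> \<Longrightarrow> D h (D k v) =
      sw V (\<lambda>h\<^sub>1 h\<^sub>2. lact (left_hash K H \<Delta> A act (act h\<^sub>1 \<one>\<^bsub>A\<^esub>) \<one>\<^bsub>H\<^esub>) (D (h\<^sub>2 \<star> k) v)) h"
proof -
  let ?T = AH and ?hash = "left_hash K H \<Delta> A act"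
  \<comment> \<open>\<open>lact\<close> is linear on the unital part only; composed with this projection it becomes linear on the
    whole tensor product, so that Sweedler sums can be taken out of it\<close>
  let ?\<rho> = "\<lambda>t. left_product t (pure_tensor K A H \<one>\<^bsub>A\<^esub> \<one>\<^bsub>H\<^esub>)"
  have bil: "bilinear_map K (left_smash K H \<Delta> A act) V V lact"
    and mult: "\<And>x y v. \<lbrakk>x \<in> carrier (left_smash K H \<Delta> A act); y \<in> carrier (left_smash K H \<Delta> A act);
      v \<in> carrier V\<rbrakk> \<Longrightarrow> lact (left_product x y) v = lact x (lact y v)"
    and one: "\<And>v. v \<in> carrier V \<Longrightarrow> lact (?hash \<one>\<^bsub>A\<^esub> \<one>\<^bsub>H\<^esub>) v = v"
    using lact by (simp_all add: left_module_over_def left_smash_simps(2,3))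
  have \<rho>: "linear_map K ?T (left_smash K H \<Delta> A act) ?\<rho>"
    using bilinear_map_left[OF left_product_bilinear, of "pure_tensor K A H \<one>\<^bsub>A\<^esub> \<one>\<^bsub>H\<^esub>"]
    by (auto simp: linear_map_def left_smash_simps)
  have lact_\<rho>: "bilinear_map K ?T V V (\<lambda>t. lact (?\<rho> t))"
    by (intro bilinear_mapI bilinear_map_right[OF bil] bilinear_map_compose_left[OF bil] \<rho>
        linear_map_closed[OF \<rho>])
  have lact_hash: "lact (?hash a h) = lact (?\<rho> (pure_tensor K A H a h))"
    if "a \<in> carrier A" "h \<in> carrier H" for a h
    using that by (simp add: left_hash_product)
  have D: "D h v = lact (?\<rho> (pure_tensor K A H \<one>\<^bsub>A\<^esub> h)) v" if "h \<in> carrier H" for h v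
    unfolding D_def using that by (simp add: lact_hash)
  show D_bil: "bilinear_map K H V V D"
  proof (rule bilinear_mapI)
    show "linear_map K V V (D h)" if "h \<in> carrier H" for h
      unfolding D_def using that by (intro bilinear_map_right[OF bil] left_hash_closed) auto
    show "linear_map K H V (\<lambda>h. D h v)" if "v \<in> carrier V" for v
    proof (rule linear_map_cong[OF H_module])
      show "linear_map K H V (\<lambda>h. lact (?\<rho> (pure_tensor K A H \<one>\<^bsub>A\<^esub> h)) v)"
        using that by (intro bilinear_map_compose_left[OF lact_\<rho>] linear_intros) simp_all
    qed (rule D)
  qed
  show "D \<one>\<^bsub>H\<^esub> v = v" if "v \<in> carrier V" unfolding D_def using that by (rule one)
  fix h k v assume h: "h \<in> carrier H" and k: "k \<in> carrier H" and v: "v \<in> carrier V"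
  have "D h (D k v) = lact (left_product (?hash \<one>\<^bsub>A\<^esub> h) (?hash \<one>\<^bsub>A\<^esub> k)) v"
    unfolding D_def using h k v by (simp add: mult left_hash_closed)
  also have "left_product (?hash \<one>\<^bsub>A\<^esub> h) (?hash \<one>\<^bsub>A\<^esub> k)
      = sw ?T (\<lambda>h\<^sub>1 h\<^sub>2. ?\<rho> (pure_tensor K A H (act h\<^sub>1 \<one>\<^bsub>A\<^esub>) (h\<^sub>2 \<star> k))) h"
    unfolding left_product_hash_hash[OF A_one_closed h A_one_closed k]
    by (rule sweedler_cong[OF AH_module h])
      (use k in \<open>auto simp: left_hash_product intro!: bilinear_map_closed[OF left_product_bilinear]\<close>)
  also have "\<dots> = ?\<rho> (sw ?T (\<lambda>h\<^sub>1 h\<^sub>2. pure_tensor K A H (act h\<^sub>1 \<one>\<^bsub>A\<^esub>) (h\<^sub>2 \<star> k)) h)"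
    by (rule linear_map_sweedler[OF AH_module AH_module bilinear_map_left[OF left_product_bilinear] h, symmetric])
      (use k in auto)
  also have "lact \<dots> v = sw V
      (\<lambda>h\<^sub>1 h\<^sub>2. lact (?\<rho> (pure_tensor K A H (act h\<^sub>1 \<one>\<^bsub>A\<^esub>) (h\<^sub>2 \<star> k))) v) h"
    by (rule linear_map_sweedler[OF AH_module V bilinear_map_left[OF lact_\<rho> v] h]) (use k in auto)
  also have "\<dots> = sw V (\<lambda>h\<^sub>1 h\<^sub>2. lact (?hash (act h\<^sub>1 \<one>\<^bsub>A\<^esub>) \<one>\<^bsub>H\<^esub>) (D (h\<^sub>2 \<star> k) v)) h"
  proof (rule sweedler_cong[OF V h])
    fix x y assume xy: "x \<in> carrier H" "y \<in> carrier H"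
    show "lact (?hash (act x \<one>\<^bsub>A\<^esub>) \<one>\<^bsub>H\<^esub>) (D (y \<star> k) v) \<in> carrier V"
      using xy k v by (intro bilinear_map_closed[OF bil] bilinear_map_closed[OF D_bil] left_hash_closed) auto
    show "lact (?\<rho> (pure_tensor K A H (act x \<one>\<^bsub>A\<^esub>) (y \<star> k))) v
        = lact (?hash (act x \<one>\<^bsub>A\<^esub>) \<one>\<^bsub>H\<^esub>) (D (y \<star> k) v)"
      unfolding D_def using xy k v
      by (simp add: lact_hash[symmetric] mult[symmetric] left_hash_closed left_product_hash_one)
  qed
  finally show "D h (D k v) =
      sw V (\<lambda>h\<^sub>1 h\<^sub>2. lact (?hash (act h\<^sub>1 \<one>\<^bsub>A\<^esub>) \<one>\<^bsub>H\<^esub>) (D (h\<^sub>2 \<star> k) v)) h" .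
qed

end

section \<open>Right smash products\<close>

lemma op_algebra_simps [simp]:
  "carrier (op_algebra H) = carrier H" "\<one>\<^bsub>op_algebra H\<^esub> = \<one>\<^bsub>H\<^esub>"
  "x \<otimes>\<^bsub>op_algebra H\<^esub> y = y \<otimes>\<^bsub>H\<^esub> x"
  "x \<oplus>\<^bsub>op_algebra H\<^esub> y = x \<oplus>\<^bsub>H\<^esub> y" "c \<odot>\<^bsub>op_algebra H\<^esub> x = c \<odot>\<^bsub>H\<^esub> x"
  by (simp_all add: op_algebra_def)

text \<open>
  The opposite algebra has the same underlying coalgebra and vector space, so all tensor products with
  it are literally those with \<open>H\<close>; it enters the right smash product through the multiplication alone.
\<close>

lemma op_algebra_tensor [simp]:
  "tensor_product K (op_algebra H) A = tensor_product K H A"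
  "pure_tensor K (op_algebra H) A = pure_tensor K H A"
  "tensor_lift K (op_algebra H) A = tensor_lift K H A"
  "sweedler K (op_algebra H) \<Delta> = sweedler K H \<Delta>"
  by (simp_all add: fun_eq_iff tensor_product_def tensor_kernel_def tensor_relators_def pure_tensor_def
      tensor_lift_def sweedler_def Let_def)

context acted_algebra
begin

abbreviation (input) right_product :: "('h \<times> 'a \<Rightarrow> 'k) set \<Rightarrow> ('h \<times> 'a \<Rightarrow> 'k) set \<Rightarrow> ('h \<times> 'a \<Rightarrow> 'k) set"
  where "right_product \<equiv> mult (right_smash_ambient K (op_algebra H) \<Delta> A (\<lambda>a h. act h a))"

abbreviation (input) op_hash :: "'h \<Rightarrow> 'a \<Rightarrow> ('h \<times> 'a \<Rightarrow> 'k) set"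
  where "op_hash \<equiv> right_hash K (op_algebra H) \<Delta> A (\<lambda>a h. act h a)"

abbreviation (input) op_smash :: "('k, ('h \<times> 'a \<Rightarrow> 'k) set) module"
  where "op_smash \<equiv> right_smash K (op_algebra H) \<Delta> A (\<lambda>a h. act h a)"

lemma op_hash_def: "op_hash h a = sw HA
    (\<lambda>h\<^sub>1 h\<^sub>2. pure_tensor K H A h\<^sub>1 (act h\<^sub>2 \<one>\<^bsub>A\<^esub> \<bullet> a)) h"
  by (simp add: right_hash_def)

lemma op_smash_simps:
  "carrier op_smash =
    (\<lambda>x. right_product (pure_tensor K H A \<one>\<^bsub>H\<^esub> \<one>\<^bsub>A\<^esub>) x) ` carrier HA"
  "mult op_smash = right_product"
  "\<one>\<^bsub>op_smash\<^esub> = op_hash \<one>\<^bsub>H\<^esub> \<one>\<^bsub>A\<^esub>"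
  "add op_smash = add HA"
  "smult op_smash = smult HA"
  by (simp_all add: right_smash_def right_smash_ambient_def Let_def)

abbreviation (input) right_term :: "'h \<Rightarrow> 'a \<Rightarrow> 'h \<Rightarrow> 'a \<Rightarrow> ('h \<times> 'a \<Rightarrow> 'k) set"
  where "right_term k b h a \<equiv> sw HA
    (\<lambda>h\<^sub>1 h\<^sub>2. pure_tensor K H A (h\<^sub>1 \<star> k) (act h\<^sub>2 b \<bullet> a)) h"

lemma right_term_linear:
  assumes "a \<in> carrier A" "h \<in> carrier H" "b \<in> carrier A" "k \<in> carrier H"
  shows "linear_map K H HA (\<lambda>k. right_term k b h a)"
    and "linear_map K A HA (\<lambda>b. right_term k b h a)"
    and "linear_map K H HA (\<lambda>h. right_term k b h a)"
    and "linear_map K A HA (\<lambda>a. right_term k b h a)"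
  using assms
  by (intro sweedler_param_linear sweedler_linear bilinear_mapI HA_module linear_intros; simp)+

lemma right_product_bilinear:
  "bilinear_map K HA HA HA right_product"
  and right_product_pure: "\<lbrakk>k \<in> carrier H; b \<in> carrier A; h \<in> carrier H; a \<in> carrier A\<rbrakk> \<Longrightarrow>
    right_product (pure_tensor K H A k b) (pure_tensor K H A h a) = right_term k b h a"
proof -
  let ?T = HA
  let ?inner = "\<lambda>y k b. tensor_lift K H A ?T (\<lambda>h a. right_term k b h a) y"
  have prod: "right_product x y = tensor_lift K H A ?T (?inner y) x" for x y
    by (simp add: right_smash_ambient_def Let_def)
  note lift = tensor_lift_linear[OF H_module A_module HA_module]
    and param = tensor_lift_param_linear[OF H_module A_module HA_module]
  have inner: "bilinear_map K H A ?T (?inner y)" if "y \<in> carrier ?T" for y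
    using that by (intro bilinear_mapI param right_term_linear) auto
  have bil: "bilinear_map K H A ?T (right_term k b)" if "k \<in> carrier H" "b \<in> carrier A" for k b
    using that by (intro bilinear_mapI right_term_linear) auto
  show "bilinear_map K ?T ?T ?T right_product"
    unfolding prod by (intro bilinear_mapI param lift inner bil)
  show "right_product (pure_tensor K H A k b) (pure_tensor K H A h a) = right_term k b h a"
    if "k \<in> carrier H" "b \<in> carrier A" "h \<in> carrier H" "a \<in> carrier A"
    using that unfolding prod
    by (simp add: tensor_lift_pure[OF H_module A_module HA_module] inner bil)
qed

lemma op_hash_bilinear: "bilinear_map K H A HA op_hash"
  unfolding op_hash_def
  by (intro bilinear_mapI sweedler_param_linear sweedler_linear HA_module linear_intros; simp)

lemma op_hash_product:
  assumes "h \<in> carrier H" "a \<in> carrier A"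
  shows "op_hash h a
    = right_product (pure_tensor K H A \<one>\<^bsub>H\<^esub> \<one>\<^bsub>A\<^esub>) (pure_tensor K H A h a)"
  unfolding right_product_pure[OF H_one_closed A_one_closed assms] op_hash_def
  by (rule sweedler_cong[OF HA_module]) (use assms in auto)

lemma op_hash_closed:
  "\<lbrakk>h \<in> carrier H; a \<in> carrier A\<rbrakk> \<Longrightarrow> op_hash h a \<in> carrier op_smash"
  by (auto simp: op_hash_product op_smash_simps)

lemma op_smash_subset: "carrier op_smash \<subseteq> carrier HA"
  by (auto simp: op_smash_simps intro!: bilinear_map_closed[OF right_product_bilinear])

end


text \<open>
  The mirror image of \<open>left_partial_module\<close>: what a block carries over the diagonal algebra of its
  column. \<open>H\<close> still acts from the left, and the second form of the composition law takes the
  place of the first.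
\<close>

locale right_partial_module = acted_algebra K H \<Delta> \<epsilon> S A act
  for K :: "'k ring" and H :: "('k, 'h) module" and \<Delta> and \<epsilon> and S
    and A :: "('k, 'a) module" and act +
  fixes V :: "('k, 'v) module" and \<nu> :: "'v \<Rightarrow> 'a \<Rightarrow> 'v" and D :: "'h \<Rightarrow> 'v \<Rightarrow> 'v"
  assumes V_module: "module K V"
    and \<nu>_bilinear: "bilinear_map K V A V \<nu>"
    and \<nu>_mult: "\<lbrakk>v \<in> carrier V; a \<in> carrier A; b \<in> carrier A\<rbrakk> \<Longrightarrow> \<nu> v (a \<bullet> b) = \<nu> (\<nu> v a) b"
    and \<nu>_one [simp]: "v \<in> carrier V \<Longrightarrow> \<nu> v \<one>\<^bsub>A\<^esub> = v"
    and D_bilinear: "bilinear_map K H V V D"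
    and D_one [simp]: "v \<in> carrier V \<Longrightarrow> D \<one>\<^bsub>H\<^esub> v = v"
    and D_mult: "\<lbrakk>h \<in> carrier H; v \<in> carrier V; a \<in> carrier A\<rbrakk> \<Longrightarrow>
      D h (\<nu> v a) = sw V (\<lambda>h\<^sub>1 h\<^sub>2. \<nu> (D h\<^sub>1 v) (act h\<^sub>2 a)) h"
    and D_D: "\<lbrakk>h \<in> carrier H; k \<in> carrier H; v \<in> carrier V\<rbrakk> \<Longrightarrow>
      D h (D k v) = sw V (\<lambda>h\<^sub>1 h\<^sub>2. \<nu> (D (h\<^sub>1 \<star> k) v) (act h\<^sub>2 \<one>\<^bsub>A\<^esub>)) h"
begin

lemmas \<nu>_closed [simp] = bilinear_map_closed[OF \<nu>_bilinear]
  and D_closed [simp] = bilinear_map_closed[OF D_bilinear]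

lemmas [linear_intros] =
  bilinear_map_compose_left[OF \<nu>_bilinear] bilinear_map_compose_right[OF \<nu>_bilinear]
  bilinear_map_compose_left[OF D_bilinear] bilinear_map_compose_right[OF D_bilinear]

text \<open>
  The mirror image \<open>h \<cdot> ((k \<cdot> v) b) = (h\<^sub>1 k \<cdot> v) (h\<^sub>2 \<cdot> b)\<close> of \<open>left_partial_module.D_mult_D\<close>. It
  makes \<open>v (h \<otimes> a) = (h \<cdot> v) a\<close> respect products.
\<close>

lemma D_D_mult:
  assumes h: "h \<in> carrier H" and k: "k \<in> carrier H" and v: "v \<in> carrier V" and b: "b \<in> carrier A"
  shows "D h (\<nu> (D k v) b) = sw V (\<lambda>h\<^sub>1 h\<^sub>2. \<nu> (D (h\<^sub>1 \<star> k) v) (act h\<^sub>2 b)) h"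
proof -
  have "D h (\<nu> (D k v) b) = sw V (\<lambda>x y. \<nu> (D x (D k v)) (act y b)) h"
    using assms by (intro D_mult) auto
  also have "\<dots> = sw V (\<lambda>x y. sw V
      (\<lambda>x\<^sub>1 x\<^sub>2. \<nu> (\<nu> (D (x\<^sub>1 \<star> k) v) (act x\<^sub>2 \<one>\<^bsub>A\<^esub>)) (act y b)) x) h"
  proof (rule sweedler_cong[OF V_module h])
    fix x y assume xy: "x \<in> carrier H" "y \<in> carrier H"
    show "sw V (\<lambda>x\<^sub>1 x\<^sub>2. \<nu> (\<nu> (D (x\<^sub>1 \<star> k) v) (act x\<^sub>2 \<one>\<^bsub>A\<^esub>)) (act y b)) x \<in> carrier V"
      using assms xy by (intro sweedler_closed V_module) auto
    show "\<nu> (D x (D k v)) (act y b) = sw V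
        (\<lambda>x\<^sub>1 x\<^sub>2. \<nu> (\<nu> (D (x\<^sub>1 \<star> k) v) (act x\<^sub>2 \<one>\<^bsub>A\<^esub>)) (act y b)) x"
      unfolding D_D[OF xy(1) k v]
      by (rule linear_map_sweedler[OF V_module V_module bilinear_map_left[OF \<nu>_bilinear]])
        (use assms xy in auto)
  qed
  also have "\<dots> = sw V (\<lambda>x y. sw V
      (\<lambda>y\<^sub>1 y\<^sub>2. \<nu> (\<nu> (D (x \<star> k) v) (act y\<^sub>1 \<one>\<^bsub>A\<^esub>)) (act y\<^sub>2 b)) y) h"
    using assms by (intro sweedler_coassoc V_module linear_intros; simp)
  also have "\<dots> = sw V (\<lambda>x y. \<nu> (D (x \<star> k) v) (act y b)) h"
  proof (rule sweedler_cong[OF V_module h])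
    fix x y assume xy: "x \<in> carrier H" "y \<in> carrier H"
    let ?w = "D (x \<star> k) v"
    show "\<nu> ?w (act y b) \<in> carrier V" using assms xy by simp
    have "\<nu> ?w (act y b) = \<nu> ?w (act y (\<one>\<^bsub>A\<^esub> \<bullet> b))" using b by simp
    also have "\<dots> = \<nu> ?w (sw A (\<lambda>y\<^sub>1 y\<^sub>2. act y\<^sub>1 \<one>\<^bsub>A\<^esub> \<bullet> act y\<^sub>2 b) y)"
      using b xy by (simp only: act_mult A_one_closed)
    also have "\<dots> = sw V (\<lambda>y\<^sub>1 y\<^sub>2. \<nu> ?w (act y\<^sub>1 \<one>\<^bsub>A\<^esub> \<bullet> act y\<^sub>2 b)) y"
      by (rule linear_map_sweedler[OF A_module V_module bilinear_map_right[OF \<nu>_bilinear]])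
        (use assms xy in auto)
    also have "\<dots> = sw V (\<lambda>y\<^sub>1 y\<^sub>2. \<nu> (\<nu> ?w (act y\<^sub>1 \<one>\<^bsub>A\<^esub>)) (act y\<^sub>2 b)) y"
      by (rule sweedler_cong[OF V_module]) (use assms xy in \<open>auto simp: \<nu>_mult\<close>)
    finally show "sw V (\<lambda>y\<^sub>1 y\<^sub>2. \<nu> (\<nu> ?w (act y\<^sub>1 \<one>\<^bsub>A\<^esub>)) (act y\<^sub>2 b)) y = \<nu> ?w (act y b)"
      by simp
  qed
  finally show ?thesis .
qed

definition smash_act :: "'v \<Rightarrow> ('h \<times> 'a \<Rightarrow> 'k) set \<Rightarrow> 'v"
  where "smash_act v t = tensor_lift K H A V (\<lambda>h a. \<nu> (D h v) a) t"

lemma smash_act_bilinear: "bilinear_map K V HA V smash_act"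
  and smash_act_pure: "\<lbrakk>h \<in> carrier H; a \<in> carrier A; v \<in> carrier V\<rbrakk> \<Longrightarrow>
    smash_act v (pure_tensor K H A h a) = \<nu> (D h v) a"
proof -
  have bil: "bilinear_map K H A V (\<lambda>h a. \<nu> (D h v) a)" if "v \<in> carrier V" for v
    using that by (intro bilinear_mapI linear_intros; simp)
  show "bilinear_map K V HA V smash_act"
    unfolding smash_act_def
    by (intro bilinear_mapI tensor_lift_linear tensor_lift_param_linear A_module H_module V_module bil
        linear_intros; simp)
  show "smash_act v (pure_tensor K H A h a) = \<nu> (D h v) a"
    if "h \<in> carrier H" "a \<in> carrier A" "v \<in> carrier V"
    unfolding smash_act_def using that by (simp add: tensor_lift_pure[OF H_module A_module V_module bil])
qed

lemma smash_act_product_pure: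
  assumes "k \<in> carrier H" "b \<in> carrier A" "h \<in> carrier H" "a \<in> carrier A" "v \<in> carrier V"
  shows "smash_act v (right_product (pure_tensor K H A k b) (pure_tensor K H A h a)) = \<nu> (D h (\<nu> (D k v) b)) a"
proof -
  have "smash_act v (right_product (pure_tensor K H A k b) (pure_tensor K H A h a))
      = sw V (\<lambda>h\<^sub>1 h\<^sub>2. smash_act v (pure_tensor K H A (h\<^sub>1 \<star> k) (act h\<^sub>2 b \<bullet> a))) h"
    unfolding right_product_pure[OF assms(1-4)]
    by (rule linear_map_sweedler[OF HA_module V_module bilinear_map_right[OF smash_act_bilinear]])
      (use assms in auto)
  also have "\<dots> = sw V (\<lambda>h\<^sub>1 h\<^sub>2. \<nu> (\<nu> (D (h\<^sub>1 \<star> k) v) (act h\<^sub>2 b)) a) h"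
    by (rule sweedler_cong[OF V_module]) (use assms in \<open>auto simp: smash_act_pure \<nu>_mult\<close>)
  also have "\<dots> = \<nu> (sw V (\<lambda>h\<^sub>1 h\<^sub>2. \<nu> (D (h\<^sub>1 \<star> k) v) (act h\<^sub>2 b)) h) a"
    by (rule linear_map_sweedler[OF V_module V_module bilinear_map_left[OF \<nu>_bilinear], symmetric])
      (use assms in auto)
  finally show ?thesis using assms by (simp add: D_D_mult)
qed

lemma smash_act_product:
  assumes x: "x \<in> carrier HA" and y: "y \<in> carrier HA"
    and v: "v \<in> carrier V"
  shows "smash_act v (right_product x y) = smash_act (smash_act v x) y"
proof -
  let ?T = HA
  note lin = bilinear_map_compose_right[OF smash_act_bilinear v]
    and cl = bilinear_map_closed[OF smash_act_bilinear]
  note prod_left = bilinear_map_left[OF right_product_bilinear]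
    and prod_right = bilinear_map_right[OF right_product_bilinear]
  show ?thesis
  proof (rule tensor_product_ext[OF H_module A_module V_module _ _ _ x])
    show "linear_map K ?T V (\<lambda>x. smash_act v (right_product x y))"
      using y by (intro lin prod_left)
    show "linear_map K ?T V (\<lambda>x. smash_act (smash_act v x) y)"
      using y v by (intro bilinear_map_compose_left[OF smash_act_bilinear]
            bilinear_map_right[OF smash_act_bilinear])
    fix k b assume kb: "k \<in> carrier H" "b \<in> carrier A"
    show "smash_act v (right_product (pure_tensor K H A k b) y)
        = smash_act (smash_act v (pure_tensor K H A k b)) y"
    proof (rule tensor_product_ext[OF H_module A_module V_module _ _ _ y])
      show "linear_map K ?T V (\<lambda>y. smash_act v (right_product (pure_tensor K H A k b) y))"
        using kb by (intro lin prod_right) auto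
      show "linear_map K ?T V (\<lambda>y. smash_act (smash_act v (pure_tensor K H A k b)) y)"
        using kb v by (intro bilinear_map_right[OF smash_act_bilinear] cl) auto
      show "smash_act v (right_product (pure_tensor K H A k b) (pure_tensor K H A h a))
          = smash_act (smash_act v (pure_tensor K H A k b)) (pure_tensor K H A h a)"
        if "h \<in> carrier H" "a \<in> carrier A" for h a
        using that kb v by (simp add: smash_act_product_pure smash_act_pure)
    qed
  qed
qed

lemma smash_act_hash:
  assumes "h \<in> carrier H" "a \<in> carrier A" "v \<in> carrier V"
  shows "smash_act v (op_hash h a) = \<nu> (D h v) a"
  using assms smash_act_product_pure[of "\<one>\<^bsub>H\<^esub>" "\<one>\<^bsub>A\<^esub>" h a v] by (simp add: op_hash_product)

lemma smash_act_module: "right_module_over K op_smash V smash_act"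
proof -
  have sub: "x \<in> carrier op_smash \<Longrightarrow> x \<in> carrier HA" for x
    using op_smash_subset by blast
  have "bilinear_map K V op_smash V smash_act"
    using smash_act_bilinear sub
    by (auto simp: bilinear_map_def linear_map_def op_smash_simps(4,5) Pi_iff)
  then show ?thesis
    by (auto simp: right_module_over_def op_smash_simps(2,3) smash_act_product sub smash_act_hash)
qed

end

context acted_algebra
begin

lemma regular_right_partial_module: "right_partial_module K H \<Delta> \<epsilon> S A act A (mult A) act"
  by (intro right_partial_module.intro right_partial_module_axioms.intro)
    (rule acted_algebra_axioms A_module A_mult_bilinear A_mult_assoc[symmetric] A_mult_one
      act_bilinear act_one act_mult act_act_right; assumption)+

lemma act_act_mult_right:
  "\<lbrakk>h \<in> carrier H; k \<in> carrier H; a \<in> carrier A; b \<in> carrier A\<rbrakk> \<Longrightarrow>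
    act h (act k a \<bullet> b) = sw A (\<lambda>h\<^sub>1 h\<^sub>2. act (h\<^sub>1 \<star> k) a \<bullet> act h\<^sub>2 b) h"
  by (rule right_partial_module.D_D_mult[OF regular_right_partial_module])

lemmas op_hash_ambient_closed [simp] = bilinear_map_closed[OF op_hash_bilinear]

lemmas [linear_intros] =
  bilinear_map_compose_left[OF op_hash_bilinear] bilinear_map_compose_right[OF op_hash_bilinear]

lemma op_hash_H_mult:
  assumes c: "c \<in> carrier A" and g: "g \<in> carrier H" and k: "k \<in> carrier H"
  shows "op_hash (g \<star> k) c = sw HA
    (\<lambda>k\<^sub>1 k\<^sub>2. sw HA
      (\<lambda>g\<^sub>1 g\<^sub>2. pure_tensor K H A (g\<^sub>1 \<star> k\<^sub>1) (act (g\<^sub>2 \<star> k\<^sub>2) \<one>\<^bsub>A\<^esub> \<bullet> c)) g) k"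
proof -
  have "bilinear_map K H H HA (\<lambda>x y. pure_tensor K H A x (act y \<one>\<^bsub>A\<^esub> \<bullet> c))"
    using c by (intro bilinear_mapI linear_intros; simp)
  then have "op_hash (g \<star> k) c = sw HA
    (\<lambda>g\<^sub>1 g\<^sub>2. sw HA
      (\<lambda>k\<^sub>1 k\<^sub>2. pure_tensor K H A (g\<^sub>1 \<star> k\<^sub>1) (act (g\<^sub>2 \<star> k\<^sub>2) \<one>\<^bsub>A\<^esub> \<bullet> c)) k) g"
    unfolding op_hash_def by (rule sweedler_mult[OF HA_module _ g k])
  also have "\<dots> = sw HA
    (\<lambda>k\<^sub>1 k\<^sub>2. sw HA
      (\<lambda>g\<^sub>1 g\<^sub>2. pure_tensor K H A (g\<^sub>1 \<star> k\<^sub>1) (act (g\<^sub>2 \<star> k\<^sub>2) \<one>\<^bsub>A\<^esub> \<bullet> c)) g) k"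
    using c by (intro sweedler_swap HA_module g k linear_intros; simp)
  finally show ?thesis .
qed

lemma right_product_hash_pure:
  assumes k: "k \<in> carrier H" and b: "b \<in> carrier A" and h: "h \<in> carrier H" and a: "a \<in> carrier A"
  shows "right_product (op_hash k b) (pure_tensor K H A h a) =
    sw HA
      (\<lambda>h\<^sub>1 h\<^sub>2. op_hash (h\<^sub>1 \<star> k) (act h\<^sub>2 b \<bullet> a)) h"
proof -
  let ?p = "pure_tensor K H A" and ?sw = "sw HA"
  have inner: "right_product (?p k\<^sub>1 (act k\<^sub>2 \<one>\<^bsub>A\<^esub> \<bullet> b)) (?p h a)
      = ?sw (\<lambda>x y. ?sw (\<lambda>x\<^sub>1 x\<^sub>2. ?p (x\<^sub>1 \<star> k\<^sub>1) (act (x\<^sub>2 \<star> k\<^sub>2) \<one>\<^bsub>A\<^esub> \<bullet> act y b \<bullet> a)) x) h"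
    if k12: "k\<^sub>1 \<in> carrier H" "k\<^sub>2 \<in> carrier H" for k\<^sub>1 k\<^sub>2
  proof -
    have "right_product (?p k\<^sub>1 (act k\<^sub>2 \<one>\<^bsub>A\<^esub> \<bullet> b)) (?p h a)
        = ?sw (\<lambda>x y. ?p (x \<star> k\<^sub>1) (act y (act k\<^sub>2 \<one>\<^bsub>A\<^esub> \<bullet> b) \<bullet> a)) h"
      using a b h k12 by (intro right_product_pure) auto
    also have "\<dots> = ?sw (\<lambda>x y. ?sw (\<lambda>y\<^sub>1 y\<^sub>2. ?p (x \<star> k\<^sub>1) (act (y\<^sub>1 \<star> k\<^sub>2) \<one>\<^bsub>A\<^esub> \<bullet> act y\<^sub>2 b \<bullet> a)) y) h"
    proof (rule sweedler_cong[OF HA_module h])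
      fix x y assume xy: "x \<in> carrier H" "y \<in> carrier H"
      show "?sw (\<lambda>y\<^sub>1 y\<^sub>2. ?p (x \<star> k\<^sub>1) (act (y\<^sub>1 \<star> k\<^sub>2) \<one>\<^bsub>A\<^esub> \<bullet> act y\<^sub>2 b \<bullet> a)) y
          \<in> carrier HA"
        using a b k12 xy by (intro sweedler_closed HA_module) auto
      have lin: "linear_map K A HA (\<lambda>z. ?p (x \<star> k\<^sub>1) (z \<bullet> a))"
        using a k12 xy by (intro linear_intros; simp)
      have "act y (act k\<^sub>2 \<one>\<^bsub>A\<^esub> \<bullet> b) = sw A (\<lambda>y\<^sub>1 y\<^sub>2. act (y\<^sub>1 \<star> k\<^sub>2) \<one>\<^bsub>A\<^esub> \<bullet> act y\<^sub>2 b) y"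
        using b k12 xy by (intro act_act_mult_right) auto
      also have "?p (x \<star> k\<^sub>1) (\<dots> \<bullet> a)
          = ?sw (\<lambda>y\<^sub>1 y\<^sub>2. ?p (x \<star> k\<^sub>1) (act (y\<^sub>1 \<star> k\<^sub>2) \<one>\<^bsub>A\<^esub> \<bullet> act y\<^sub>2 b \<bullet> a)) y"
        using b k12 xy by (intro linear_map_sweedler[OF A_module HA_module lin]) auto
      finally show "?p (x \<star> k\<^sub>1) (act y (act k\<^sub>2 \<one>\<^bsub>A\<^esub> \<bullet> b) \<bullet> a) = \<dots>" .
    qed
    also have "\<dots> = ?sw (\<lambda>x y. ?sw (\<lambda>x\<^sub>1 x\<^sub>2. ?p (x\<^sub>1 \<star> k\<^sub>1) (act (x\<^sub>2 \<star> k\<^sub>2) \<one>\<^bsub>A\<^esub> \<bullet> act y b \<bullet> a)) x) h"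
      using a b k12 by (intro sweedler_coassoc[symmetric] HA_module h linear_intros; simp)
    finally show ?thesis .
  qed
  have "right_product (op_hash k b) (?p h a)
      = ?sw (\<lambda>k\<^sub>1 k\<^sub>2. right_product (?p k\<^sub>1 (act k\<^sub>2 \<one>\<^bsub>A\<^esub> \<bullet> b)) (?p h a)) k"
    unfolding op_hash_def
    by (rule linear_map_sweedler[OF HA_module HA_module bilinear_map_left[OF right_product_bilinear] k])
      (use a b h in auto)
  also have "\<dots> = ?sw (\<lambda>k\<^sub>1 k\<^sub>2. ?sw (\<lambda>x y. ?sw (\<lambda>x\<^sub>1 x\<^sub>2.
      ?p (x\<^sub>1 \<star> k\<^sub>1) (act (x\<^sub>2 \<star> k\<^sub>2) \<one>\<^bsub>A\<^esub> \<bullet> act y b \<bullet> a)) x) h) k"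
    by (intro sweedler_cong HA_module k inner sweedler_closed h) (use a b in auto)
  also have "\<dots> = ?sw (\<lambda>x y. ?sw (\<lambda>k\<^sub>1 k\<^sub>2. ?sw (\<lambda>x\<^sub>1 x\<^sub>2.
      ?p (x\<^sub>1 \<star> k\<^sub>1) (act (x\<^sub>2 \<star> k\<^sub>2) \<one>\<^bsub>A\<^esub> \<bullet> act y b \<bullet> a)) x) k) h"
    using a b by (intro sweedler_swap sweedler_param_linear HA_module h k linear_intros; simp)
  also have "\<dots> = ?sw (\<lambda>x y. op_hash (x \<star> k) (act y b \<bullet> a)) h"
  proof (rule sweedler_cong[OF HA_module h])
    fix x y assume xy: "x \<in> carrier H" "y \<in> carrier H"
    have "?sw (\<lambda>k\<^sub>1 k\<^sub>2. ?sw (\<lambda>x\<^sub>1 x\<^sub>2. ?p (x\<^sub>1 \<star> k\<^sub>1) (act (x\<^sub>2 \<star> k\<^sub>2) \<one>\<^bsub>A\<^esub> \<bullet> act y b \<bullet> a)) x) k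
        = ?sw (\<lambda>k\<^sub>1 k\<^sub>2. ?sw (\<lambda>x\<^sub>1 x\<^sub>2. ?p (x\<^sub>1 \<star> k\<^sub>1) (act (x\<^sub>2 \<star> k\<^sub>2) \<one>\<^bsub>A\<^esub> \<bullet> (act y b \<bullet> a))) x) k"
      using a b xy by (intro sweedler_cong sweedler_closed HA_module k) (simp_all add: A_mult_assoc)
    also have "\<dots> = op_hash (x \<star> k) (act y b \<bullet> a)"
      using a b xy k by (intro op_hash_H_mult[symmetric]) simp_all
    finally show "?sw (\<lambda>k\<^sub>1 k\<^sub>2. ?sw (\<lambda>x\<^sub>1 x\<^sub>2. ?p (x\<^sub>1 \<star> k\<^sub>1) (act (x\<^sub>2 \<star> k\<^sub>2) \<one>\<^bsub>A\<^esub> \<bullet> act y b \<bullet> a)) x) k = \<dots>" .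
  qed (use a b k in auto)
  finally show ?thesis .
qed

text \<open>
  Again a factor \<open>h\<^sub>2 \<cdot> 1\<close> is absorbed, here by \<open>h\<^sub>1 \<cdot> b\<close> on its left. The product of \<open>h\<^sub>1\<close> and \<open>k\<close> appears
  in reversed order because of the passage to the opposite algebra.
\<close>

lemma right_product_hash_hash:
  assumes k: "k \<in> carrier H" and b: "b \<in> carrier A" and h: "h \<in> carrier H" and a: "a \<in> carrier A"
  shows "right_product (op_hash k b) (op_hash h a) =
    sw HA
      (\<lambda>h\<^sub>1 h\<^sub>2. op_hash (h\<^sub>1 \<star> k) (act h\<^sub>2 b \<bullet> a)) h"
proof -
  let ?p = "pure_tensor K H A" and ?sw = "sw HA"
  have "right_product (op_hash k b) (op_hash h a) = 
      ?sw (\<lambda>x y. right_product (op_hash k b) (?p x (act y \<one>\<^bsub>A\<^esub> \<bullet> a))) h"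
    unfolding op_hash_def[of h a]
    by (rule linear_map_sweedler[OF HA_module HA_module bilinear_map_right[OF right_product_bilinear] h])
      (use a b k in auto)
  also have "\<dots> = ?sw (\<lambda>x y. ?sw (\<lambda>x\<^sub>1 x\<^sub>2. op_hash (x\<^sub>1 \<star> k) (act x\<^sub>2 b \<bullet> (act y \<one>\<^bsub>A\<^esub> \<bullet> a))) x) h"
    by (intro sweedler_cong HA_module h right_product_hash_pure sweedler_closed) (use a b k in auto)
  also have "\<dots> = ?sw (\<lambda>x y. ?sw (\<lambda>y\<^sub>1 y\<^sub>2. op_hash (x \<star> k) (act y\<^sub>1 b \<bullet> (act y\<^sub>2 \<one>\<^bsub>A\<^esub> \<bullet> a))) y) h"
    using a b k by (intro sweedler_coassoc HA_module h linear_intros; simp)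
  also have "\<dots> = ?sw (\<lambda>x y. op_hash (x \<star> k) (act y b \<bullet> a)) h"
  proof (rule sweedler_cong[OF HA_module h])
    fix x y assume xy: "x \<in> carrier H" "y \<in> carrier H"
    have lin: "linear_map K A HA (\<lambda>z. op_hash (x \<star> k) (z \<bullet> a))"
      using a k xy by (intro linear_intros; simp)
    have "?sw (\<lambda>y\<^sub>1 y\<^sub>2. op_hash (x \<star> k) (act y\<^sub>1 b \<bullet> (act y\<^sub>2 \<one>\<^bsub>A\<^esub> \<bullet> a))) y
        = ?sw (\<lambda>y\<^sub>1 y\<^sub>2. op_hash (x \<star> k) (act y\<^sub>1 b \<bullet> act y\<^sub>2 \<one>\<^bsub>A\<^esub> \<bullet> a)) y"
      using a b k xy by (intro sweedler_cong HA_module) (auto simp: A_mult_assoc)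
    also have "\<dots> = op_hash (x \<star> k) (sw A (\<lambda>y\<^sub>1 y\<^sub>2. act y\<^sub>1 b \<bullet> act y\<^sub>2 \<one>\<^bsub>A\<^esub>) y \<bullet> a)"
      using b xy by (intro linear_map_sweedler[OF A_module HA_module lin, symmetric]) auto
    also have "\<dots> = op_hash (x \<star> k) (act y b \<bullet> a)"
      using act_mult[OF xy(2) b A_one_closed] b by simp
    finally show "?sw (\<lambda>y\<^sub>1 y\<^sub>2. op_hash (x \<star> k) (act y\<^sub>1 b \<bullet> (act y\<^sub>2 \<one>\<^bsub>A\<^esub> \<bullet> a))) y = \<dots>" .
  qed (use a b k in auto)
  finally show ?thesis .
qed

lemma right_product_hash_one:
  assumes "k \<in> carrier H" "a \<in> carrier A"
  shows "right_product (op_hash k \<one>\<^bsub>A\<^esub>) (op_hash \<one>\<^bsub>H\<^esub> a) = op_hash k a"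
proof -
  have "bilinear_map K H H HA
      (\<lambda>h\<^sub>1 h\<^sub>2. op_hash (h\<^sub>1 \<star> k) (act h\<^sub>2 \<one>\<^bsub>A\<^esub> \<bullet> a))"
    using assms by (intro bilinear_mapI linear_intros; simp)
  then show ?thesis
    using assms by (simp add: right_product_hash_hash sweedler_one[OF HA_module])
qed

text \<open>
  Here \<open>h \<cdot> v = v (h # 1)\<close>, and the opposite multiplication turns \<open>(k # 1)(h # 1)\<close> into
  \<open>h\<^sub>1 k # (h\<^sub>2 \<cdot> 1)\<close>. This is the source of the second form of the composition law.
\<close>

lemma right_smash_module_partial:
  assumes V: "module K V" and ract: "right_module_over K op_smash V ract"
  defines "D \<equiv> \<lambda>h v. ract v (op_hash h \<one>\<^bsub>A\<^esub>)"
  assumes h: "h \<in> carrier H" and k: "k \<in> carrier H" and v: "v \<in> carrier V"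
  shows "D h (D k v) =
      sw V (\<lambda>h\<^sub>1 h\<^sub>2. ract (D (h\<^sub>1 \<star> k) v) (op_hash \<one>\<^bsub>H\<^esub> (act h\<^sub>2 \<one>\<^bsub>A\<^esub>))) h"
proof -
  let ?T = HA
  let ?\<rho> = "\<lambda>t. right_product (pure_tensor K H A \<one>\<^bsub>H\<^esub> \<one>\<^bsub>A\<^esub>) t"
  have bil: "bilinear_map K V op_smash V ract"
    and mult: "\<And>x y v. \<lbrakk>x \<in> carrier op_smash; y \<in> carrier op_smash;
      v \<in> carrier V\<rbrakk> \<Longrightarrow> ract v (right_product x y) = ract (ract v x) y"
    using ract by (simp_all add: right_module_over_def op_smash_simps(2,3))
  have \<rho>: "linear_map K ?T op_smash ?\<rho>"
    using bilinear_map_right[OF right_product_bilinear, of "pure_tensor K H A \<one>\<^bsub>H\<^esub> \<one>\<^bsub>A\<^esub>"]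
    by (auto simp: linear_map_def op_smash_simps)
  have ract_\<rho>: "bilinear_map K V ?T V (\<lambda>v t. ract v (?\<rho> t))"
    by (intro bilinear_mapI bilinear_map_left[OF bil] bilinear_map_compose_right[OF bil] \<rho>
        linear_map_closed[OF \<rho>])
  have ract_hash: "ract v (op_hash h a) = ract v (?\<rho> (pure_tensor K H A h a))"
    if "a \<in> carrier A" "h \<in> carrier H" for a h v
    using that by (simp add: op_hash_product)
  have "D h (D k v) = ract v (right_product (op_hash k \<one>\<^bsub>A\<^esub>) (op_hash h \<one>\<^bsub>A\<^esub>))"
    unfolding D_def using h k v by (simp add: mult op_hash_closed)
  also have "right_product (op_hash k \<one>\<^bsub>A\<^esub>) (op_hash h \<one>\<^bsub>A\<^esub>)
      = sw ?T (\<lambda>h\<^sub>1 h\<^sub>2. ?\<rho> (pure_tensor K H A (h\<^sub>1 \<star> k) (act h\<^sub>2 \<one>\<^bsub>A\<^esub>))) h"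
    unfolding right_product_hash_hash[OF k A_one_closed h A_one_closed]
    by (rule sweedler_cong[OF HA_module h])
      (use k in \<open>auto simp: op_hash_product intro!: bilinear_map_closed[OF right_product_bilinear]\<close>)
  also have "\<dots> = ?\<rho> (sw ?T (\<lambda>h\<^sub>1 h\<^sub>2. pure_tensor K H A (h\<^sub>1 \<star> k) (act h\<^sub>2 \<one>\<^bsub>A\<^esub>)) h)"
    by (rule linear_map_sweedler[OF HA_module HA_module bilinear_map_right[OF right_product_bilinear] h, symmetric])
      (use k in auto)
  also have "ract v \<dots> = sw V
      (\<lambda>h\<^sub>1 h\<^sub>2. ract v (?\<rho> (pure_tensor K H A (h\<^sub>1 \<star> k) (act h\<^sub>2 \<one>\<^bsub>A\<^esub>)))) h"
    by (rule linear_map_sweedler[OF HA_module V bilinear_map_right[OF ract_\<rho> v] h]) (use k in auto)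
  also have "\<dots> = sw V (\<lambda>h\<^sub>1 h\<^sub>2. ract (D (h\<^sub>1 \<star> k) v) (op_hash \<one>\<^bsub>H\<^esub> (act h\<^sub>2 \<one>\<^bsub>A\<^esub>))) h"
  proof (rule sweedler_cong[OF V h])
    fix x y assume xy: "x \<in> carrier H" "y \<in> carrier H"
    show "ract (D (x \<star> k) v) (op_hash \<one>\<^bsub>H\<^esub> (act y \<one>\<^bsub>A\<^esub>)) \<in> carrier V"
      unfolding D_def using xy k v by (intro bilinear_map_closed[OF bil] op_hash_closed) auto
    show "ract v (?\<rho> (pure_tensor K H A (x \<star> k) (act y \<one>\<^bsub>A\<^esub>)))
        = ract (D (x \<star> k) v) (op_hash \<one>\<^bsub>H\<^esub> (act y \<one>\<^bsub>A\<^esub>))"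
      unfolding D_def using xy k v
      by (simp add: ract_hash[symmetric] mult[symmetric] op_hash_closed right_product_hash_one)
  qed
  finally show ?thesis .
qed

end

section \<open>Generalized matrix algebras\<close>

lemma diag_algebra_simps [simp]:
  "carrier (diag_algebra K M \<theta> \<eta> i) = carrier (M i i)"
  "mult (diag_algebra K M \<theta> \<eta> i) = \<theta> i i i"
  "\<one>\<^bsub>diag_algebra K M \<theta> \<eta> i\<^esub> = \<eta> i \<one>\<^bsub>K\<^esub>"
  "\<zero>\<^bsub>diag_algebra K M \<theta> \<eta> i\<^esub> = \<zero>\<^bsub>M i i\<^esub>"
  "add (diag_algebra K M \<theta> \<eta> i) = add (M i i)"
  "smult (diag_algebra K M \<theta> \<eta> i) = smult (M i i)"
  by (simp_all add: diag_algebra_def)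

lemma linear_map_from_diag: "linear_map K (diag_algebra K M \<theta> \<eta> i) V f = linear_map K (M i i) V f"
  and linear_map_to_diag: "linear_map K U (diag_algebra K M \<theta> \<eta> i) g = linear_map K U (M i i) g"
  by (simp_all add: linear_map_def)

lemma bilinear_map_diag1 [simp]:
    "bilinear_map K (diag_algebra K M \<theta> \<eta> i) V W f = bilinear_map K (M i i) V W f"
  and bilinear_map_diag2 [simp]:
    "bilinear_map K U (diag_algebra K M \<theta> \<eta> i) W g = bilinear_map K U (M i i) W g"
  and bilinear_map_diag3 [simp]:
    "bilinear_map K U V (diag_algebra K M \<theta> \<eta> i) k = bilinear_map K U V (M i i) k"
  by (simp_all add: bilinear_map_def linear_map_from_diag linear_map_to_diag)

lemma sweedler_diag [simp]:
  "sweedler K H \<Delta> (diag_algebra K M \<theta> \<eta> i) = sweedler K H \<Delta> (M i i)"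
  by (simp add: fun_eq_iff sweedler_def tensor_lift_def finsum_def)

context generalized_matrix_algebra
begin

lemma unit_closed [simp]: "i \<in> {1..n} \<Longrightarrow> \<eta> i \<one> \<in> carrier (M i i)"
  using linear_map_closed[OF eta_linear] by (simp add: base_algebra_def)

lemma theta_closed [simp]:
  "\<lbrakk>i \<in> {1..n}; j \<in> {1..n}; k \<in> {1..n}; x \<in> carrier (M i j); y \<in> carrier (M j k)\<rbrakk> \<Longrightarrow>
    \<theta> i j k x y \<in> carrier (M i k)"
  by (rule bilinear_map_closed[OF theta_bilinear])

lemma theta_unit [simp]:
  assumes "i \<in> {1..n}" "j \<in> {1..n}" "m \<in> carrier (M i j)"
  shows "\<theta> i i j (\<eta> i \<one>) m = m" "\<theta> i j j m (\<eta> j \<one>) = m"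
proof -
  interpret Mij: module K "M i j" using assms by (intro vector_space)
  show "\<theta> i i j (\<eta> i \<one>) m = m" "\<theta> i j j m (\<eta> j \<one>) = m"
    using assms eta_left[of i j \<one> m] eta_right[of i j \<one> m] by simp_all
qed

lemma theta_zero [simp]:
  assumes "i \<in> {1..n}" "j \<in> {1..n}" "k \<in> {1..n}"
  shows "x \<in> carrier (M i j) \<Longrightarrow> \<theta> i j k x \<zero>\<^bsub>M j k\<^esub> = \<zero>\<^bsub>M i k\<^esub>"
    and "y \<in> carrier (M j k) \<Longrightarrow> \<theta> i j k \<zero>\<^bsub>M i j\<^esub> y = \<zero>\<^bsub>M i k\<^esub>"
  using assms
  by (auto intro!: linear_map_zero vector_space bilinear_map_right[OF theta_bilinear]
      bilinear_map_left[OF theta_bilinear])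

lemma diag_algebra_algebra:
  assumes i: "i \<in> {1..n}"
  shows "assoc_algebra K (diag_algebra K M \<theta> \<eta> i)"
proof -
  interpret Mi: module K "M i i" using i by (intro vector_space)
  note th = theta_bilinear[OF i i i]
  have ab: "abelian_group (diag_algebra K M \<theta> \<eta> i)"
    using Mi.M.abelian_group_axioms
    by (simp add: abelian_group_def abelian_monoid_def abelian_group_axioms_def)
  have mod: "module K (diag_algebra K M \<theta> \<eta> i)"
    by (rule moduleI)
      (simp_all add: ab Mi.smult_l_distr Mi.smult_r_distr Mi.smult_assoc1 is_cring)
  have mon: "Group.monoid (diag_algebra K M \<theta> \<eta> i)"
    by (rule monoidI) (use i in \<open>simp_all add: theta_assoc\<close>)
  have "ring (diag_algebra K M \<theta> \<eta> i)"
    by (rule ringI)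
      (use i in \<open>simp_all add: ab mon linear_map_add[OF bilinear_map_left[OF th]]
        linear_map_add[OF bilinear_map_right[OF th]]\<close>)
  with mod show ?thesis
    using i field_axioms
    by (auto simp: assoc_algebra_def assoc_algebra_axioms_def
        linear_map_smult[OF bilinear_map_left[OF th]] linear_map_smult[OF bilinear_map_right[OF th]])
qed

abbreviation (input) "Mat \<equiv> matrix_algebra K n M \<theta> \<eta>"

lemma matrix_carrier:
  "x \<in> carrier Mat \<longleftrightarrow> x \<in> extensional ({1..n} \<times> {1..n}) \<and>
    (\<forall>i\<in>{1..n}. \<forall>j\<in>{1..n}. x (i, j) \<in> carrier (M i j))"
  by (auto simp: matrix_algebra_def Let_def PiE_def Pi_def)

lemma matrix_entry_closed [simp]:
  "\<lbrakk>x \<in> carrier Mat; i \<in> {1..n}; j \<in> {1..n}\<rbrakk> \<Longrightarrow> x (i, j) \<in> carrier (M i j)"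
  by (simp add: matrix_carrier)

lemma matrix_ext:
  "\<lbrakk>x \<in> carrier Mat; y \<in> carrier Mat; \<And>i j. \<lbrakk>i \<in> {1..n}; j \<in> {1..n}\<rbrakk> \<Longrightarrow> x (i, j) = y (i, j)\<rbrakk> \<Longrightarrow> x = y"
  by (rule extensionalityI[where A = "{1..n} \<times> {1..n}"]) (auto simp: matrix_carrier)

lemma matrix_entries [simp]:
  assumes "i \<in> {1..n}" "j \<in> {1..n}"
  shows "(x \<otimes>\<^bsub>Mat\<^esub> y) (i, j) = (\<Oplus>\<^bsub>M i j\<^esub>k\<in>{1..n}. \<theta> i k j (x (i, k)) (y (k, j)))"
    and "\<one>\<^bsub>Mat\<^esub> (i, j) = (if i = j then \<eta> i \<one> else \<zero>\<^bsub>M i j\<^esub>)"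
    and "\<zero>\<^bsub>Mat\<^esub> (i, j) = \<zero>\<^bsub>M i j\<^esub>"
    and "(x \<oplus>\<^bsub>Mat\<^esub> y) (i, j) = x (i, j) \<oplus>\<^bsub>M i j\<^esub> y (i, j)"
    and "(c \<odot>\<^bsub>Mat\<^esub> x) (i, j) = c \<odot>\<^bsub>M i j\<^esub> x (i, j)"
    and "matrix_incl n M p q m (i, j) = (if i = p \<and> j = q then m else \<zero>\<^bsub>M i j\<^esub>)"
  using assms by (simp_all add: matrix_algebra_def matrix_incl_def Let_def)

lemma zero_entry_closed [simp]: "\<lbrakk>i \<in> {1..n}; j \<in> {1..n}\<rbrakk> \<Longrightarrow> \<zero>\<^bsub>M i j\<^esub> \<in> carrier (M i j)"
  using vector_space[of i j] by (meson abelian_group_def abelian_monoid.zero_closed module_def)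

lemma matrix_closed [simp]:
  "\<zero>\<^bsub>Mat\<^esub> \<in> carrier Mat" "\<one>\<^bsub>Mat\<^esub> \<in> carrier Mat"
  "\<lbrakk>x \<in> carrier Mat; y \<in> carrier Mat\<rbrakk> \<Longrightarrow> x \<oplus>\<^bsub>Mat\<^esub> y \<in> carrier Mat"
  "\<lbrakk>x \<in> carrier Mat; y \<in> carrier Mat\<rbrakk> \<Longrightarrow> x \<otimes>\<^bsub>Mat\<^esub> y \<in> carrier Mat"
  "\<lbrakk>c \<in> carrier K; x \<in> carrier Mat\<rbrakk> \<Longrightarrow> c \<odot>\<^bsub>Mat\<^esub> x \<in> carrier Mat"
  "\<lbrakk>p \<in> {1..n}; q \<in> {1..n}; m \<in> carrier (M p q)\<rbrakk> \<Longrightarrow> matrix_incl n M p q m \<in> carrier Mat"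
proof -
  have mod: "abelian_group (M i j)" "module K (M i j)" if "i \<in> {1..n}" "j \<in> {1..n}" for i j
    using vector_space[OF that] by (auto simp: module_def)
  have ext: "\<zero>\<^bsub>Mat\<^esub> \<in> extensional ({1..n} \<times> {1..n})" "\<one>\<^bsub>Mat\<^esub> \<in> extensional ({1..n} \<times> {1..n})"
    "x \<oplus>\<^bsub>Mat\<^esub> y \<in> extensional ({1..n} \<times> {1..n})" "x \<otimes>\<^bsub>Mat\<^esub> y \<in> extensional ({1..n} \<times> {1..n})"
    "c \<odot>\<^bsub>Mat\<^esub> x \<in> extensional ({1..n} \<times> {1..n})"
    "matrix_incl n M p q m \<in> extensional ({1..n} \<times> {1..n})"
    by (auto simp: matrix_algebra_def matrix_incl_def Let_def)
  show "\<zero>\<^bsub>Mat\<^esub> \<in> carrier Mat" "\<one>\<^bsub>Mat\<^esub> \<in> carrier Mat"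
    using ext by (auto simp: matrix_carrier)
  show "x \<oplus>\<^bsub>Mat\<^esub> y \<in> carrier Mat" if "x \<in> carrier Mat" "y \<in> carrier Mat"
    using that ext by (auto simp: matrix_carrier intro!: abelian_monoid.a_closed abelian_group.axioms(1) mod)
  show "x \<otimes>\<^bsub>Mat\<^esub> y \<in> carrier Mat" if "x \<in> carrier Mat" "y \<in> carrier Mat"
    using that ext
    by (auto simp: matrix_carrier intro!: abelian_monoid.finsum_closed abelian_group.axioms(1) mod)
  show "c \<odot>\<^bsub>Mat\<^esub> x \<in> carrier Mat" if "c \<in> carrier K" "x \<in> carrier Mat"
    using that ext by (auto simp: matrix_carrier intro!: module.smult_closed mod)
  show "matrix_incl n M p q m \<in> carrier Mat"
    if "p \<in> {1..n}" "q \<in> {1..n}" "m \<in> carrier (M p q)"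
    using that ext by (auto simp: matrix_carrier)
qed

lemma matrix_module: "module K Mat"
proof -
  have mod: "abelian_monoid (M i j)" "abelian_group (M i j)" "module K (M i j)"
    if "i \<in> {1..n}" "j \<in> {1..n}" for i j
    using vector_space[OF that] by (auto simp: module_def abelian_group_def)
  show ?thesis
  proof (rule moduleI)
    show "abelian_group Mat"
    proof (rule abelian_groupI)
      fix x assume x: "x \<in> carrier Mat"
      let ?y = "\<lambda>(i, j)\<in>{1..n} \<times> {1..n}. \<ominus>\<^bsub>M i j\<^esub> x (i, j)"
      have y: "?y \<in> carrier Mat"
        using x by (auto simp: matrix_carrier intro!: abelian_group.a_inv_closed mod)
      have "?y \<oplus>\<^bsub>Mat\<^esub> x = \<zero>\<^bsub>Mat\<^esub>"
        using x y by (intro matrix_ext) (auto simp: abelian_group.l_neg[OF mod(2)])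
      with y show "\<exists>y\<in>carrier Mat. y \<oplus>\<^bsub>Mat\<^esub> x = \<zero>\<^bsub>Mat\<^esub>" by blast
    next
      fix x y assume "x \<in> carrier Mat" "y \<in> carrier Mat"
      then show "x \<oplus>\<^bsub>Mat\<^esub> y = y \<oplus>\<^bsub>Mat\<^esub> x"
        by (intro matrix_ext) (auto simp: abelian_monoid.a_comm[OF mod(1)])
    next
      fix x y z assume "x \<in> carrier Mat" "y \<in> carrier Mat" "z \<in> carrier Mat"
      then show "x \<oplus>\<^bsub>Mat\<^esub> y \<oplus>\<^bsub>Mat\<^esub> z = x \<oplus>\<^bsub>Mat\<^esub> (y \<oplus>\<^bsub>Mat\<^esub> z)"
        by (intro matrix_ext) (auto simp: abelian_monoid.a_assoc[OF mod(1)])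
    next
      fix x assume "x \<in> carrier Mat"
      then show "\<zero>\<^bsub>Mat\<^esub> \<oplus>\<^bsub>Mat\<^esub> x = x"
        by (intro matrix_ext) (auto simp: abelian_monoid.l_zero[OF mod(1)])
    qed auto
  next
    fix a b x assume "a \<in> carrier K" "b \<in> carrier K" "x \<in> carrier Mat"
    then show "(a \<oplus> b) \<odot>\<^bsub>Mat\<^esub> x = a \<odot>\<^bsub>Mat\<^esub> x \<oplus>\<^bsub>Mat\<^esub> b \<odot>\<^bsub>Mat\<^esub> x"
      by (intro matrix_ext) (auto simp: module.smult_l_distr[OF mod(3)])
  next
    fix a x y assume "a \<in> carrier K" "x \<in> carrier Mat" "y \<in> carrier Mat"
    then show "a \<odot>\<^bsub>Mat\<^esub> (x \<oplus>\<^bsub>Mat\<^esub> y) = a \<odot>\<^bsub>Mat\<^esub> x \<oplus>\<^bsub>Mat\<^esub> a \<odot>\<^bsub>Mat\<^esub> y"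
      by (intro matrix_ext) (auto simp: module.smult_r_distr[OF mod(3)])
  next
    fix a b x assume "a \<in> carrier K" "b \<in> carrier K" "x \<in> carrier Mat"
    then show "(a \<otimes> b) \<odot>\<^bsub>Mat\<^esub> x = a \<odot>\<^bsub>Mat\<^esub> (b \<odot>\<^bsub>Mat\<^esub> x)"
      by (intro matrix_ext) (auto simp: module.smult_assoc1[OF mod(3)])
  next
    fix x assume "x \<in> carrier Mat"
    then show "\<one> \<odot>\<^bsub>Mat\<^esub> x = x"
      by (intro matrix_ext) (auto simp: module.smult_one[OF mod(3)])
  qed (auto simp: is_cring)
qed

lemma matrix_entry_linear:
  "\<lbrakk>i \<in> {1..n}; j \<in> {1..n}\<rbrakk> \<Longrightarrow> linear_map K Mat (M i j) (\<lambda>x. x (i, j))"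
  by (rule linear_mapI) auto

lemma matrix_incl_linear:
  assumes "i \<in> {1..n}" "j \<in> {1..n}"
  shows "linear_map K (M i j) Mat (matrix_incl n M i j)"
proof -
  have mod: "module K (M p q)" if "p \<in> {1..n}" "q \<in> {1..n}" for p q
    using vector_space[OF that] .
  have z: "\<zero>\<^bsub>M p q\<^esub> \<oplus>\<^bsub>M p q\<^esub> \<zero>\<^bsub>M p q\<^esub> = \<zero>\<^bsub>M p q\<^esub>" "c \<in> carrier K \<Longrightarrow> c \<odot>\<^bsub>M p q\<^esub> \<zero>\<^bsub>M p q\<^esub> = \<zero>\<^bsub>M p q\<^esub>"
    if "p \<in> {1..n}" "q \<in> {1..n}" for p q c
  proof -
    interpret module K "M p q" by (rule mod[OF that])
    show "\<zero>\<^bsub>M p q\<^esub> \<oplus>\<^bsub>M p q\<^esub> \<zero>\<^bsub>M p q\<^esub> = \<zero>\<^bsub>M p q\<^esub>" by simp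
    show "c \<odot>\<^bsub>M p q\<^esub> \<zero>\<^bsub>M p q\<^esub> = \<zero>\<^bsub>M p q\<^esub>" if "c \<in> carrier K" using that by simp
  qed
  interpret Mij: module K "M i j" by (rule mod[OF assms])
  show ?thesis
    by (rule linear_mapI; (intro matrix_ext)?) (use assms in \<open>auto simp: z\<close>)
qed

lemma finsum_single:
  assumes W: "module K W" and B: "finite B" "i \<in> B" and w: "f i \<in> carrier W"
    and z: "\<And>k. \<lbrakk>k \<in> B; k \<noteq> i\<rbrakk> \<Longrightarrow> f k = \<zero>\<^bsub>W\<^esub>"
  shows "(\<Oplus>\<^bsub>W\<^esub>k\<in>B. f k) = f i"
proof -
  interpret W: module K W by fact
  have "(\<Oplus>\<^bsub>W\<^esub>k\<in>B. f k) = (\<Oplus>\<^bsub>W\<^esub>k\<in>B. if i = k then f i else \<zero>\<^bsub>W\<^esub>)"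
    using w z by (intro W.finsum_cong') auto
  also have "\<dots> = f i" using B w by (intro W.finsum_singleton[where f = "\<lambda>_. f i"]) auto
  finally show ?thesis .
qed

lemma matrix_mult_incl_right:
  assumes "i \<in> {1..n}" "j \<in> {1..n}" "k \<in> {1..n}" "x \<in> carrier Mat" "y \<in> carrier (M j k)"
  shows "(x \<otimes>\<^bsub>Mat\<^esub> matrix_incl n M j k y) (i, k) = \<theta> i j k (x (i, j)) y"
  using assms
  by (simp, subst finsum_single[where i = j]) (auto intro: vector_space)

lemma matrix_mult_incl_left:
  assumes "i \<in> {1..n}" "j \<in> {1..n}" "k \<in> {1..n}" "x \<in> carrier (M i j)" "y \<in> carrier Mat"
  shows "(matrix_incl n M i j x \<otimes>\<^bsub>Mat\<^esub> y) (i, k) = \<theta> i j k x (y (j, k))"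
  using assms
  by (simp, subst finsum_single[where i = j]) (auto intro: vector_space)

lemma matrix_incl_mult:
  assumes "i \<in> {1..n}" "j \<in> {1..n}" "k \<in> {1..n}" "x \<in> carrier (M i j)" "y \<in> carrier (M j k)"
  shows "matrix_incl n M i j x \<otimes>\<^bsub>Mat\<^esub> matrix_incl n M j k y = matrix_incl n M i k (\<theta> i j k x y)"
proof (rule matrix_ext)
  fix p q assume pq: "p \<in> {1..n}" "q \<in> {1..n}"
  show "(matrix_incl n M i j x \<otimes>\<^bsub>Mat\<^esub> matrix_incl n M j k y) (p, q) = matrix_incl n M i k (\<theta> i j k x y) (p, q)"
    using assms pq
    by (simp only: matrix_entries(1), subst finsum_single[where i = j]) (auto intro: vector_space)
qed (use assms in auto)

text \<open>
  The unit matrix is spread over the diagonal blocks. This decomposition reduces \<open>h \<cdot> 1\<close> to the diagonal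
  units.
\<close>

lemma matrix_one_decomp:
  "\<one>\<^bsub>Mat\<^esub> = (\<Oplus>\<^bsub>Mat\<^esub>l\<in>{1..n}. matrix_incl n M l l (\<eta> l \<one>))"
proof -
  interpret Mat: module K Mat by (rule matrix_module)
  have cl: "(\<lambda>l. matrix_incl n M l l (\<eta> l \<one>)) \<in> {1..n} \<rightarrow> carrier Mat" by auto
  show ?thesis
  proof (rule matrix_ext)
    fix p q assume pq: "p \<in> {1..n}" "q \<in> {1..n}"
    have "(\<Oplus>\<^bsub>Mat\<^esub>l\<in>{1..n}. matrix_incl n M l l (\<eta> l \<one>)) (p, q)
        = (\<Oplus>\<^bsub>M p q\<^esub>l\<in>{1..n}. matrix_incl n M l l (\<eta> l \<one>) (p, q))"
      using pq cl by (intro linear_map_finsum[OF matrix_module _ matrix_entry_linear] vector_space) auto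
    also have "\<dots> = matrix_incl n M p p (\<eta> p \<one>) (p, q)"
      using pq by (intro finsum_single) (auto intro: vector_space)
    finally show "\<one>\<^bsub>Mat\<^esub> (p, q) = (\<Oplus>\<^bsub>Mat\<^esub>l\<in>{1..n}. matrix_incl n M l l (\<eta> l \<one>)) (p, q)"
      using pq by auto
  qed (use cl in \<open>auto intro: Mat.finsum_closed\<close>)
qed

end

section \<open>Blockwise partial actions\<close>

locale hopf_matrix_algebra =
  hopf_algebra K H \<Delta> \<epsilon> S + generalized_matrix_algebra K n M \<theta> \<eta>
  for K :: "'k ring" and H :: "('k, 'h) module" and \<Delta> \<epsilon> S
    and n and M :: "nat \<Rightarrow> nat \<Rightarrow> ('k, 'm) module" and \<theta> \<eta>

text \<open>
  The notion through which the two assertions are compared: the maps that a partial action on the matrix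
  algebra induces on the single blocks, and equally the maps \<open>m \<mapsto> (1 # h) m\<close> of the smash product
  modules. The composition law is the one of symmetric partial actions, with the units
  of the row and of the column in place of the unit of the matrix algebra.
\<close>

locale blockwise_partial_action = hopf_matrix_algebra K H \<Delta> \<epsilon> S n M \<theta> \<eta>
  for K :: "'k ring" and H :: "('k, 'h) module" and \<Delta> \<epsilon> S
    and n and M :: "nat \<Rightarrow> nat \<Rightarrow> ('k, 'm) module" and \<theta> \<eta> +
  fixes D :: "nat \<Rightarrow> nat \<Rightarrow> 'h \<Rightarrow> 'm \<Rightarrow> 'm"
  assumes D_bilinear: "\<lbrakk>i \<in> {1..n}; j \<in> {1..n}\<rbrakk> \<Longrightarrow> bilinear_map K H (M i j) (M i j) (D i j)"
    and D_one: "\<lbrakk>i \<in> {1..n}; j \<in> {1..n}; m \<in> carrier (M i j)\<rbrakk> \<Longrightarrow> D i j \<one>\<^bsub>H\<^esub> m = m"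
    and D_theta: "\<lbrakk>i \<in> {1..n}; j \<in> {1..n}; k \<in> {1..n};
        h \<in> carrier H; x \<in> carrier (M i j); y \<in> carrier (M j k)\<rbrakk> \<Longrightarrow>
      D i k h (\<theta> i j k x y) = sw (M i k) (\<lambda>h\<^sub>1 h\<^sub>2. \<theta> i j k (D i j h\<^sub>1 x) (D j k h\<^sub>2 y)) h"
    and D_D_left: "\<lbrakk>i \<in> {1..n}; j \<in> {1..n}; h \<in> carrier H; g \<in> carrier H; m \<in> carrier (M i j)\<rbrakk> \<Longrightarrow>
      D i j h (D i j g m) = sw (M i j)
        (\<lambda>h\<^sub>1 h\<^sub>2. \<theta> i i j (D i i h\<^sub>1 (\<eta> i \<one>\<^bsub>K\<^esub>)) (D i j (h\<^sub>2 \<star> g) m)) h"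
    and D_D_right: "\<lbrakk>i \<in> {1..n}; j \<in> {1..n}; h \<in> carrier H; g \<in> carrier H; m \<in> carrier (M i j)\<rbrakk> \<Longrightarrow>
      D i j h (D i j g m) = sw (M i j)
        (\<lambda>h\<^sub>1 h\<^sub>2. \<theta> i j j (D i j (h\<^sub>1 \<star> g) m) (D j j h\<^sub>2 (\<eta> j \<one>\<^bsub>K\<^esub>))) h"
begin

lemma D_closed [simp]:
  "\<lbrakk>i \<in> {1..n}; j \<in> {1..n}; h \<in> carrier H; m \<in> carrier (M i j)\<rbrakk> \<Longrightarrow> D i j h m \<in> carrier (M i j)"
  by (rule bilinear_map_closed[OF D_bilinear])

lemma D_zero [simp]:
  "\<lbrakk>i \<in> {1..n}; j \<in> {1..n}; h \<in> carrier H\<rbrakk> \<Longrightarrow> D i j h \<zero>\<^bsub>M i j\<^esub> = \<zero>\<^bsub>M i j\<^esub>"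
  by (rule linear_map_zero[OF vector_space vector_space bilinear_map_right[OF D_bilinear]])

definition matrix_action :: "'h \<Rightarrow> (nat \<times> nat \<Rightarrow> 'm) \<Rightarrow> (nat \<times> nat \<Rightarrow> 'm)"
  where "matrix_action h x = (\<lambda>(i, j)\<in>{1..n} \<times> {1..n}. D i j h (x (i, j)))"

lemma matrix_action_entry [simp]:
  "\<lbrakk>i \<in> {1..n}; j \<in> {1..n}\<rbrakk> \<Longrightarrow> matrix_action h x (i, j) = D i j h (x (i, j))"
  by (simp add: matrix_action_def)

lemma matrix_action_closed [simp]:
  "\<lbrakk>h \<in> carrier H; x \<in> carrier Mat\<rbrakk> \<Longrightarrow> matrix_action h x \<in> carrier Mat"
  by (auto simp: matrix_carrier matrix_action_def)

lemma sweedler_matrix_entry: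
  assumes "h \<in> carrier H" "i \<in> {1..n}" "j \<in> {1..n}"
    and "\<And>a b. \<lbrakk>a \<in> carrier H; b \<in> carrier H\<rbrakk> \<Longrightarrow> f a b \<in> carrier Mat"
  shows "sw Mat f h (i, j) = sw (M i j) (\<lambda>a b. f a b (i, j)) h"
  using assms by (intro linear_map_sweedler[OF matrix_module _ matrix_entry_linear] vector_space)

text \<open>
  Every axiom is an equation of matrices and can be read off entrywise. For the composition
  law, \<open>h \<cdot> 1\<close> is the diagonal matrix with entries \<open>h \<cdot> 1\<^sub>i\<close>, so in its product with a matrix a single term of
  each row-column sum remains.
\<close>

lemma matrix_action_partial_action: "left_partial_action K H \<Delta> Mat matrix_action"
proof -
  have bil: "bilinear_map K H Mat Mat matrix_action"
  proof (intro bilinear_mapI linear_mapI)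
    fix h x y assume *: "h \<in> carrier H" "x \<in> carrier Mat" "y \<in> carrier Mat"
    show "matrix_action h (x \<oplus>\<^bsub>Mat\<^esub> y) = matrix_action h x \<oplus>\<^bsub>Mat\<^esub> matrix_action h y"
      using * by (intro matrix_ext) (auto simp: linear_map_add[OF bilinear_map_right[OF D_bilinear]])
  next
    fix h c x assume *: "h \<in> carrier H" "c \<in> carrier K" "x \<in> carrier Mat"
    show "matrix_action h (c \<odot>\<^bsub>Mat\<^esub> x) = c \<odot>\<^bsub>Mat\<^esub> matrix_action h x"
      using * by (intro matrix_ext) (auto simp: linear_map_smult[OF bilinear_map_right[OF D_bilinear]])
  next
    fix h k x assume *: "x \<in> carrier Mat" "h \<in> carrier H" "k \<in> carrier H"
    then have "h \<oplus>\<^bsub>H\<^esub> k \<in> carrier H"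
      using H_module by (simp add: module_def abelian_group_def abelian_monoid.a_closed)
    with * show "matrix_action (h \<oplus>\<^bsub>H\<^esub> k) x = matrix_action h x \<oplus>\<^bsub>Mat\<^esub> matrix_action k x"
      by (intro matrix_ext) (auto simp: linear_map_add[OF bilinear_map_left[OF D_bilinear]])
  next
    fix h c x assume *: "x \<in> carrier Mat" "c \<in> carrier K" "h \<in> carrier H"
    then have "c \<odot>\<^bsub>H\<^esub> h \<in> carrier H" by (intro module.smult_closed[OF H_module])
    with * show "matrix_action (c \<odot>\<^bsub>H\<^esub> h) x = c \<odot>\<^bsub>Mat\<^esub> matrix_action h x"
      by (intro matrix_ext) (auto simp: linear_map_smult[OF bilinear_map_left[OF D_bilinear]])
  qed auto
  have one: "matrix_action \<one>\<^bsub>H\<^esub> x = x" if "x \<in> carrier Mat" for x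
    using that by (intro matrix_ext) (auto simp: D_one)
  have mult: "matrix_action h (x \<otimes>\<^bsub>Mat\<^esub> y)
      = sw Mat (\<lambda>h\<^sub>1 h\<^sub>2. matrix_action h\<^sub>1 x \<otimes>\<^bsub>Mat\<^esub> matrix_action h\<^sub>2 y) h"
    if h: "h \<in> carrier H" and x: "x \<in> carrier Mat" and y: "y \<in> carrier Mat" for h x y
  proof (rule matrix_ext)
    fix i j assume ij: "i \<in> {1..n}" "j \<in> {1..n}"
    interpret Mij: module K "M i j" by (rule vector_space[OF ij])
    let ?t = "\<lambda>l a b. \<theta> i l j (D i l a (x (i, l))) (D l j b (y (l, j)))"
    have "matrix_action h (x \<otimes>\<^bsub>Mat\<^esub> y) (i, j) = D i j h (\<Oplus>\<^bsub>M i j\<^esub>l\<in>{1..n}. \<theta> i l j (x (i, l)) (y (l, j)))"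
      using ij by simp
    also have "\<dots> = (\<Oplus>\<^bsub>M i j\<^esub>l\<in>{1..n}. D i j h (\<theta> i l j (x (i, l)) (y (l, j))))"
      using ij h x y
      by (intro linear_map_finsum[OF vector_space vector_space bilinear_map_right[OF D_bilinear]]) auto
    also have "\<dots> = (\<Oplus>\<^bsub>M i j\<^esub>l\<in>{1..n}. sw (M i j) (?t l) h)"
      using ij h x y
      by (intro Mij.M.finsum_cong') (auto simp: D_theta intro!: sweedler_closed vector_space)
    also have "\<dots> = sw (M i j) (\<lambda>a b. \<Oplus>\<^bsub>M i j\<^esub>l\<in>{1..n}. ?t l a b) h"
      using ij h x y by (intro sweedler_finsum[symmetric] vector_space) auto
    also have "\<dots> = sw (M i j) (\<lambda>a b. (matrix_action a x \<otimes>\<^bsub>Mat\<^esub> matrix_action b y) (i, j)) h"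
      using ij h x y
      by (intro sweedler_cong vector_space)
        (auto intro!: Mij.M.finsum_cong' Mij.M.finsum_closed 
          simp del: matrix_entries(1) simp: matrix_entries(1)[OF ij])
    also have "\<dots> = sw Mat (\<lambda>a b. matrix_action a x \<otimes>\<^bsub>Mat\<^esub> matrix_action b y) h (i, j)"
      using ij h x y by (intro sweedler_matrix_entry[symmetric]) auto
    finally show "matrix_action h (x \<otimes>\<^bsub>Mat\<^esub> y) (i, j) = \<dots>" .
  qed (use h x y in \<open>auto intro!: sweedler_closed matrix_module\<close>)
  have left: "matrix_action h (matrix_action k x)
      = sw Mat (\<lambda>h\<^sub>1 h\<^sub>2. matrix_action h\<^sub>1 \<one>\<^bsub>Mat\<^esub> \<otimes>\<^bsub>Mat\<^esub> matrix_action (h\<^sub>2 \<star> k) x) h"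
    and right: "matrix_action h (matrix_action k x)
      = sw Mat (\<lambda>h\<^sub>1 h\<^sub>2. matrix_action (h\<^sub>1 \<star> k) x \<otimes>\<^bsub>Mat\<^esub> matrix_action h\<^sub>2 \<one>\<^bsub>Mat\<^esub>) h"
    if h: "h \<in> carrier H" and k: "k \<in> carrier H" and x: "x \<in> carrier Mat" for h k x
  proof -
    have "(matrix_action a \<one>\<^bsub>Mat\<^esub> \<otimes>\<^bsub>Mat\<^esub> matrix_action (b \<star> k) x) (i, j)
        = \<theta> i i j (D i i a (\<eta> i \<one>\<^bsub>K\<^esub>)) (D i j (b \<star> k) (x (i, j)))"
      and "(matrix_action (a \<star> k) x \<otimes>\<^bsub>Mat\<^esub> matrix_action b \<one>\<^bsub>Mat\<^esub>) (i, j)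
        = \<theta> i j j (D i j (a \<star> k) (x (i, j))) (D j j b (\<eta> j \<one>\<^bsub>K\<^esub>))"
      if "a \<in> carrier H" "b \<in> carrier H" "i \<in> {1..n}" "j \<in> {1..n}" for a b i j
      using that k x
      by (simp_all only: matrix_entries(1))
        (subst finsum_single[where i = i] finsum_single[where i = j]; auto intro: vector_space)+
    note entries = this
    show "matrix_action h (matrix_action k x)
      = sw Mat (\<lambda>h\<^sub>1 h\<^sub>2. matrix_action h\<^sub>1 \<one>\<^bsub>Mat\<^esub> \<otimes>\<^bsub>Mat\<^esub> matrix_action (h\<^sub>2 \<star> k) x) h"
    proof (rule matrix_ext)
      fix i j assume ij: "i \<in> {1..n}" "j \<in> {1..n}"
      have "sw Mat (\<lambda>h\<^sub>1 h\<^sub>2. matrix_action h\<^sub>1 \<one>\<^bsub>Mat\<^esub> \<otimes>\<^bsub>Mat\<^esub> matrix_action (h\<^sub>2 \<star> k) x) h (i, j)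
        = sw (M i j) (\<lambda>a b. (matrix_action a \<one>\<^bsub>Mat\<^esub> \<otimes>\<^bsub>Mat\<^esub> matrix_action (b \<star> k) x) (i, j)) h"
        using ij h k x by (intro sweedler_matrix_entry) auto
      also have "\<dots> = sw (M i j) (\<lambda>a b. \<theta> i i j (D i i a (\<eta> i \<one>\<^bsub>K\<^esub>)) (D i j (b \<star> k) (x (i, j)))) h"
        using ij h k x by (intro sweedler_cong vector_space entries) auto
      finally show "matrix_action h (matrix_action k x) (i, j) = sw Mat
          (\<lambda>h\<^sub>1 h\<^sub>2. matrix_action h\<^sub>1 \<one>\<^bsub>Mat\<^esub> \<otimes>\<^bsub>Mat\<^esub> matrix_action (h\<^sub>2 \<star> k) x) h (i, j)"
        using ij h k x by (simp add: D_D_left)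
    qed (use h k x in \<open>auto intro!: sweedler_closed matrix_module\<close>)
    show "matrix_action h (matrix_action k x)
      = sw Mat (\<lambda>h\<^sub>1 h\<^sub>2. matrix_action (h\<^sub>1 \<star> k) x \<otimes>\<^bsub>Mat\<^esub> matrix_action h\<^sub>2 \<one>\<^bsub>Mat\<^esub>) h"
    proof (rule matrix_ext)
      fix i j assume ij: "i \<in> {1..n}" "j \<in> {1..n}"
      have "sw Mat (\<lambda>h\<^sub>1 h\<^sub>2. matrix_action (h\<^sub>1 \<star> k) x \<otimes>\<^bsub>Mat\<^esub> matrix_action h\<^sub>2 \<one>\<^bsub>Mat\<^esub>) h (i, j)
        = sw (M i j) (\<lambda>a b. (matrix_action (a \<star> k) x \<otimes>\<^bsub>Mat\<^esub> matrix_action b \<one>\<^bsub>Mat\<^esub>) (i, j)) h"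
        using ij h k x by (intro sweedler_matrix_entry) auto
      also have "\<dots> = sw (M i j) (\<lambda>a b. \<theta> i j j (D i j (a \<star> k) (x (i, j))) (D j j b (\<eta> j \<one>\<^bsub>K\<^esub>))) h"
        using ij h k x by (intro sweedler_cong vector_space entries) auto
      finally show "matrix_action h (matrix_action k x) (i, j) = sw Mat
          (\<lambda>h\<^sub>1 h\<^sub>2. matrix_action (h\<^sub>1 \<star> k) x \<otimes>\<^bsub>Mat\<^esub> matrix_action h\<^sub>2 \<one>\<^bsub>Mat\<^esub>) h (i, j)"
        using ij h k x by (simp add: D_D_right)
    qed (use h k x in \<open>auto intro!: sweedler_closed matrix_module\<close>)
  qed
  show ?thesis
    unfolding left_partial_action_def using bil one mult left right by blast
qed

lemma matrix_action_invariant: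
  assumes ij: "i \<in> {1..n}" "j \<in> {1..n}"
  shows "invariant_under H matrix_action (block n M i j)"
proof -
  have "matrix_action h (matrix_incl n M i j m) = matrix_incl n M i j (D i j h m)"
    if "h \<in> carrier H" "m \<in> carrier (M i j)" for h m
    using that ij by (intro matrix_ext) auto
  then show ?thesis using ij by (auto simp: invariant_under_def block_def)
qed

end

context hopf_matrix_algebra
begin

text \<open>
  Invariance means that \<open>h\<close> commutes with the inclusions of the blocks. Therefore the axioms restrict to
  matrices with a single entry. Of the matrix \<open>h \<cdot> 1\<close> that occurs in the composition law only the diagonal
  entry in row \<open>i\<close> (or column \<open>j\<close>) matters, and it is \<open>h \<cdot> 1\<^sub>i\<close> since \<open>1\<close> is the sum of the diagonal
  units.
\<close>

lemma invariant_action_blockwise: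
  assumes act: "left_partial_action K H \<Delta> Mat act"
    and inv: "\<And>i j. \<lbrakk>i \<in> {1..n}; j \<in> {1..n}\<rbrakk> \<Longrightarrow> invariant_under H act (block n M i j)"
  shows "blockwise_partial_action K H \<Delta> \<epsilon> S n M \<theta> \<eta> (\<lambda>i j h m. act h (matrix_incl n M i j m) (i, j))"
proof -
  let ?inc = "matrix_incl n M"
  define D where "D = (\<lambda>i j h m. act h (?inc i j m) (i, j))"
  have bil: "bilinear_map K H Mat Mat act"
    and one: "\<And>x. x \<in> carrier Mat \<Longrightarrow> act \<one>\<^bsub>H\<^esub> x = x"
    and mult: "\<And>h x y. \<lbrakk>h \<in> carrier H; x \<in> carrier Mat; y \<in> carrier Mat\<rbrakk> \<Longrightarrow>
      act h (x \<otimes>\<^bsub>Mat\<^esub> y) = sw Mat (\<lambda>h\<^sub>1 h\<^sub>2. act h\<^sub>1 x \<otimes>\<^bsub>Mat\<^esub> act h\<^sub>2 y) h"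
    and left: "\<And>h k x. \<lbrakk>h \<in> carrier H; k \<in> carrier H; x \<in> carrier Mat\<rbrakk> \<Longrightarrow>
      act h (act k x) = sw Mat (\<lambda>h\<^sub>1 h\<^sub>2. act h\<^sub>1 \<one>\<^bsub>Mat\<^esub> \<otimes>\<^bsub>Mat\<^esub> act (h\<^sub>2 \<star> k) x) h"
    and right: "\<And>h k x. \<lbrakk>h \<in> carrier H; k \<in> carrier H; x \<in> carrier Mat\<rbrakk> \<Longrightarrow>
      act h (act k x) = sw Mat (\<lambda>h\<^sub>1 h\<^sub>2. act (h\<^sub>1 \<star> k) x \<otimes>\<^bsub>Mat\<^esub> act h\<^sub>2 \<one>\<^bsub>Mat\<^esub>) h"
    using act unfolding left_partial_action_def by blast+
  note act_closed [simp] = bilinear_map_closed[OF bil]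
  have incl: "act h (?inc i j m) = ?inc i j (D i j h m)"
    if ij: "i \<in> {1..n}" "j \<in> {1..n}" and h: "h \<in> carrier H" and m: "m \<in> carrier (M i j)" for i j h m
  proof -
    have "act h (?inc i j m) \<in> block n M i j"
      using inv[OF ij] h m by (auto simp: invariant_under_def block_def)
    then obtain m' where "act h (?inc i j m) = ?inc i j m'" by (auto simp: block_def)
    then show ?thesis using ij by (simp add: D_def)
  qed
  have D_closed [simp]: "D i j h m \<in> carrier (M i j)"
    if "i \<in> {1..n}" "j \<in> {1..n}" "h \<in> carrier H" "m \<in> carrier (M i j)" for i j h m
    using that by (simp add: D_def)
  have D_bil: "bilinear_map K H (M i j) (M i j) (D i j)" if "i \<in> {1..n}" "j \<in> {1..n}" for i j
    unfolding D_def using that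
    by (intro bilinear_mapI linear_map_compose[OF matrix_entry_linear]
        bilinear_map_compose_right[OF bil] bilinear_map_left[OF bil] matrix_incl_linear) auto
  have act_one: "act h \<one>\<^bsub>Mat\<^esub> (i, i) = D i i h (\<eta> i \<one>\<^bsub>K\<^esub>)"
    if i: "i \<in> {1..n}" and h: "h \<in> carrier H" for i h
  proof -
    have "linear_map K Mat (M i i) (\<lambda>x. act h x (i, i))"
      using i h by (intro linear_map_compose[OF matrix_entry_linear] bilinear_map_right[OF bil])
    note this = linear_map_finsum[OF matrix_module vector_space[OF i i] this,
        of "{1..n}" "\<lambda>l. ?inc l l (\<eta> l \<one>\<^bsub>K\<^esub>)"]
    then have "act h \<one>\<^bsub>Mat\<^esub> (i, i) = (\<Oplus>\<^bsub>M i i\<^esub>l\<in>{1..n}. act h (?inc l l (\<eta> l \<one>\<^bsub>K\<^esub>)) (i, i))"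
      unfolding matrix_one_decomp by auto
    also have "\<dots> = act h (?inc i i (\<eta> i \<one>\<^bsub>K\<^esub>)) (i, i)"
      using i h by (intro finsum_single vector_space) (auto simp: incl)
    finally show ?thesis by (simp add: D_def)
  qed
  have entry: "sw Mat f h (i, j) = sw (M i j) (\<lambda>a b. f a b (i, j)) h"
    if "h \<in> carrier H" "i \<in> {1..n}" "j \<in> {1..n}"
      "\<And>a b. \<lbrakk>a \<in> carrier H; b \<in> carrier H\<rbrakk> \<Longrightarrow> f a b \<in> carrier Mat" for f h i j
    using that by (intro linear_map_sweedler[OF matrix_module _ matrix_entry_linear] vector_space)
  have "blockwise_partial_action K H \<Delta> \<epsilon> S n M \<theta> \<eta> D"
  proof (intro blockwise_partial_action.intro blockwise_partial_action_axioms.intro)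
    show "hopf_matrix_algebra K H \<Delta> \<epsilon> S n M \<theta> \<eta>" by (rule hopf_matrix_algebra_axioms)
    show "D i j \<one>\<^bsub>H\<^esub> m = m" if "i \<in> {1..n}" "j \<in> {1..n}" "m \<in> carrier (M i j)" for i j m
      using that by (simp add: D_def one)
    show "D i k h (\<theta> i j k x y) = sw (M i k) (\<lambda>h\<^sub>1 h\<^sub>2. \<theta> i j k (D i j h\<^sub>1 x) (D j k h\<^sub>2 y)) h"
      if ijk: "i \<in> {1..n}" "j \<in> {1..n}" "k \<in> {1..n}" and h: "h \<in> carrier H"
        and x: "x \<in> carrier (M i j)" and y: "y \<in> carrier (M j k)" for i j k h x y
    proof -
      have "D i k h (\<theta> i j k x y) = act h (?inc i j x \<otimes>\<^bsub>Mat\<^esub> ?inc j k y) (i, k)"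
        using ijk x y by (simp only: D_def matrix_incl_mult)
      also have "\<dots> = sw Mat (\<lambda>a b. act a (?inc i j x) \<otimes>\<^bsub>Mat\<^esub> act b (?inc j k y)) h (i, k)"
        using ijk h x y by (subst mult) auto
      also have "\<dots> = sw (M i k) (\<lambda>a b. (act a (?inc i j x) \<otimes>\<^bsub>Mat\<^esub> act b (?inc j k y)) (i, k)) h"
        using ijk h x y by (intro entry) auto
      also have "\<dots> = sw (M i k) (\<lambda>h\<^sub>1 h\<^sub>2. \<theta> i j k (D i j h\<^sub>1 x) (D j k h\<^sub>2 y)) h"
      proof (rule sweedler_cong[OF _ h])
        fix a b assume ab: "a \<in> carrier H" "b \<in> carrier H"
        have "act a (?inc i j x) \<otimes>\<^bsub>Mat\<^esub> act b (?inc j k y) = ?inc i k (\<theta> i j k (D i j a x) (D j k b y))"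
          using ijk ab x y by (simp only: incl matrix_incl_mult D_closed)
        then show "(act a (?inc i j x) \<otimes>\<^bsub>Mat\<^esub> act b (?inc j k y)) (i, k) = \<theta> i j k (D i j a x) (D j k b y)"
          using ijk by (simp only: matrix_entries(6) simp_thms if_True)
      qed (use ijk x y in \<open>auto intro: vector_space\<close>)
      finally show ?thesis .
    qed
    fix i j h k m assume ij: "i \<in> {1..n}" "j \<in> {1..n}" and h: "h \<in> carrier H" and k: "k \<in> carrier H"
      and m: "m \<in> carrier (M i j)"
    have X: "?inc i j m \<in> carrier Mat" using ij m by simp
    have DD: "D i j h (D i j k m) = act h (act k (?inc i j m)) (i, j)"
      using ij k m by (simp only: incl) (simp add: D_def)
    have "\<dots> = sw (M i j) (\<lambda>a b. (act a \<one>\<^bsub>Mat\<^esub> \<otimes>\<^bsub>Mat\<^esub> act (b \<star> k) (?inc i j m)) (i, j)) h"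
      unfolding left[OF h k X] using ij h k X by (intro entry) auto
    also have "\<dots> = sw (M i j)
        (\<lambda>h\<^sub>1 h\<^sub>2. \<theta> i i j (D i i h\<^sub>1 (\<eta> i \<one>\<^bsub>K\<^esub>)) (D i j (h\<^sub>2 \<star> k) m)) h"
      using ij k m
      by (intro sweedler_cong[OF _ h]) (auto simp: incl matrix_mult_incl_right act_one intro: vector_space
          simp del: matrix_entries(1))
    finally show "D i j h (D i j k m) = sw (M i j)
        (\<lambda>h\<^sub>1 h\<^sub>2. \<theta> i i j (D i i h\<^sub>1 (\<eta> i \<one>\<^bsub>K\<^esub>)) (D i j (h\<^sub>2 \<star> k) m)) h"
      using DD by simp
    have "act h (act k (?inc i j m)) (i, j)
        = sw (M i j) (\<lambda>a b. (act (a \<star> k) (?inc i j m) \<otimes>\<^bsub>Mat\<^esub> act b \<one>\<^bsub>Mat\<^esub>) (i, j)) h"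
      unfolding right[OF h k X] using ij h k X by (intro entry) auto
    also have "\<dots> = sw (M i j)
        (\<lambda>h\<^sub>1 h\<^sub>2. \<theta> i j j (D i j (h\<^sub>1 \<star> k) m) (D j j h\<^sub>2 (\<eta> j \<one>\<^bsub>K\<^esub>))) h"
      using ij k m
      by (intro sweedler_cong[OF _ h]) (auto simp: incl matrix_mult_incl_left act_one intro: vector_space
          simp del: matrix_entries(1))
    finally show "D i j h (D i j k m) = sw (M i j)
        (\<lambda>h\<^sub>1 h\<^sub>2. \<theta> i j j (D i j (h\<^sub>1 \<star> k) m) (D j j h\<^sub>2 (\<eta> j \<one>\<^bsub>K\<^esub>))) h"
      using DD by simp
  qed (rule D_bil)
  then show ?thesis unfolding D_def .
qed

end

section \<open>Blocks as modules over smash products\<close>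

context blockwise_partial_action
begin

lemma diag_partial_action:
  assumes i: "i \<in> {1..n}"
  shows "left_partial_action K H \<Delta> (diag_algebra K M \<theta> \<eta> i) (D i i)"
  unfolding left_partial_action_def
  by (intro conjI ballI) (use i D_theta D_D_left D_D_right in \<open>simp_all add: D_bilinear D_one\<close>)

lemma diag_acted_algebra:
  "i \<in> {1..n} \<Longrightarrow> acted_algebra K H \<Delta> \<epsilon> S (diag_algebra K M \<theta> \<eta> i) (D i i)"
  by (intro acted_algebra.intro acted_algebra_axioms.intro hopf_algebra_axioms
      diag_algebra_algebra diag_partial_action)

lemma block_left_partial_module:
  assumes ij: "i \<in> {1..n}" "j \<in> {1..n}"
  shows "left_partial_module K H \<Delta> \<epsilon> S (diag_algebra K M \<theta> \<eta> i) (D i i) (M i j) (\<theta> i i j) (D i j)"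
  by (intro left_partial_module.intro left_partial_module_axioms.intro diag_acted_algebra)
    (use ij D_theta D_D_left in \<open>simp_all add: vector_space theta_bilinear theta_assoc D_bilinear D_one\<close>)

lemma block_right_partial_module:
  assumes ij: "i \<in> {1..n}" "j \<in> {1..n}"
  shows "right_partial_module K H \<Delta> \<epsilon> S (diag_algebra K M \<theta> \<eta> j) (D j j) (M i j) (\<theta> i j j) (D i j)"
  by (intro right_partial_module.intro right_partial_module_axioms.intro diag_acted_algebra)
    (use ij D_theta D_D_right in \<open>simp_all add: vector_space theta_bilinear theta_assoc D_bilinear D_one\<close>)

definition left_block_act :: "nat \<Rightarrow> nat \<Rightarrow> ('m \<times> 'h \<Rightarrow> 'k) set \<Rightarrow> 'm \<Rightarrow> 'm"
  where "left_block_act i j t m =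
    tensor_lift K (diag_algebra K M \<theta> \<eta> i) H (M i j) (\<lambda>a h. \<theta> i i j a (D i j h m)) t"

definition right_block_act :: "nat \<Rightarrow> nat \<Rightarrow> 'm \<Rightarrow> ('h \<times> 'm \<Rightarrow> 'k) set \<Rightarrow> 'm"
  where "right_block_act i j m t =
    tensor_lift K H (diag_algebra K M \<theta> \<eta> j) (M i j) (\<lambda>h a. \<theta> i j j (D i j h m) a) t"

lemma left_block_act:
  assumes ij: "i \<in> {1..n}" "j \<in> {1..n}"
  shows "left_module_over K (left_smash K H \<Delta> (diag_algebra K M \<theta> \<eta> i) (D i i)) (M i j) (left_block_act i j)"
    and "\<lbrakk>r \<in> carrier (M i i); h \<in> carrier H; m \<in> carrier (M i j)\<rbrakk> \<Longrightarrow>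
      left_block_act i j (left_hash K H \<Delta> (diag_algebra K M \<theta> \<eta> i) (D i i) r h) m = \<theta> i i j r (D i j h m)"
proof -
  interpret L: left_partial_module K H \<Delta> \<epsilon> S "diag_algebra K M \<theta> \<eta> i" "D i i" "M i j" "\<theta> i i j" "D i j"
    by (rule block_left_partial_module[OF ij])
  have eq: "left_block_act i j = L.smash_act"
    by (simp add: fun_eq_iff left_block_act_def L.smash_act_def)
  show "left_module_over K (left_smash K H \<Delta> (diag_algebra K M \<theta> \<eta> i) (D i i)) (M i j) (left_block_act i j)"
    unfolding eq by (rule L.smash_act_module)
  show "left_block_act i j (left_hash K H \<Delta> (diag_algebra K M \<theta> \<eta> i) (D i i) r h) m = \<theta> i i j r (D i j h m)"
    if "r \<in> carrier (M i i)" "h \<in> carrier H" "m \<in> carrier (M i j)"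
    unfolding eq using that by (intro L.smash_act_hash) simp_all
qed

lemma right_block_act:
  assumes ij: "i \<in> {1..n}" "j \<in> {1..n}"
  shows "right_module_over K (right_smash K (op_algebra H) \<Delta> (diag_algebra K M \<theta> \<eta> j) (\<lambda>r h. D j j h r))
      (M i j) (right_block_act i j)"
    and "\<lbrakk>h \<in> carrier H; r \<in> carrier (M j j); m \<in> carrier (M i j)\<rbrakk> \<Longrightarrow>
      right_block_act i j m
        (right_hash K (op_algebra H) \<Delta> (diag_algebra K M \<theta> \<eta> j) (\<lambda>r h. D j j h r) h r) = \<theta> i j j (D i j h m) r"
proof -
  interpret L: right_partial_module K H \<Delta> \<epsilon> S "diag_algebra K M \<theta> \<eta> j" "D j j" "M i j" "\<theta> i j j" "D i j"
    by (rule block_right_partial_module[OF ij])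
  have eq: "right_block_act i j = L.smash_act"
    by (simp add: fun_eq_iff right_block_act_def L.smash_act_def)
  show "right_module_over K (right_smash K (op_algebra H) \<Delta> (diag_algebra K M \<theta> \<eta> j) (\<lambda>r h. D j j h r))
      (M i j) (right_block_act i j)"
    unfolding eq by (rule L.smash_act_module)
  show "right_block_act i j m
        (right_hash K (op_algebra H) \<Delta> (diag_algebra K M \<theta> \<eta> j) (\<lambda>r h. D j j h r) h r) = \<theta> i j j (D i j h m) r"
    if "h \<in> carrier H" "r \<in> carrier (M j j)" "m \<in> carrier (M i j)"
    unfolding eq using that by (intro L.smash_act_hash) simp_all
qed

end

context hopf_matrix_algebra
begin

text \<open>
  The condition \<open>(1 # h) m = m (h # 1)\<close> makes one and the same family of maps come from the left and from the
  right module structures. The left ones yield the first form of the composition law, the right ones the second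
  form, and the remaining conditions identify the factors that occur there with \<open>h \<cdot> 1\<^sub>i\<close> and \<open>h \<cdot> 1\<^sub>j\<close>.
\<close>

lemma smash_modules_blockwise:
  fixes pact :: "nat \<Rightarrow> 'h \<Rightarrow> 'm \<Rightarrow> 'm"
    and lact :: "nat \<Rightarrow> nat \<Rightarrow> ('m \<times> 'h \<Rightarrow> 'k) set \<Rightarrow> 'm \<Rightarrow> 'm"
    and ract :: "nat \<Rightarrow> nat \<Rightarrow> 'm \<Rightarrow> ('h \<times> 'm \<Rightarrow> 'k) set \<Rightarrow> 'm"
  defines "R \<equiv> diag_algebra K M \<theta> \<eta>"
  defines "lhash \<equiv> \<lambda>i. left_hash K H \<Delta> (R i) (pact i)"
    and "rhash \<equiv> \<lambda>j. right_hash K (op_algebra H) \<Delta> (R j) (\<lambda>r h. pact j h r)"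
  assumes pact: "\<And>i. i \<in> {1..n} \<Longrightarrow> left_partial_action K H \<Delta> (R i) (pact i)"
    and lact: "\<And>i j. \<lbrakk>i \<in> {1..n}; j \<in> {1..n}\<rbrakk> \<Longrightarrow>
      left_module_over K (left_smash K H \<Delta> (R i) (pact i)) (M i j) (lact i j)"
    and ract: "\<And>i j. \<lbrakk>i \<in> {1..n}; j \<in> {1..n}\<rbrakk> \<Longrightarrow>
      right_module_over K (right_smash K (op_algebra H) \<Delta> (R j) (\<lambda>r h. pact j h r)) (M i j) (ract i j)"
    and lact_ract: "\<And>i j h m. \<lbrakk>i \<in> {1..n}; j \<in> {1..n}; h \<in> carrier H; m \<in> carrier (M i j)\<rbrakk> \<Longrightarrow>
      lact i j (lhash i \<one>\<^bsub>R i\<^esub> h) m = ract i j m (rhash j h \<one>\<^bsub>R j\<^esub>)"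
    and lact_pact: "\<And>i h r. \<lbrakk>i \<in> {1..n}; h \<in> carrier H; r \<in> carrier (R i)\<rbrakk> \<Longrightarrow>
      lact i i (lhash i \<one>\<^bsub>R i\<^esub> h) r = pact i h r"
    and lact_theta: "\<And>i j r m. \<lbrakk>i \<in> {1..n}; j \<in> {1..n}; r \<in> carrier (R i); m \<in> carrier (M i j)\<rbrakk> \<Longrightarrow>
      lact i j (lhash i r \<one>\<^bsub>H\<^esub>) m = \<theta> i i j r m"
    and ract_theta: "\<And>i j r m. \<lbrakk>i \<in> {1..n}; j \<in> {1..n}; r \<in> carrier (R j); m \<in> carrier (M i j)\<rbrakk> \<Longrightarrow>
      ract i j m (rhash j \<one>\<^bsub>H\<^esub> r) = \<theta> i j j m r"
    and mult: "\<And>i j k h m x. \<lbrakk>i \<in> {1..n}; j \<in> {1..n}; k \<in> {1..n};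
        h \<in> carrier H; m \<in> carrier (M i j); x \<in> carrier (M j k)\<rbrakk> \<Longrightarrow>
      lact i k (lhash i \<one>\<^bsub>R i\<^esub> h) (\<theta> i j k m x) = sw (M i k)
        (\<lambda>h\<^sub>1 h\<^sub>2. \<theta> i j k (lact i j (lhash i \<one>\<^bsub>R i\<^esub> h\<^sub>1) m) (lact j k (lhash j \<one>\<^bsub>R j\<^esub> h\<^sub>2) x)) h"
  shows "blockwise_partial_action K H \<Delta> \<epsilon> S n M \<theta> \<eta> (\<lambda>i j h. lact i j (lhash i \<one>\<^bsub>R i\<^esub> h))"
proof -
  define D where "D = (\<lambda>i j h. lact i j (lhash i \<one>\<^bsub>R i\<^esub> h))"
  have acted: "acted_algebra K H \<Delta> \<epsilon> S (R i) (pact i)" if "i \<in> {1..n}" for i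
    using that pact unfolding R_def
    by (intro acted_algebra.intro acted_algebra_axioms.intro hopf_algebra_axioms diag_algebra_algebra) auto
  note left = acted_algebra.left_smash_module_partial[OF acted vector_space lact, folded lhash_def D_def]
  have D_pact: "D i i h r = pact i h r" if "i \<in> {1..n}" "h \<in> carrier H" "r \<in> carrier (M i i)" for i h r
    unfolding D_def using that lact_pact by (simp add: R_def)
  have one: "\<eta> i \<one>\<^bsub>K\<^esub> = \<one>\<^bsub>R i\<^esub>" for i by (simp add: R_def)
  have D_bil: "bilinear_map K H (M i j) (M i j) (D i j)" if "i \<in> {1..n}" "j \<in> {1..n}" for i j
    using left(1) that by (simp add: D_def lhash_def)
  note [simp] = bilinear_map_closed[OF D_bil]
  have "blockwise_partial_action K H \<Delta> \<epsilon> S n M \<theta> \<eta> D"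
  proof (intro blockwise_partial_action.intro blockwise_partial_action_axioms.intro)
    show "hopf_matrix_algebra K H \<Delta> \<epsilon> S n M \<theta> \<eta>" by (rule hopf_matrix_algebra_axioms)
    show "D i j \<one>\<^bsub>H\<^esub> m = m" if "i \<in> {1..n}" "j \<in> {1..n}" "m \<in> carrier (M i j)" for i j m
      using left(2) that by (simp add: D_def lhash_def)
    show "D i k h (\<theta> i j k x y) = sw (M i k) (\<lambda>h\<^sub>1 h\<^sub>2. \<theta> i j k (D i j h\<^sub>1 x) (D j k h\<^sub>2 y)) h"
      if "i \<in> {1..n}" "j \<in> {1..n}" "k \<in> {1..n}" "h \<in> carrier H" "x \<in> carrier (M i j)" "y \<in> carrier (M j k)"
      for i j k h x y
      unfolding D_def using that by (rule mult)
    fix i j h g m assume ij: "i \<in> {1..n}" "j \<in> {1..n}" and h: "h \<in> carrier H" and g: "g \<in> carrier H"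
      and m: "m \<in> carrier (M i j)"
    have R_one: "\<one>\<^bsub>R i\<^esub> \<in> carrier (M i i)" "\<one>\<^bsub>R j\<^esub> \<in> carrier (M j j)" using ij by (simp_all add: R_def)
    have "D i j h (D i j g m) = sw (M i j)
        (\<lambda>h\<^sub>1 h\<^sub>2. lact i j (lhash i (pact i h\<^sub>1 \<one>\<^bsub>R i\<^esub>) \<one>\<^bsub>H\<^esub>) (D i j (h\<^sub>2 \<star> g) m)) h"
      using acted_algebra.left_smash_module_partial(3)[OF acted vector_space lact] ij h g m
      by (simp add: D_def lhash_def)
    also have "\<dots> = sw (M i j)
        (\<lambda>h\<^sub>1 h\<^sub>2. \<theta> i i j (D i i h\<^sub>1 \<one>\<^bsub>R i\<^esub>) (D i j (h\<^sub>2 \<star> g) m)) h"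
    proof (rule sweedler_cong[OF vector_space[OF ij] h])
      fix a b assume ab: "a \<in> carrier H" "b \<in> carrier H"
      show "\<theta> i i j (D i i a \<one>\<^bsub>R i\<^esub>) (D i j (b \<star> g) m) \<in> carrier (M i j)"
        using ij ab g m R_one by simp
      have "pact i a \<one>\<^bsub>R i\<^esub> = D i i a \<one>\<^bsub>R i\<^esub>" using D_pact ij ab R_one by simp
      moreover have "D i i a \<one>\<^bsub>R i\<^esub> \<in> carrier (R i)" using ij ab R_one by (simp add: R_def)
      ultimately show "lact i j (lhash i (pact i a \<one>\<^bsub>R i\<^esub>) \<one>\<^bsub>H\<^esub>) (D i j (b \<star> g) m)
          = \<theta> i i j (D i i a \<one>\<^bsub>R i\<^esub>) (D i j (b \<star> g) m)"
        using ij ab g m by (simp only: lact_theta bilinear_map_closed[OF D_bil] H_mult_closed)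
    qed
    finally show "D i j h (D i j g m) = sw (M i j)
        (\<lambda>h\<^sub>1 h\<^sub>2. \<theta> i i j (D i i h\<^sub>1 (\<eta> i \<one>\<^bsub>K\<^esub>)) (D i j (h\<^sub>2 \<star> g) m)) h"
      unfolding one .
    have D_ract: "D i j h m = ract i j m (rhash j h \<one>\<^bsub>R j\<^esub>)" if "h \<in> carrier H" "m \<in> carrier (M i j)" for h m
      unfolding D_def using that ij by (intro lact_ract)
    have "D i j h (D i j g m) = ract i j (ract i j m (rhash j g \<one>\<^bsub>R j\<^esub>)) (rhash j h \<one>\<^bsub>R j\<^esub>)"
      using ij h g m by (simp add: D_ract[symmetric])
    also have "\<dots> = sw (M i j)
        (\<lambda>h\<^sub>1 h\<^sub>2. ract i j (ract i j m (rhash j (h\<^sub>1 \<star> g) \<one>\<^bsub>R j\<^esub>)) (rhash j \<one>\<^bsub>H\<^esub> (pact j h\<^sub>2 \<one>\<^bsub>R j\<^esub>))) h"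
      unfolding rhash_def
      by (rule acted_algebra.right_smash_module_partial[OF acted[OF ij(2)] vector_space[OF ij] ract[OF ij] h g m])
    also have "\<dots> = sw (M i j)
        (\<lambda>h\<^sub>1 h\<^sub>2. \<theta> i j j (D i j (h\<^sub>1 \<star> g) m) (D j j h\<^sub>2 \<one>\<^bsub>R j\<^esub>)) h"
    proof (rule sweedler_cong[OF vector_space[OF ij] h])
      fix a b assume ab: "a \<in> carrier H" "b \<in> carrier H"
      show "\<theta> i j j (D i j (a \<star> g) m) (D j j b \<one>\<^bsub>R j\<^esub>) \<in> carrier (M i j)"
        using ij ab g m R_one by simp
      have "pact j b \<one>\<^bsub>R j\<^esub> = D j j b \<one>\<^bsub>R j\<^esub>" using D_pact ij ab R_one by simp
      moreover have "D j j b \<one>\<^bsub>R j\<^esub> \<in> carrier (R j)" using ij ab R_one by (simp add: R_def)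
      moreover have "ract i j m (rhash j (a \<star> g) \<one>\<^bsub>R j\<^esub>) = D i j (a \<star> g) m"
        using ab g m by (simp add: D_ract)
      ultimately show "ract i j (ract i j m (rhash j (a \<star> g) \<one>\<^bsub>R j\<^esub>)) (rhash j \<one>\<^bsub>H\<^esub> (pact j b \<one>\<^bsub>R j\<^esub>))
          = \<theta> i j j (D i j (a \<star> g) m) (D j j b \<one>\<^bsub>R j\<^esub>)"
        using ij ab g m by (simp only: ract_theta bilinear_map_closed[OF D_bil] H_mult_closed)
    qed
    finally show "D i j h (D i j g m) = sw (M i j)
        (\<lambda>h\<^sub>1 h\<^sub>2. \<theta> i j j (D i j (h\<^sub>1 \<star> g) m) (D j j h\<^sub>2 (\<eta> j \<one>\<^bsub>K\<^esub>))) h"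
      unfolding one .
  qed (rule D_bil)
  then show ?thesis unfolding D_def .
qed

end

section \<open>The equivalence\<close>

theorem theorem3p3:
  fixes K :: "'k ring" and H :: "('k, 'h) module"
    and \<Delta> :: "'h \<Rightarrow> ('h \<times> 'h \<Rightarrow> 'k) set" and \<epsilon> :: "'h \<Rightarrow> 'k" and S :: "'h \<Rightarrow> 'h"
    and n :: nat and M :: "nat \<Rightarrow> nat \<Rightarrow> ('k, 'm) module"
    and \<theta> :: "nat \<Rightarrow> nat \<Rightarrow> nat \<Rightarrow> 'm \<Rightarrow> 'm \<Rightarrow> 'm" and \<eta> :: "nat \<Rightarrow> 'k \<Rightarrow> 'm"
  assumes hopf: "hopf_algebra K H \<Delta> \<epsilon> S"
    and bijective_antipode: "bij_betw S (carrier H) (carrier H)"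
    and n_pos: "n > 0"
    and gma: "generalized_matrix_algebra K n M \<theta> \<eta>"
  defines "R \<equiv> diag_algebra K M \<theta> \<eta>"
  shows
    "(\<exists>act. left_partial_action K H \<Delta> (matrix_algebra K n M \<theta> \<eta>) act \<and>
        (\<forall>i\<in>{1..n}. \<forall>j\<in>{1..n}. invariant_under H act (block n M i j)))
     \<longleftrightarrow>
     (\<exists>(pact :: nat \<Rightarrow> 'h \<Rightarrow> 'm \<Rightarrow> 'm)
       (lact :: nat \<Rightarrow> nat \<Rightarrow> ('m \<times> 'h \<Rightarrow> 'k) set \<Rightarrow> 'm \<Rightarrow> 'm)
       (ract :: nat \<Rightarrow> nat \<Rightarrow> 'm \<Rightarrow> ('h \<times> 'm \<Rightarrow> 'k) set \<Rightarrow> 'm).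
        let rpact = (\<lambda>j r h. pact j h r);
            lhash = (\<lambda>i. left_hash K H \<Delta> (R i) (pact i));
            rhash = (\<lambda>j. right_hash K (op_algebra H) \<Delta> (R j) (rpact j))
        in
        (\<forall>i\<in>{1..n}. left_partial_action K H \<Delta> (R i) (pact i)) \<and>
        (\<forall>i\<in>{1..n}. \<forall>j\<in>{1..n}.
           left_module_over K (left_smash K H \<Delta> (R i) (pact i)) (M i j) (lact i j) \<and>
           right_module_over K (right_smash K (op_algebra H) \<Delta> (R j) (rpact j)) (M i j) (ract i j) \<and>
           (\<forall>h\<in>carrier H. \<forall>m\<in>carrier (M i j).
              lact i j (lhash i \<one>\<^bsub>R i\<^esub> h) m = ract i j m (rhash j h \<one>\<^bsub>R j\<^esub>)) \<and>
           (\<forall>h\<in>carrier H. \<forall>r\<in>carrier (R i). lact i i (lhash i \<one>\<^bsub>R i\<^esub> h) r = pact i h r) \<and>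
           (\<forall>r\<in>carrier (R i). \<forall>m\<in>carrier (M i j). lact i j (lhash i r \<one>\<^bsub>H\<^esub>) m = \<theta> i i j r m) \<and>
           (\<forall>r\<in>carrier (R j). \<forall>m\<in>carrier (M i j). ract i j m (rhash j \<one>\<^bsub>H\<^esub> r) = \<theta> i j j m r)) \<and>
        (\<forall>i\<in>{1..n}. \<forall>j\<in>{1..n}. \<forall>k\<in>{1..n}.
           \<forall>h\<in>carrier H. \<forall>m\<in>carrier (M i j). \<forall>x\<in>carrier (M j k).
             lact i k (lhash i \<one>\<^bsub>R i\<^esub> h) (\<theta> i j k m x) =
             sweedler K H \<Delta> (M i k)
               (\<lambda>h\<^sub>1 h\<^sub>2. \<theta> i j k (lact i j (lhash i \<one>\<^bsub>R i\<^esub> h\<^sub>1) m) (lact j k (lhash j \<one>\<^bsub>R j\<^esub> h\<^sub>2) x)) h))"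
  (is "?matrix \<longleftrightarrow> ?smash")
proof -
  interpret HM: hopf_matrix_algebra K H \<Delta> \<epsilon> S n M \<theta> \<eta>
    using hopf gma by (rule hopf_matrix_algebra.intro)
  let ?blockwise = "\<exists>D. blockwise_partial_action K H \<Delta> \<epsilon> S n M \<theta> \<eta> D"
  have "?matrix \<longleftrightarrow> ?blockwise"
  proof
    assume ?matrix
    then obtain act where act: "left_partial_action K H \<Delta> (matrix_algebra K n M \<theta> \<eta>) act"
      and inv: "\<And>i j. \<lbrakk>i \<in> {1..n}; j \<in> {1..n}\<rbrakk> \<Longrightarrow> invariant_under H act (block n M i j)" by blast
    show ?blockwise by (rule exI, rule HM.invariant_action_blockwise[OF act inv])
  next
    assume ?blockwise
    then obtain D where "blockwise_partial_action K H \<Delta> \<epsilon> S n M \<theta> \<eta> D" ..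
    then interpret B: blockwise_partial_action K H \<Delta> \<epsilon> S n M \<theta> \<eta> D .
    show ?matrix using B.matrix_action_partial_action B.matrix_action_invariant by blast
  qed
  also have "\<dots> \<longleftrightarrow> ?smash"
  proof
    assume ?blockwise
    then obtain D where "blockwise_partial_action K H \<Delta> \<epsilon> S n M \<theta> \<eta> D" ..
    then interpret B: blockwise_partial_action K H \<Delta> \<epsilon> S n M \<theta> \<eta> D .
    let ?lhash = "\<lambda>i. left_hash K H \<Delta> (R i) (D i i)"
    have hash: "B.left_block_act i j (?lhash i \<one>\<^bsub>R i\<^esub> h) m = D i j h m"
      if "i \<in> {1..n}" "j \<in> {1..n}" "h \<in> carrier H" "m \<in> carrier (M i j)" for i j h m
      using that by (simp add: R_def B.left_block_act(2))
    have mult: "B.left_block_act i k (?lhash i \<one>\<^bsub>R i\<^esub> h) (\<theta> i j k m x) = sweedler K H \<Delta> (M i k)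
        (\<lambda>h\<^sub>1 h\<^sub>2. \<theta> i j k (B.left_block_act i j (?lhash i \<one>\<^bsub>R i\<^esub> h\<^sub>1) m)
          (B.left_block_act j k (?lhash j \<one>\<^bsub>R j\<^esub> h\<^sub>2) x)) h"
      if ijk: "i \<in> {1..n}" "j \<in> {1..n}" "k \<in> {1..n}" and h: "h \<in> carrier H"
        and mx: "m \<in> carrier (M i j)" "x \<in> carrier (M j k)" for i j k h m x
    proof -
      have "B.left_block_act i k (?lhash i \<one>\<^bsub>R i\<^esub> h) (\<theta> i j k m x)
          = sweedler K H \<Delta> (M i k) (\<lambda>h\<^sub>1 h\<^sub>2. \<theta> i j k (D i j h\<^sub>1 m) (D j k h\<^sub>2 x)) h"
        using ijk h mx by (simp add: hash B.D_theta)
      also have "\<dots> = sweedler K H \<Delta> (M i k)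
        (\<lambda>h\<^sub>1 h\<^sub>2. \<theta> i j k (B.left_block_act i j (?lhash i \<one>\<^bsub>R i\<^esub> h\<^sub>1) m)
          (B.left_block_act j k (?lhash j \<one>\<^bsub>R j\<^esub> h\<^sub>2) x)) h"
        using ijk h mx by (intro HM.sweedler_cong HM.vector_space) (simp_all add: hash)
      finally show ?thesis .
    qed
    show ?smash unfolding Let_def
      by (intro exI[of _ "\<lambda>i. D i i"] exI[of _ B.left_block_act] exI[of _ B.right_block_act] conjI ballI mult)
        (simp_all add: R_def B.diag_partial_action B.left_block_act B.right_block_act B.D_one)
  next
    assume ?smash
    then show ?blockwise unfolding Let_def R_def
    proof (elim exE conjE, goal_cases)
      case (1 pact lact ract)
      show ?case
        by (rule exI, rule HM.smash_modules_blockwise[of pact lact ract]) (use 1 in blast)+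
    qed
  qed
  finally show ?thesis .
qed

end
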